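(* (a) Let $\Gamma$ be obtained from a connected graph $\Gamma'$ by adding an edge $e$ such that $\Gamma'\cap e$ is a single point. Then $H_2(F(\Gamma',2))\cong H_2(F(\Gamma,2))$ and the difference $b_1(F(\Gamma,2))-b_1(F(\Gamma',2))$ equals $2\mu(v)-2$, where $\mu(v)$ denotes the valence in $\Gamma'$ of the vertex $v$ of $\Gamma'$ which is incident to the newly attached edge $e$. (b) Let $\Gamma$ be obtained from a graph $\Gamma'$ having two connected components $\Gamma'=\Gamma'_1\sqcup\Gamma'_2$ by adding an edge $e$ connecting the components $\Gamma'_1$ and $\Gamma'_2$. Then $$b_2(F(\Gamma,2))=b_2(F(\Gamma'_1,2))+b_2(F(\Gamma'_2,2))+2b_1(\Gamma'_1)b_1(\Gamma'_2).$$
   Context: A graph means a finite 1-dimensional simplicial complex. For a topological space $X$, $F(X,2)=\{(x,y)\in X\times X: x\neq y\}$ is the configuration space of two distinct points of $X$. Homology is taken with integer coefficients and $b_i(X)$ denotes the rank of $H_i(X)$ (the $i$-th Betti number). The valence of a vertex is the number of edges incident to it. An added edge is attached at vertices: in (a) one endpoint of $e$ is the vertex $v$ of $\Gamma'$ and the rest of $e$ is disjoint from $\Gamma'$; in (b) one endpoint of $e$ is a vertex of $\Gamma'_1$ and the other is a vertex of $\Gamma'_2$.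
   Formalization: In (a) the formula for the difference of b_1 is not claimed when Γ' is homeomorphic to a closed interval and v is an interior vertex (valence 2): there it is false, since the difference is 1 and not 2 (Γ is then the letter Y). *)

theory Defs
  imports "HOL-Analysis.Analysis" "HOL-Homology.Homology"
begin

text \<open>
  A graph is a finite simplicial complex of dimension exactly one, realized linearly in some
  Euclidean space; every finite abstract graph has such a realization (in dimension three).
  The underlying space of a complex \<open>K\<close> is \<open>\<Union>K\<close>. As in the library,
  a nonempty simplicial complex contains the empty simplex.
\<close>

definition graph_complex :: "'a::euclidean_space set set \<Rightarrow> bool" where
  "graph_complex K \<longleftrightarrow>
     simplicial_complex K \<and> (\<forall>S\<in>K. aff_dim S \<le> 1) \<and> (\<exists>S\<in>K. aff_dim S = 1)"

definition valence :: "'a::euclidean_space set set \<Rightarrow> 'a \<Rightarrow> nat" where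
  "valence K v = card {e \<in> K. 1 simplex e \<and> {v} face_of e}"

text \<open>
  \<open>K\<close> arises from \<open>K'\<close> by adding the edge \<open>e\<close> together with its endpoints. As \<open>K\<close> is
  again a simplicial complex, \<open>e\<close> can meet the space of \<open>K'\<close> only in vertices.
\<close>

definition adds_edge ::
    "'a::euclidean_space set set \<Rightarrow> 'a set set \<Rightarrow> 'a set \<Rightarrow> bool" where
  "adds_edge K' K e \<longleftrightarrow>
     graph_complex K' \<and> graph_complex K \<and> 1 simplex e \<and> e \<notin> K' \<and>
     K = K' \<union> {F. F face_of e}"

definition config2 :: "'a topology \<Rightarrow> ('a \<times> 'a) topology" where
  "config2 X = subtopology (prod_topology X X) {(x, y). x \<noteq> y}"

definition Z_independent :: "('g, 'm) monoid_scheme \<Rightarrow> 'g set \<Rightarrow> bool" where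
  "Z_independent G B \<longleftrightarrow> finite B \<and> B \<subseteq> carrier G \<and>
     (\<forall>c :: 'g \<Rightarrow> int.
        finprod G (\<lambda>b. b [^]\<^bsub>G\<^esub> c b) B = \<one>\<^bsub>G\<^esub> \<longrightarrow> (\<forall>b\<in>B. c b = 0))"

text \<open>
  The rank of an abelian group, as a natural number: meaningful only when the rank is finite,
  since \<open>Max\<close> of an infinite set is unspecified.
\<close>

definition group_rank :: "('g, 'm) monoid_scheme \<Rightarrow> nat" where
  "group_rank G = Max {card B | B. Z_independent G B}"

definition betti :: "int \<Rightarrow> 'a topology \<Rightarrow> nat" where
  "betti i X = group_rank (homology_group i X)"

end

theory Submission
  imports Defs
begin

text \<open>Both parts concern a graph \<open>Y\<close> made of two disjoint pieces \<open>S1\<close> and \<open>S2\<close> and a segment, the bridge, from \<open>a\<close> in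
\<open>S1\<close> to \<open>b\<close> in \<open>S2\<close>; in part (a) the piece \<open>S2\<close> is the single new endpoint. Collapsing the bridge and everything
behind it gives retractions \<open>r1\<close> and \<open>r2\<close> of \<open>Y\<close> onto \<open>S1\<close> and \<open>S2\<close>, and the position along the bridge gives a
height \<open>h\<close> from \<open>Y\<close> to the unit interval. The space \<open>F\<close> of ordered pairs of distinct points of \<open>Y\<close> is covered by
two open sets. On \<open>P\<close> both points can be slid along the bridge into the same piece without a collision, so \<open>P\<close> is
equivalent to the disjoint union of the configuration spaces of \<open>S1\<close> and \<open>S2\<close>. On \<open>Q\<close> the two points have different
heights and can be slid apart to opposite ends, so \<open>Q\<close> is equivalent to two copies of \<open>S1 \<times> S2\<close>. In the
intersection one point is on the open bridge and the other lies in a piece, off the attaching point: up to equivalence,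
\<open>P \<inter> Q\<close> consists of two copies of \<open>S1 - {a}\<close> and two copies of \<open>S2 - {b}\<close>.

In degree one, no nonzero class of \<open>P \<inter> Q\<close> dies in \<open>Q\<close>: applying \<open>r1\<close> or \<open>r2\<close> to one of the two points
gives four maps defined on all of \<open>Q\<close>, each of which is constant on three of the four parts of \<open>P \<inter> Q\<close> and
is, on the remaining one, the projection followed by the inclusion of \<open>S1 - {a}\<close> into \<open>S1\<close> or of \<open>S2 - {b}\<close> into
\<open>S2\<close>. Removing a vertex from a graph removes a contractible star whose punctured version is a disjoint union of open
edges, so this inclusion is injective in positive degrees. This is \<open>common_ker_1\<close>.

The Mayer--Vietoris sequence of \<open>P\<close> and \<open>Q\<close> then splits at \<open>H\<^sub>1 (P \<inter> Q)\<close>. In degree two it yields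
\<open>betti_2_bridge\<close>, and with the product formula \<open>betti_2_product\<close> this is part (b). If \<open>S2\<close> is a point, the same
sequence shows that the inclusion of \<open>P\<close> is an isomorphism in degree two, which is the first claim of part (a)
(\<open>homology_2_bridge_point\<close>). In degrees one and zero the kernel terms of degree zero cancel in the difference of the
two counts and leave \<open>b\<^sub>1 (F) - b\<^sub>0 (F)\<close> (\<open>betti_1_0_bridge\<close>). So the second claim of part (a) is
equivalent to the statement that adding the edge does not change the number of components of the configuration space.
At a vertex of valence one this follows from the sequence in degree zero. At a vertex of valence at least two both
configuration spaces are path-connected, unless the graph is an arc: at three edges the two points can be interchanged
directly (\<open>path_connected_conf_3\<close>), and with two edges one uses that a graph seen from a leaf is an arc or contains a
place where two points can pass each other (\<open>leaf_dichotomy\<close>, \<open>path_connected_conf_2\<close>).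

Counting ranks in exact sequences needs all of them to be finite. The spaces that occur are unions of finitely many
compact convex sets with the zeros of an affine map removed, and \<open>finite_rank_pieces\<close> covers all of them at once.\<close>

section \<open>Ranks of abelian groups\<close>

text \<open>Indexed families, unlike sets, survive the application of a homomorphism without bookkeeping
  about coinciding images.\<close>

definition independent_family :: "('g, 'm) monoid_scheme \<Rightarrow> ('i \<Rightarrow> 'g) \<Rightarrow> 'i set \<Rightarrow> bool" where
  "independent_family G x I \<longleftrightarrow> finite I \<and> x \<in> I \<rightarrow> carrier G \<and>
     (\<forall>c :: 'i \<Rightarrow> int.
        finprod G (\<lambda>i. x i [^]\<^bsub>G\<^esub> c i) I = \<one>\<^bsub>G\<^esub> \<longrightarrow> (\<forall>i\<in>I. c i = 0))"

definition finite_rank_on :: "('g, 'm) monoid_scheme \<Rightarrow> 'g set \<Rightarrow> bool" where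
  "finite_rank_on G S \<longleftrightarrow> (\<exists>N. \<forall>B. Z_independent G B \<longrightarrow> B \<subseteq> S \<longrightarrow> card B \<le> N)"

definition rank_on :: "('g, 'm) monoid_scheme \<Rightarrow> 'g set \<Rightarrow> nat" where
  "rank_on G S = Max {card B | B. Z_independent G B \<and> B \<subseteq> S}"

abbreviation finite_rank :: "('g, 'm) monoid_scheme \<Rightarrow> bool" where
  "finite_rank G \<equiv> finite_rank_on G (carrier G)"

lemma group_rank_eq_rank_on: "group_rank G = rank_on G (carrier G)"
proof -
  have "{card B | B. Z_independent G B} = {card B | B. Z_independent G B \<and> B \<subseteq> carrier G}"
    by (auto simp: Z_independent_def)
  then show ?thesis
    by (simp add: group_rank_def rank_on_def)
qed

lemma Z_independent_iff_family: "Z_independent G B \<longleftrightarrow> independent_family G (\<lambda>b. b) B"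
  by (auto simp: Z_independent_def independent_family_def)

lemma independent_familyD:
  assumes "independent_family G x I" "finprod G (\<lambda>i. x i [^]\<^bsub>G\<^esub> (c i :: int)) I = \<one>\<^bsub>G\<^esub>" "i \<in> I"
  shows "c i = 0"
  using assms unfolding independent_family_def by blast

lemma independent_family_cong:
  assumes "comm_group G" "\<And>i. i \<in> I \<Longrightarrow> x i = y i"
  shows "independent_family G x I \<longleftrightarrow> independent_family G y I"
proof -
  interpret comm_group G by fact
  have "finprod G (\<lambda>i. x i [^]\<^bsub>G\<^esub> (c i :: int)) I = finprod G (\<lambda>i. y i [^]\<^bsub>G\<^esub> c i) I"
    if "y \<in> I \<rightarrow> carrier G" for c
    using assms(2) that by (intro finprod_cong') auto
  moreover have "x \<in> I \<rightarrow> carrier G \<longleftrightarrow> y \<in> I \<rightarrow> carrier G"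
    using assms(2) by (auto simp: Pi_iff)
  ultimately show ?thesis unfolding independent_family_def by metis
qed

context comm_group
begin

lemma finprod_int_pow:
  assumes "finite I" "x \<in> I \<rightarrow> carrier G"
  shows "finprod G x I [^] (n::int) = finprod G (\<lambda>i. x i [^] n) I"
  using assms
  by (induction I rule: finite_induct) (auto simp: int_pow_distrib Pi_iff)

lemma finprod_of_finprods:
  assumes "finite I" "finite K" and x: "x \<in> I \<rightarrow> carrier G"
  shows "finprod G (\<lambda>k. finprod G (\<lambda>i. x i [^] (c k i :: int)) I [^] (d k :: int)) K
       = finprod G (\<lambda>i. x i [^] (\<Sum>k\<in>K. d k * c k i)) I"
  using assms(2)
proof (induction K rule: finite_induct)
  case empty
  then show ?case by simp
next
  case (insert k K)
  have [simp]: "\<And>i n. i \<in> I \<Longrightarrow> x i [^] (n::int) \<in> carrier G"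
    using x by auto
  have "finprod G (\<lambda>k. finprod G (\<lambda>i. x i [^] c k i) I [^] d k) (insert k K)
      = finprod G (\<lambda>i. (x i [^] c k i) [^] d k) I \<otimes> finprod G (\<lambda>i. x i [^] (\<Sum>k\<in>K. d k * c k i)) I"
    using insert assms(1) by (subst finprod_insert) (auto simp: finprod_int_pow Pi_iff)
  also have "\<dots> = finprod G (\<lambda>i. (x i [^] c k i) [^] d k \<otimes> x i [^] (\<Sum>k\<in>K. d k * c k i)) I"
    by (subst finprod_multf) auto
  also have "\<dots> = finprod G (\<lambda>i. x i [^] (\<Sum>k\<in>insert k K. d k * c k i)) I"
    using x insert(1,2)
    by (intro finprod_cong') (auto simp: int_pow_pow int_pow_mult mult.commute Pi_iff)
  finally show ?case .
qed

lemma independent_family_inj_on: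
  fixes x :: "'i \<Rightarrow> 'a"
  assumes "independent_family G x I"
  shows "inj_on x I"
proof (rule inj_onI, rule ccontr)
  fix i j assume ij: "i \<in> I" "j \<in> I" "x i = x j" "i \<noteq> j"
  define c :: "'i \<Rightarrow> int" where "c k = (if k = i then 1 else if k = j then -1 else 0)" for k
  have x: "x \<in> I \<rightarrow> carrier G" "finite I" using assms by (auto simp: independent_family_def)
  have "finprod G (\<lambda>k. x k [^] c k) I = finprod G (\<lambda>k. x k [^] c k) {i,j}"
    using x ij by (intro finprod_mono_neutral_cong_right) (auto simp: c_def)
  also have "\<dots> = \<one>"
    using x ij by (auto simp: c_def Pi_iff int_pow_neg)
  finally show False
    using independent_familyD[OF assms, of c i] ij by (simp add: c_def)
qed

lemma independent_family_image:
  assumes "independent_family G x I"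
  shows "Z_independent G (x ` I)" "card (x ` I) = card I"
proof -
  have inj: "inj_on x I" using assms by (rule independent_family_inj_on)
  then show "card (x ` I) = card I" by (rule card_image)
  have x: "x \<in> I \<rightarrow> carrier G" "finite I" using assms by (auto simp: independent_family_def)
  show "Z_independent G (x ` I)"
    unfolding Z_independent_def
  proof (intro conjI allI impI)
    fix c :: "'a \<Rightarrow> int" assume c: "finprod G (\<lambda>b. b [^] c b) (x ` I) = \<one>"
    have "finprod G (\<lambda>b. b [^] c b) (x ` I) = finprod G (\<lambda>i. x i [^] c (x i)) I"
      using x inj by (intro finprod_reindex) auto
    with c have "\<forall>i\<in>I. c (x i) = 0"
      using independent_familyD[OF assms, of "\<lambda>i. c (x i)"] by simp
    then show "\<forall>b\<in>x ` I. c b = 0" by auto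
  qed (use x in auto)
qed

lemma independent_family_empty: "independent_family G x {}"
  by (auto simp: independent_family_def)

lemma card_le_rank_on:
  assumes "finite_rank_on G S" "independent_family G x I" "x ` I \<subseteq> S"
  shows "card I \<le> rank_on G S"
proof -
  obtain N where N: "\<And>B. Z_independent G B \<Longrightarrow> B \<subseteq> S \<Longrightarrow> card B \<le> N"
    using assms(1) by (auto simp: finite_rank_on_def)
  have "finite {card B | B. Z_independent G B \<and> B \<subseteq> S}"
    by (rule finite_subset[of _ "{..N}"]) (use N in auto)
  moreover have "card I \<in> {card B | B. Z_independent G B \<and> B \<subseteq> S}"
    using independent_family_image[OF assms(2)] assms(3) by (metis (mono_tags, lifting) mem_Collect_eq)
  ultimately show ?thesis unfolding rank_on_def by (rule Max_ge)
qed

lemma rank_on_attained: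
  assumes "finite_rank_on G S"
  obtains B where "independent_family G (\<lambda>b. b) B" "B \<subseteq> S" "card B = rank_on G S"
proof -
  obtain N where N: "\<And>B. Z_independent G B \<Longrightarrow> B \<subseteq> S \<Longrightarrow> card B \<le> N"
    using assms(1) by (auto simp: finite_rank_on_def)
  have "finite {card B | B. Z_independent G B \<and> B \<subseteq> S}"
    by (rule finite_subset[of _ "{..N}"]) (use N in auto)
  moreover have "{card B | B. Z_independent G B \<and> B \<subseteq> S} \<noteq> {}"
    using independent_family_empty Z_independent_iff_family by blast
  ultimately have "rank_on G S \<in> {card B | B. Z_independent G B \<and> B \<subseteq> S}"
    unfolding rank_on_def by (rule Max_in)
  then show ?thesis using that by (auto simp: Z_independent_iff_family)
qed

lemma finite_rank_onI:
  assumes "\<And>B. independent_family G (\<lambda>b. b) B \<Longrightarrow> B \<subseteq> S \<Longrightarrow> card B \<le> N"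
  shows "finite_rank_on G S" "rank_on G S \<le> N"
proof -
  show *: "finite_rank_on G S"
    using assms by (auto simp: finite_rank_on_def Z_independent_iff_family)
  show "rank_on G S \<le> N"
    using rank_on_attained[OF *] assms by metis
qed

lemma finite_rank_on_subset:
  assumes "finite_rank_on G S" "T \<subseteq> S"
  shows "finite_rank_on G T" "rank_on G T \<le> rank_on G S"
proof -
  have "card B \<le> rank_on G S" if "independent_family G (\<lambda>b. b) B" "B \<subseteq> T" for B
    using card_le_rank_on[OF assms(1) that(1)] that assms by auto
  then show "finite_rank_on G T" "rank_on G T \<le> rank_on G S"
    using finite_rank_onI[of T "rank_on G S"] by blast+
qed

lemma rank_on_one: "finite_rank_on G {\<one>}" "rank_on G {\<one>} = 0"
proof -
  have "card B \<le> 0" if B: "independent_family G (\<lambda>b. b) B" "B \<subseteq> {\<one>}" for B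
  proof -
    have "finprod G (\<lambda>b. b [^] (1::int)) B = \<one>"
      using B by (intro finprod_one_eqI) auto
    then have "B = {}"
      using independent_familyD[OF B(1), of "\<lambda>_. 1"] by auto
    then show ?thesis by simp
  qed
  then show "finite_rank_on G {\<one>}" "rank_on G {\<one>} = 0"
    using finite_rank_onI[of "{\<one>}" 0] by auto
qed

end

lemma hom_finprod_int_pow:
  assumes "comm_group G" "comm_group H" "f \<in> hom G H" "finite I" "x \<in> I \<rightarrow> carrier G"
  shows "f (finprod G (\<lambda>i. x i [^]\<^bsub>G\<^esub> (c i :: int)) I) = finprod H (\<lambda>i. f (x i) [^]\<^bsub>H\<^esub> c i) I"
  using assms(4,5)
proof (induction I rule: finite_induct)
  interpret G: comm_group G by fact
  interpret H: comm_group H by fact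
  interpret group_hom G H f using assms(3) by unfold_locales
  have f: "x \<in> carrier G \<Longrightarrow> f x \<in> carrier H" for x using assms(3) by (auto simp: hom_def)
  {
    case empty
    then show ?case by simp
  next
    case (insert i I)
    then show ?case
      using f by (simp add: Pi_iff hom_int_pow)
  }
qed

text \<open>An independent family can be traded for one that splits into a part with independent image and
  a part in the kernel: fix a maximal subfamily \<open>J\<close> with independent image; every other member has a
  nonzero multiple whose image depends on the image of \<open>J\<close>, and correcting this multiple by a combination of \<open>J\<close>
  moves it into the kernel.\<close>

lemma independent_family_split:
  fixes x :: "'i \<Rightarrow> 'g"
  assumes "comm_group G" "comm_group H" "f \<in> hom G H" and x: "independent_family G x I"
  obtains J y where "J \<subseteq> I" "independent_family H (f \<circ> x) J"
    "independent_family G y (I - J)" "y ` (I - J) \<subseteq> kernel G H f"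
proof -
  interpret G: comm_group G by fact
  interpret H: comm_group H by fact
  interpret group_hom G H f using assms(3) by unfold_locales
  have fin: "finite I" and xc: "x \<in> I \<rightarrow> carrier G" using x by (auto simp: independent_family_def)
  let ?\<J> = "{J. J \<subseteq> I \<and> independent_family H (f \<circ> x) J}"
  have "finite ?\<J>" using fin by (auto intro: finite_subset[of _ "Pow I"])
  moreover have "{} \<in> ?\<J>" by (simp add: H.independent_family_empty)
  ultimately obtain J where J: "J \<in> ?\<J>" and Jeq: "card J = Max (card ` ?\<J>)"
    using Max_in[of "card ` ?\<J>"] by (metis (no_types, lifting) empty_iff finite_imageI image_iff)
  have Jmax: "card J' \<le> card J" if "J' \<in> ?\<J>" for J'
    unfolding Jeq using that \<open>finite ?\<J>\<close> by (intro Max_ge) auto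
  have finJ: "finite J" using J fin finite_subset by auto
  have fxc: "f (x i) \<in> carrier H" if "i \<in> I" for i using xc that by (auto intro!: hom_closed)
  have fx: "f \<circ> x \<in> I \<rightarrow> carrier H" using xc by (auto intro!: hom_closed)
  have "\<exists>c :: 'i \<Rightarrow> int. c i \<noteq> 0 \<and> (\<forall>j. j \<notin> insert i J \<longrightarrow> c j = 0) \<and>
          finprod H (\<lambda>j. f (x j) [^]\<^bsub>H\<^esub> c j) I = \<one>\<^bsub>H\<^esub>" if i: "i \<in> I - J" for i
  proof -
    have "\<not> independent_family H (f \<circ> x) (insert i J)"
      using Jmax[of "insert i J"] i J finJ by auto
    then obtain c :: "'i \<Rightarrow> int" where
      c: "finprod H (\<lambda>j. f (x j) [^]\<^bsub>H\<^esub> c j) (insert i J) = \<one>\<^bsub>H\<^esub>" and nz: "\<exists>j\<in>insert i J. c j \<noteq> 0"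
      using finJ fx i J by (auto simp: independent_family_def)
    define c' where "c' j = (if j \<in> insert i J then c j else 0)" for j
    have "finprod H (\<lambda>j. f (x j) [^]\<^bsub>H\<^esub> c' j) I = finprod H (\<lambda>j. f (x j) [^]\<^bsub>H\<^esub> c j) (insert i J)"
      using fin i J fxc by (intro H.finprod_mono_neutral_cong_right) (auto simp: c'_def)
    moreover have "c i \<noteq> 0"
    proof
      assume "c i = 0"
      then have "finprod H (\<lambda>j. f (x j) [^]\<^bsub>H\<^esub> c j) J = \<one>\<^bsub>H\<^esub>"
        using c i finJ fxc J by (subst (asm) H.finprod_insert) (auto simp: Pi_iff subset_iff)
      then have "\<forall>j\<in>J. c j = 0" using J by (auto simp: independent_family_def)
      with nz \<open>c i = 0\<close> show False by auto
    qed
    ultimately show ?thesis using c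
      by (intro exI[of _ c']) (auto simp: c'_def)
  qed
  then obtain c :: "'i \<Rightarrow> 'i \<Rightarrow> int" where ci: "\<And>i. i \<in> I - J \<Longrightarrow> c i i \<noteq> 0"
    and c0: "\<And>i j. i \<in> I - J \<Longrightarrow> j \<notin> insert i J \<Longrightarrow> c i j = 0"
    and c1: "\<And>i. i \<in> I - J \<Longrightarrow> finprod H (\<lambda>j. f (x j) [^]\<^bsub>H\<^esub> c i j) I = \<one>\<^bsub>H\<^esub>"
    by metis
  define y where "y i = finprod G (\<lambda>j. x j [^]\<^bsub>G\<^esub> c i j) I" for i
  have yc: "y i \<in> carrier G" for i
    unfolding y_def using xc by (intro G.finprod_closed) auto
  have "y i \<in> kernel G H f" if "i \<in> I - J" for i
    using c1[OF that] yc fin xc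
    by (auto simp: kernel_def y_def hom_finprod_int_pow[OF assms(1-3)])
  moreover have "independent_family G y (I - J)"
    unfolding independent_family_def
  proof (intro conjI allI impI)
    fix d :: "'i \<Rightarrow> int" assume d: "finprod G (\<lambda>i. y i [^]\<^bsub>G\<^esub> d i) (I - J) = \<one>\<^bsub>G\<^esub>"
    have "finprod G (\<lambda>i. y i [^]\<^bsub>G\<^esub> d i) (I - J) =
          finprod G (\<lambda>j. x j [^]\<^bsub>G\<^esub> (\<Sum>i\<in>I-J. d i * c i j)) I"
      unfolding y_def using fin xc by (intro G.finprod_of_finprods) auto
    with d have "finprod G (\<lambda>j. x j [^]\<^bsub>G\<^esub> (\<Sum>i\<in>I-J. d i * c i j)) I = \<one>\<^bsub>G\<^esub>" by simp
    then have s0: "\<And>j. j \<in> I \<Longrightarrow> (\<Sum>i\<in>I-J. d i * c i j) = 0"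
      by (rule independent_familyD[OF x])
    show "\<forall>i\<in>I - J. d i = 0"
    proof
      fix k assume k: "k \<in> I - J"
      have "(\<Sum>i\<in>I-J. d i * c i k) = (\<Sum>i\<in>{k}. d i * c i k)"
        using k fin c0 by (intro sum.mono_neutral_right) auto
      then show "d k = 0" using s0[of k] ci[OF k] k by auto
    qed
  qed (use fin yc in auto)
  ultimately show ?thesis using J by (intro that[of J y]) auto
qed

text \<open>A relation between all members, pushed through \<open>f\<close>, is a relation between the images of the second part and hence
trivial there; what is left is a relation in the kernel.\<close>

lemma independent_family_join:
  fixes y :: "'i \<Rightarrow> 'g" and x :: "'j \<Rightarrow> 'g"
  assumes "comm_group G" "comm_group H" "f \<in> hom G H"
    and y: "independent_family G y J" "y ` J \<subseteq> kernel G H f"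
    and x: "independent_family H (f \<circ> x) K" "x \<in> K \<rightarrow> carrier G"
  shows "independent_family G (case_sum y x) (J <+> K)"
proof -
  interpret G: comm_group G by fact
  interpret H: comm_group H by fact
  interpret group_hom G H f using assms(3) by unfold_locales
  have yc: "y \<in> J \<rightarrow> carrier G" and fin: "finite J" "finite K"
    using x y by (auto simp: independent_family_def)
  show ?thesis
    unfolding independent_family_def
  proof (intro conjI allI impI)
    fix c :: "'i + 'j \<Rightarrow> int"
    let ?F = "\<lambda>i. case_sum y x i [^]\<^bsub>G\<^esub> c i"
    assume c: "finprod G ?F (J <+> K) = \<one>\<^bsub>G\<^esub>"
    let ?u = "finprod G (\<lambda>j. y j [^]\<^bsub>G\<^esub> c (Inl j)) J" and ?v = "finprod G (\<lambda>j. x j [^]\<^bsub>G\<^esub> c (Inr j)) K"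
    have uv: "?u \<in> carrier G" "?v \<in> carrier G"
      using x yc by (auto intro!: G.finprod_closed)
    have "finprod G ?F (J <+> K) = finprod G ?F (Inl ` J) \<otimes>\<^bsub>G\<^esub> finprod G ?F (Inr ` K)"
      unfolding Plus_def using fin x(2) yc by (intro G.finprod_Un_disjoint) (auto simp: Pi_iff)
    moreover have "finprod G ?F (Inl ` J) = ?u"
      using yc by (subst G.finprod_reindex) (auto simp: Pi_iff)
    moreover have "finprod G ?F (Inr ` K) = ?v"
      using x(2) by (subst G.finprod_reindex) (auto simp: Pi_iff)
    ultimately have 1: "?u \<otimes>\<^bsub>G\<^esub> ?v = \<one>\<^bsub>G\<^esub>" using c by simp
    have fu: "f ?u = \<one>\<^bsub>H\<^esub>"
      using fin yc y(2) by (auto simp: hom_finprod_int_pow[OF assms(1-3)] kernel_def intro!: H.finprod_one_eqI)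
    have "f ?u \<otimes>\<^bsub>H\<^esub> f ?v = \<one>\<^bsub>H\<^esub>" using 1 uv by (metis hom_mult hom_one)
    then have "f ?v = \<one>\<^bsub>H\<^esub>" using fu uv by simp
    then have K0: "\<forall>j\<in>K. c (Inr j) = 0"
      using x(2) fin independent_familyD[OF x(1), of "\<lambda>j. c (Inr j)"]
      by (simp add: hom_finprod_int_pow[OF assms(1-3)])
    then have "?v = \<one>\<^bsub>G\<^esub>" by (intro G.finprod_one_eqI) auto
    then have "?u = \<one>\<^bsub>G\<^esub>" using 1 uv by simp
    then have "\<forall>j\<in>J. c (Inl j) = 0" using independent_familyD[OF y(1), of "\<lambda>j. c (Inl j)"] by simp
    with K0 show "\<forall>i\<in>J <+> K. c i = 0" by auto
  qed (use fin x yc in auto)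
qed

text \<open>Splitting an independent family gives the upper bound for the rank, joining families the lower bound. Finiteness of
the rank of the whole group is a conclusion, so that it can be propagated along exact sequences.\<close>

theorem rank_nullity:
  assumes G: "comm_group G" "comm_group H" and f: "f \<in> hom G H"
    and fin: "finite_rank_on G (kernel G H f)" "finite_rank_on H (f ` carrier G)"
  shows "finite_rank G"
    and "group_rank G = rank_on G (kernel G H f) + rank_on H (f ` carrier G)"
proof -
  interpret G: comm_group G by fact
  interpret H: comm_group H by fact
  let ?k = "rank_on G (kernel G H f)" and ?i = "rank_on H (f ` carrier G)"
  have le: "card B \<le> ?k + ?i" if B: "independent_family G (\<lambda>b. b) B" for B
  proof -
    have finB: "finite B" using B by (auto simp: independent_family_def)
    obtain J y where J: "J \<subseteq> B" "independent_family H (f \<circ> (\<lambda>b. b)) J"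
      "independent_family G y (B - J)" "y ` (B - J) \<subseteq> kernel G H f"
      using independent_family_split[OF assms(1-3) B] by metis
    have "card J \<le> ?i"
      using J B by (intro H.card_le_rank_on[OF fin(2) J(2)]) (auto simp: independent_family_def)
    moreover have "card (B - J) \<le> ?k"
      using J by (intro G.card_le_rank_on[OF fin(1) J(3)])
    moreover have "card B = card J + card (B - J)"
      using J(1) finB by (metis Diff_disjoint card_Un_disjoint finite_Diff finite_subset Un_Diff_cancel Un_absorb1)
    ultimately show ?thesis by simp
  qed
  show fG: "finite_rank G" using G.finite_rank_onI(1)[of "carrier G" "?k + ?i"] le by blast
  have 1: "group_rank G \<le> ?k + ?i"
    unfolding group_rank_eq_rank_on using G.finite_rank_onI(2)[of "carrier G" "?k + ?i"] le by blast
  obtain J where J: "independent_family G (\<lambda>b. b) J" "J \<subseteq> kernel G H f" "card J = ?k"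
    using G.rank_on_attained[OF fin(1)] by metis
  obtain L where L: "independent_family H (\<lambda>b. b) L" "L \<subseteq> f ` carrier G" "card L = ?i"
    using H.rank_on_attained[OF fin(2)] by metis
  have "\<forall>l\<in>L. \<exists>x. x \<in> carrier G \<and> f x = l" using L(2) by blast
  then obtain x where x: "\<And>l. l \<in> L \<Longrightarrow> x l \<in> carrier G \<and> f (x l) = l"
    unfolding bchoice_iff by blast
  have finL: "finite L" using L by (auto simp: independent_family_def)
  have "independent_family H (f \<circ> x) L"
    using L x independent_family_cong[OF assms(2), of L "f \<circ> x" "\<lambda>b. b"] by simp
  then have "independent_family G (case_sum (\<lambda>b. b) x) (J <+> L)"
    using J x by (intro independent_family_join[OF assms(1-3)]) auto
  then have "card (J <+> L) \<le> rank_on G (carrier G)"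
    using x J by (intro G.card_le_rank_on[OF fG]) (auto simp: kernel_def)
  then have "?k + ?i \<le> group_rank G"
    using J L finL unfolding group_rank_eq_rank_on
    by (subst (asm) card_Plus) (auto simp: independent_family_def)
  with 1 show "group_rank G = ?k + ?i" by simp
qed

text \<open>Lifting an independent family of the image to preimages keeps it independent.\<close>

lemma finite_rank_image:
  assumes G: "comm_group G" "comm_group H" and f: "f \<in> hom G H" and fin: "finite_rank G"
  shows "finite_rank_on H (f ` carrier G)" "rank_on H (f ` carrier G) \<le> group_rank G"
proof -
  interpret G: comm_group G by fact
  interpret H: comm_group H by fact
  have "card B \<le> group_rank G"
    if B: "independent_family H (\<lambda>b. b) B" "B \<subseteq> f ` carrier G" for B
  proof -
    have "\<forall>l\<in>B. \<exists>x. x \<in> carrier G \<and> f x = l" using B(2) by blast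
    then obtain x where x: "\<And>l. l \<in> B \<Longrightarrow> x l \<in> carrier G \<and> f (x l) = l"
      unfolding bchoice_iff by blast
    have finB: "finite B" using B by (auto simp: independent_family_def)
    have "independent_family H (f \<circ> x) B"
      using B x independent_family_cong[OF assms(2), of B "f \<circ> x" "\<lambda>b. b"] by simp
    then have "independent_family G (case_sum (\<lambda>b. b) x) (({}::'a set) <+> B)"
      using x by (intro independent_family_join[OF assms(1-3)]) (auto simp: G.independent_family_empty)
    then have "card (({}::'a set) <+> B) \<le> rank_on G (carrier G)"
      using x by (intro G.card_le_rank_on[OF fin]) auto
    then show ?thesis by (simp add: group_rank_eq_rank_on card_Plus finB)
  qed
  then show "finite_rank_on H (f ` carrier G)" "rank_on H (f ` carrier G) \<le> group_rank G"
    using H.finite_rank_onI[of "f ` carrier G" "group_rank G"] by blast+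
qed

lemma rank_nullity':
  assumes G: "comm_group G" "comm_group H" and f: "f \<in> hom G H" and fin: "finite_rank G"
  shows "group_rank G = rank_on G (kernel G H f) + rank_on H (f ` carrier G)"
  using rank_nullity(2)[OF assms(1-3)] finite_rank_image(1)[OF assms]
    comm_group.finite_rank_on_subset(1)[OF assms(1) fin, of "kernel G H f"]
  by (auto simp: kernel_def)

lemma rank_iso:
  assumes G: "comm_group G" "comm_group H" and f: "f \<in> iso G H"
  shows "finite_rank G \<longleftrightarrow> finite_rank H" "finite_rank G \<Longrightarrow> group_rank H = group_rank G"
proof -
  interpret G: comm_group G by fact
  interpret H: comm_group H by fact
  have f': "f \<in> hom G H" "f ` carrier G = carrier H" "inj_on f (carrier G)"
    using f by (auto simp: iso_def bij_betw_def)
  then have k: "kernel G H f = {\<one>\<^bsub>G\<^esub>}"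
    by (metis G.group_axioms H.group_axioms group_hom.inj_iff_trivial_ker group_hom_axioms.intro group_hom_def)
  show 1: "finite_rank G \<longleftrightarrow> finite_rank H"
    using rank_nullity(1)[OF G f'(1)] finite_rank_image(1)[OF G f'(1)] G.rank_on_one
    by (auto simp: k f')
  show "group_rank H = group_rank G" if "finite_rank G"
    using rank_nullity'[OF G f'(1) that] by (simp add: k G.rank_on_one f' group_rank_eq_rank_on)
qed

lemma rank_is_iso:
  assumes "comm_group G" "comm_group H" "G \<cong> H"
  shows "finite_rank G \<longleftrightarrow> finite_rank H" "finite_rank G \<Longrightarrow> group_rank H = group_rank G"
  using assms(3) rank_iso[OF assms(1,2)] unfolding is_iso_def by blast+

lemma rank_trivial:
  assumes "comm_group G" "trivial_group G"
  shows "finite_rank G" "group_rank G = 0"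
  using comm_group.rank_on_one[OF assms(1)] assms(2)
  by (auto simp: trivial_group_def group_rank_eq_rank_on)

text \<open>The first projection has the second factor as kernel.\<close>

lemma rank_DirProd:
  assumes "comm_group G" "comm_group H" "finite_rank G" "finite_rank H"
  shows "finite_rank (G \<times>\<times> H)" "group_rank (G \<times>\<times> H) = group_rank G + group_rank H"
proof -
  interpret G: comm_group G by fact
  interpret H: comm_group H by fact
  have P: "comm_group (G \<times>\<times> H)"
    using assms(1,2) by (intro group.group_comm_groupI DirProd_group) (auto simp: G.m_comm H.m_comm)
  have s: "snd \<in> hom (G \<times>\<times> H) H" by (auto simp: hom_def DirProd_def)
  have i: "(\<lambda>x. (x, \<one>\<^bsub>H\<^esub>)) \<in> hom G (G \<times>\<times> H)" by (auto simp: hom_def DirProd_def)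
  have im: "snd ` carrier (G \<times>\<times> H) = carrier H"
    by (auto simp: image_iff intro: bexI[of _ "\<one>\<^bsub>G\<^esub>"])
  have ker: "kernel (G \<times>\<times> H) H snd = (\<lambda>x. (x, \<one>\<^bsub>H\<^esub>)) ` carrier G" by (auto simp: kernel_def)
  have ki: "kernel G (G \<times>\<times> H) (\<lambda>x. (x, \<one>\<^bsub>H\<^esub>)) = {\<one>\<^bsub>G\<^esub>}" by (auto simp: kernel_def)
  have "group_rank G = rank_on (G \<times>\<times> H) (kernel (G \<times>\<times> H) H snd)"
    using rank_nullity'[OF assms(1) P i assms(3)] by (simp add: ki G.rank_on_one ker)
  moreover have "finite_rank_on (G \<times>\<times> H) (kernel (G \<times>\<times> H) H snd)"
    using finite_rank_image[OF assms(1) P i assms(3)] by (simp add: ker)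
  ultimately show "finite_rank (G \<times>\<times> H)" "group_rank (G \<times>\<times> H) = group_rank G + group_rank H"
    using rank_nullity[OF P assms(2) s, unfolded im] assms(4)
    by (simp_all only: group_rank_eq_rank_on[symmetric])
qed

lemma rank_integer_group: "finite_rank integer_group" "group_rank integer_group = 1"
proof -
  interpret Z: comm_group integer_group by (rule abelian_integer_group)
  have fp: "finprod integer_group g {a,b} = g a + g b" if "a \<noteq> b" for g :: "int \<Rightarrow> int" and a b
    using that by (simp add: Z.finprod_insert)
  have le: "card B \<le> 1" if B: "independent_family integer_group (\<lambda>b. b) B" for B
  proof (rule ccontr)
    assume "\<not> card B \<le> 1"
    then have fB: "finite B" and "1 < card B" using B by (auto simp: independent_family_def)
    then obtain a b where ab: "a \<in> B" "b \<in> B" "a \<noteq> b"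
      by (metis card_le_Suc0_iff_eq One_nat_def not_less)
    define c where "c k = (if k = a then b else if k = b then -a else 0)" for k
    have "finprod integer_group (\<lambda>k. k [^]\<^bsub>integer_group\<^esub> c k) B
        = finprod integer_group (\<lambda>k. k [^]\<^bsub>integer_group\<^esub> c k) {a,b}"
      using ab fB by (intro Z.finprod_mono_neutral_cong_right) (auto simp: c_def)
    also have "\<dots> = 0" using ab by (subst fp) (auto simp: c_def)
    finally have "\<forall>k\<in>B. c k = 0" using B by (auto simp: independent_family_def)
    then have "b = 0" "a = 0" using ab by (auto simp: c_def split: if_splits)
    with ab show False by simp
  qed
  show f: "finite_rank integer_group" using Z.finite_rank_onI(1)[of UNIV 1] le by simp
  have "independent_family integer_group (\<lambda>b. b) {1}"
    by (auto simp: independent_family_def Z.finprod_insert)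
  then have "card {1::int} \<le> rank_on integer_group UNIV"
    using f by (intro Z.card_le_rank_on) auto
  moreover have "rank_on integer_group UNIV \<le> 1" using Z.finite_rank_onI(2)[of UNIV 1] le by simp
  ultimately show "group_rank integer_group = 1" by (simp add: group_rank_eq_rank_on)
qed

section \<open>The Mayer--Vietoris sequence\<close>

text \<open>Two long exact sequences joined by homomorphisms, every third of which is bijective. The
  groups \<open>Rp\<close>, \<open>Sp\<close> sit one degree above \<open>C\<close>, \<open>B\<close>, and primed groups sit one degree below.\<close>

locale exact_ladder =
  fixes C A R C' A' B X S B' Rp Sp
    and iA q d iA' iB jA e iB' jB q2 d2 dp ep d2p
  assumes groups: "comm_group C" "comm_group A" "comm_group R" "comm_group C'" "comm_group A'"
      "comm_group B" "comm_group X" "comm_group S" "comm_group B'" "comm_group Rp" "comm_group Sp"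
    and homs: "iA \<in> hom C A" "q \<in> hom A R" "d \<in> hom R C'" "iA' \<in> hom C' A'" "iB \<in> hom C B" "jA \<in> hom A X"
      "iB' \<in> hom C' B'" "jB \<in> hom B X" "q2 \<in> hom X S" "d2 \<in> hom S B'" "dp \<in> hom Rp C" "d2p \<in> hom Sp B"
    and isos: "e \<in> iso R S" "ep \<in> iso Rp Sp"
    and exact: "kernel A R q = iA ` carrier C" "kernel R C' d = q ` carrier A"
      "kernel C' A' iA' = d ` carrier R" "kernel C A iA = dp ` carrier Rp"
      "kernel X S q2 = jB ` carrier B" "kernel S B' d2 = q2 ` carrier X"
      "kernel B X jB = d2p ` carrier Sp"
    and squares: "\<And>c. c \<in> carrier C \<Longrightarrow> jA (iA c) = jB (iB c)"
      "\<And>a. a \<in> carrier A \<Longrightarrow> q2 (jA a) = e (q a)"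
      "\<And>r. r \<in> carrier R \<Longrightarrow> d2 (e r) = iB' (d r)"
      "\<And>r. r \<in> carrier Rp \<Longrightarrow> d2p (ep r) = iB (dp r)"
begin

sublocale C: comm_group C by (rule groups)
sublocale A: comm_group A by (rule groups)
sublocale R: comm_group R by (rule groups)
sublocale C': comm_group C' by (rule groups)
sublocale A': comm_group A' by (rule groups)
sublocale B: comm_group B by (rule groups)
sublocale X: comm_group X by (rule groups)
sublocale S: comm_group S by (rule groups)
sublocale B': comm_group B' by (rule groups)
sublocale Rp: comm_group Rp by (rule groups)
sublocale Sp: comm_group Sp by (rule groups)
sublocale iA: group_hom C A iA by unfold_locales (rule homs)
sublocale q: group_hom A R q by unfold_locales (rule homs)
sublocale d: group_hom R C' d by unfold_locales (rule homs)
sublocale iA': group_hom C' A' iA' by unfold_locales (rule homs)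
sublocale iB: group_hom C B iB by unfold_locales (rule homs)
sublocale jA: group_hom A X jA by unfold_locales (rule homs)
sublocale iB': group_hom C' B' iB' by unfold_locales (rule homs)
sublocale jB: group_hom B X jB by unfold_locales (rule homs)
sublocale q2: group_hom X S q2 by unfold_locales (rule homs)
sublocale d2: group_hom S B' d2 by unfold_locales (rule homs)
sublocale dp: group_hom Rp C dp by unfold_locales (rule homs)
sublocale d2p: group_hom Sp B d2p by unfold_locales (rule homs)
sublocale e: group_hom R S e by unfold_locales (use isos in \<open>auto simp: iso_def\<close>)

lemma e_bij: "inj_on e (carrier R)" "e ` carrier R = carrier S" "ep ` carrier Rp = carrier Sp"
  using isos by (auto simp: iso_def bij_betw_def)

lemma exact_middle:
  assumes "a \<in> carrier A" "b \<in> carrier B" "jA a = jB b"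
  obtains c where "c \<in> carrier C" "iA c = a" "iB c = b"
proof -
  have "jB b \<in> kernel X S q2" unfolding exact using assms by blast
  then have "e (q a) = e \<one>\<^bsub>R\<^esub>" using squares(2)[OF assms(1)] assms by (simp add: kernel_def)
  then have "q a = \<one>\<^bsub>R\<^esub>" using inj_onD[OF e_bij(1), of "q a" "\<one>\<^bsub>R\<^esub>"] assms by simp
  then have "a \<in> kernel A R q" using assms by (simp add: kernel_def)
  then obtain c where c: "c \<in> carrier C" "iA c = a" unfolding exact by blast
  let ?b = "b \<otimes>\<^bsub>B\<^esub> inv\<^bsub>B\<^esub> iB c"
  have "jB ?b = \<one>\<^bsub>X\<^esub>" using assms c squares(1)[of c] by simp
  then have "?b \<in> kernel B X jB" using assms c by (simp add: kernel_def)
  then have "?b \<in> d2p ` carrier Sp" unfolding exact .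
  then have "?b \<in> d2p ` ep ` carrier Rp" unfolding e_bij(3) .
  then obtain r where r: "r \<in> carrier Rp" "d2p (ep r) = ?b" by auto
  then have 1: "iB (dp r) = ?b" using squares(4) by simp
  have "dp r \<in> kernel C A iA" unfolding exact using r by blast
  then have 2: "iA (dp r) = \<one>\<^bsub>A\<^esub>" by (simp add: kernel_def)
  show ?thesis
    using c r assms 1 2 by (intro that[of "c \<otimes>\<^bsub>C\<^esub> dp r"]) (auto simp: B.m_ac)
qed

definition "\<delta> x = d (the_inv_into (carrier R) e (q2 x))"

lemma e_inv: assumes "s \<in> carrier S"
  shows "the_inv_into (carrier R) e s \<in> carrier R" "e (the_inv_into (carrier R) e s) = s"
  using e_bij assms by (auto simp: the_inv_into_into f_the_inv_into_f)

lemma e_inv_eq: "r \<in> carrier R \<Longrightarrow> the_inv_into (carrier R) e (e r) = r"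
  using e_bij by (simp add: the_inv_into_f_f)

lemma delta_hom: "\<delta> \<in> hom X C'"
proof (rule homI)
  fix x y assume xy: "x \<in> carrier X" "y \<in> carrier X"
  let ?r = "the_inv_into (carrier R) e (q2 x)" and ?s = "the_inv_into (carrier R) e (q2 y)"
  have rs: "?r \<in> carrier R" "?s \<in> carrier R" using xy e_inv by auto
  then have "the_inv_into (carrier R) e (q2 (x \<otimes>\<^bsub>X\<^esub> y)) = ?r \<otimes>\<^bsub>R\<^esub> ?s"
    using e_inv_eq[of "?r \<otimes>\<^bsub>R\<^esub> ?s"] xy e_inv by simp
  then show "\<delta> (x \<otimes>\<^bsub>X\<^esub> y) = \<delta> x \<otimes>\<^bsub>C'\<^esub> \<delta> y" using rs by (simp add: \<delta>_def)
qed (auto simp: \<delta>_def e_inv)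

lemma kernel_delta:
  assumes "x \<in> kernel X C' \<delta>"
  obtains a b where "a \<in> carrier A" "b \<in> carrier B" "x = jA a \<otimes>\<^bsub>X\<^esub> jB b"
proof -
  let ?r = "the_inv_into (carrier R) e (q2 x)"
  have x: "x \<in> carrier X" "d ?r = \<one>\<^bsub>C'\<^esub>" using assms by (auto simp: kernel_def \<delta>_def)
  have r: "?r \<in> carrier R" "e ?r = q2 x" using x e_inv by auto
  then have "?r \<in> kernel R C' d" using x by (simp add: kernel_def)
  then obtain a where a: "a \<in> carrier A" "q a = ?r" unfolding exact by auto
  then have eq: "q2 (jA a) = q2 x" using squares(2) r by simp
  have "x \<otimes>\<^bsub>X\<^esub> inv\<^bsub>X\<^esub> jA a \<in> kernel X S q2" using x a eq by (simp add: kernel_def)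
  then obtain b where b: "b \<in> carrier B" "jB b = x \<otimes>\<^bsub>X\<^esub> inv\<^bsub>X\<^esub> jA a" unfolding exact by auto
  show ?thesis
    using a b x by (intro that[of a b]) (auto simp: X.m_ac)
qed

lemma delta_jA: "a \<in> carrier A \<Longrightarrow> \<delta> (jA a) = \<one>\<^bsub>C'\<^esub>"
  using squares(2)[of a] exact(2) e_inv_eq[of "q a"] by (auto simp: \<delta>_def kernel_def)

lemma delta_jB:
  assumes "b \<in> carrier B" shows "\<delta> (jB b) = \<one>\<^bsub>C'\<^esub>"
proof -
  have "jB b \<in> kernel X S q2" unfolding exact using assms by blast
  then have "q2 (jB b) = e \<one>\<^bsub>R\<^esub>" by (simp add: kernel_def)
  then show ?thesis using e_inv_eq[of "\<one>\<^bsub>R\<^esub>"] by (simp add: \<delta>_def)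
qed

lemma image_delta:
  "\<delta> ` carrier X = {c \<in> carrier C'. iA' c = \<one>\<^bsub>A'\<^esub> \<and> iB' c = \<one>\<^bsub>B'\<^esub>}"
proof (intro equalityI subsetI)
  fix c assume "c \<in> \<delta> ` carrier X"
  then obtain x where x: "x \<in> carrier X" "c = \<delta> x" by blast
  let ?r = "the_inv_into (carrier R) e (q2 x)"
  have r: "?r \<in> carrier R" "e ?r = q2 x" using x e_inv by auto
  have "d ?r \<in> kernel C' A' iA'" unfolding exact using r by blast
  moreover have "q2 x \<in> kernel S B' d2" unfolding exact using x by blast
  then have "iB' (d ?r) = \<one>\<^bsub>B'\<^esub>" using squares(3)[OF r(1)] r by (simp add: kernel_def)
  ultimately show "c \<in> {c \<in> carrier C'. iA' c = \<one>\<^bsub>A'\<^esub> \<and> iB' c = \<one>\<^bsub>B'\<^esub>}"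
    using x by (auto simp: kernel_def \<delta>_def)
next
  fix c assume c: "c \<in> {c \<in> carrier C'. iA' c = \<one>\<^bsub>A'\<^esub> \<and> iB' c = \<one>\<^bsub>B'\<^esub>}"
  then have "c \<in> kernel C' A' iA'" by (simp add: kernel_def)
  then obtain r where r: "r \<in> carrier R" "c = d r" unfolding exact by blast
  then have "e r \<in> kernel S B' d2" using squares(3) c by (simp add: kernel_def)
  then obtain x where "x \<in> carrier X" "e r = q2 x" unfolding exact by blast
  then show "c \<in> \<delta> ` carrier X" using r e_inv_eq[OF r(1)] by (auto simp: \<delta>_def)
qed

theorem rank_formula:
  assumes fin: "finite_rank A" "finite_rank B" "finite_rank C" "finite_rank C'"
  shows "finite_rank X"
    and "group_rank X + group_rank C = group_rank A + group_rank B
           + rank_on C {c \<in> carrier C. iA c = \<one>\<^bsub>A\<^esub> \<and> iB c = \<one>\<^bsub>B\<^esub>}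
           + rank_on C' {c \<in> carrier C'. iA' c = \<one>\<^bsub>A'\<^esub> \<and> iB' c = \<one>\<^bsub>B'\<^esub>}"
proof -
  define \<psi> where "\<psi> = (\<lambda>(a, b). jA a \<otimes>\<^bsub>X\<^esub> inv\<^bsub>X\<^esub> jB b)"
  define \<phi> where "\<phi> = (\<lambda>c. (iA c, iB c))"
  have P: "comm_group (A \<times>\<times> B)"
    by (intro group.group_comm_groupI DirProd_group) (auto simp: A.m_comm B.m_comm)
  note PR = rank_DirProd[OF A.comm_group_axioms B.comm_group_axioms fin(1,2)]
  have \<psi>: "\<psi> \<in> hom (A \<times>\<times> B) X"
    by (rule homI) (auto simp: \<psi>_def X.inv_mult X.m_ac)
  have \<phi>: "\<phi> \<in> hom C (A \<times>\<times> B)"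
    by (rule homI) (auto simp: \<phi>_def)
  have im\<psi>: "\<psi> ` carrier (A \<times>\<times> B) = kernel X C' \<delta>"
  proof (intro equalityI subsetI)
    fix x assume "x \<in> \<psi> ` carrier (A \<times>\<times> B)"
    then obtain a b where ab: "a \<in> carrier A" "b \<in> carrier B" and x: "x = jA a \<otimes>\<^bsub>X\<^esub> jB (inv\<^bsub>B\<^esub> b)"
      by (auto simp: \<psi>_def)
    have "\<delta> x = \<delta> (jA a) \<otimes>\<^bsub>C'\<^esub> \<delta> (jB (inv\<^bsub>B\<^esub> b))"
      unfolding x using ab by (intro hom_mult[OF delta_hom]) auto
    then show "x \<in> kernel X C' \<delta>"
      using ab x delta_jA[of a] delta_jB[of "inv\<^bsub>B\<^esub> b"] by (simp add: kernel_def)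
  next
    fix x assume "x \<in> kernel X C' \<delta>"
    then obtain a b where "a \<in> carrier A" "b \<in> carrier B" "x = jA a \<otimes>\<^bsub>X\<^esub> jB b"
      by (rule kernel_delta)
    then show "x \<in> \<psi> ` carrier (A \<times>\<times> B)"
      by (intro image_eqI[of _ _ "(a, inv\<^bsub>B\<^esub> b)"]) (auto simp: \<psi>_def)
  qed
  have ker\<psi>: "kernel (A \<times>\<times> B) X \<psi> = \<phi> ` carrier C"
  proof (intro equalityI subsetI)
    fix z assume "z \<in> kernel (A \<times>\<times> B) X \<psi>"
    then obtain a b where z: "z = (a, b)" "a \<in> carrier A" "b \<in> carrier B"
        "jA a \<otimes>\<^bsub>X\<^esub> inv\<^bsub>X\<^esub> jB b = \<one>\<^bsub>X\<^esub>"
      by (auto simp: kernel_def \<psi>_def)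
    then have "jA a = jB b"
      by (metis X.inv_equality X.inv_inv X.inv_closed jA.hom_closed jB.hom_closed)
    from exact_middle[OF z(2,3) this] obtain c where "c \<in> carrier C" "iA c = a" "iB c = b" .
    then show "z \<in> \<phi> ` carrier C" using z by (auto simp: \<phi>_def)
  qed (auto simp: kernel_def \<psi>_def \<phi>_def squares)
  have ker\<phi>: "kernel C (A \<times>\<times> B) \<phi> = {c \<in> carrier C. iA c = \<one>\<^bsub>A\<^esub> \<and> iB c = \<one>\<^bsub>B\<^esub>}"
    by (auto simp: kernel_def \<phi>_def)
  have fk: "finite_rank_on X (kernel X C' \<delta>)"
    using finite_rank_image(1)[OF P X.comm_group_axioms \<psi> PR(1)] im\<psi> by simp
  have fi: "finite_rank_on C' (\<delta> ` carrier X)"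
    by (rule C'.finite_rank_on_subset(1)[OF fin(4)]) (use delta_hom in \<open>auto simp: hom_def\<close>)
  show "finite_rank X"
    by (rule rank_nullity(1)[OF X.comm_group_axioms C'.comm_group_axioms delta_hom fk fi])
  have "group_rank X = rank_on X (kernel X C' \<delta>) + rank_on C' (\<delta> ` carrier X)"
    by (rule rank_nullity(2)[OF X.comm_group_axioms C'.comm_group_axioms delta_hom fk fi])
  moreover have "group_rank A + group_rank B
      = rank_on (A \<times>\<times> B) (kernel (A \<times>\<times> B) X \<psi>) + rank_on X (\<psi> ` carrier (A \<times>\<times> B))"
    using rank_nullity'[OF P X.comm_group_axioms \<psi> PR(1)] PR(2) by simp
  moreover have "group_rank C = rank_on C (kernel C (A \<times>\<times> B) \<phi>) + rank_on (A \<times>\<times> B) (\<phi> ` carrier C)"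
    by (rule rank_nullity'[OF C.comm_group_axioms P \<phi> fin(3)])
  ultimately show "group_rank X + group_rank C = group_rank A + group_rank B
           + rank_on C {c \<in> carrier C. iA c = \<one>\<^bsub>A\<^esub> \<and> iB c = \<one>\<^bsub>B\<^esub>}
           + rank_on C' {c \<in> carrier C'. iA' c = \<one>\<^bsub>A'\<^esub> \<and> iB' c = \<one>\<^bsub>B'\<^esub>}"
    unfolding im\<psi> ker\<psi> ker\<phi> image_delta by linarith
qed

end

lemma hom_induced_one:
  "hom_induced p X S Y T f \<one>\<^bsub>relative_homology_group p X S\<^esub> = \<one>\<^bsub>relative_homology_group p Y T\<^esub>"
  by (rule hom_one[OF hom_induced_hom]) simp_all

abbreviation incl_hom :: "int \<Rightarrow> 'a topology \<Rightarrow> 'a set \<Rightarrow> 'a set \<Rightarrow> 'a chain set \<Rightarrow> 'a chain set" where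
  "incl_hom p X S T \<equiv> hom_induced p (subtopology X S) {} (subtopology X T) {} id"

text \<open>Classes of the intersection of an open cover that die in both members; its rank measures by how
  much the homology of the union exceeds the naive count.\<close>

definition common_kernel :: "int \<Rightarrow> 'a topology \<Rightarrow> 'a set \<Rightarrow> 'a set \<Rightarrow> 'a chain set set" where
  "common_kernel p X A B = {c \<in> carrier (homology_group p (subtopology X (A \<inter> B))).
     incl_hom p X (A \<inter> B) A c = \<one>\<^bsub>homology_group p (subtopology X A)\<^esub> \<and>
     incl_hom p X (A \<inter> B) B c = \<one>\<^bsub>homology_group p (subtopology X B)\<^esub>}"

locale open_cover_pair =
  fixes X :: "'a topology" and A B :: "'a set"
  assumes openA: "openin X A" and openB: "openin X B" and cover: "A \<union> B = topspace X"
begin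

lemma excision_iso:
  "hom_induced p (subtopology X A) (A \<inter> B) X B id
     \<in> iso (relative_homology_group p (subtopology X A) (A \<inter> B)) (relative_homology_group p X B)"
proof -
  have AB: "A \<subseteq> topspace X" "B \<subseteq> topspace X" using cover by auto
  have "closedin X (topspace X - A)" using openA by blast
  then have "X closure_of (topspace X - A) \<subseteq> X interior_of B"
    using cover openB by (auto simp: closure_of_closedin interior_of_openin)
  from homology_excision_axiom[OF this AB(2), of p]
  have "hom_induced p (subtopology X (topspace X - (topspace X - A))) (B - (topspace X - A))
          (subtopology X (topspace X)) B id
      \<in> iso (relative_homology_group p (subtopology X (topspace X - (topspace X - A))) (B - (topspace X - A)))
            (relative_homology_group p (subtopology X (topspace X)) B)" .
  moreover have "topspace X - (topspace X - A) = A" "B - (topspace X - A) = A \<inter> B" using AB by auto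
  ultimately show ?thesis by simp
qed

lemma ladder:
  "exact_ladder
     (homology_group p (subtopology X (A \<inter> B))) (homology_group p (subtopology X A))
     (relative_homology_group p (subtopology X A) (A \<inter> B))
     (homology_group (p-1) (subtopology X (A \<inter> B))) (homology_group (p-1) (subtopology X A))
     (homology_group p (subtopology X B)) (homology_group p X) (relative_homology_group p X B)
     (homology_group (p-1) (subtopology X B))
     (relative_homology_group (p+1) (subtopology X A) (A \<inter> B)) (relative_homology_group (p+1) X B)
     (incl_hom p X (A \<inter> B) A) (hom_induced p (subtopology X A) {} (subtopology X A) (A \<inter> B) id)
     (hom_boundary p (subtopology X A) (A \<inter> B)) (incl_hom (p-1) X (A \<inter> B) A)
     (incl_hom p X (A \<inter> B) B) (hom_induced p (subtopology X A) {} X {} id)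
     (hom_induced p (subtopology X A) (A \<inter> B) X B id) (incl_hom (p-1) X (A \<inter> B) B)
     (hom_induced p (subtopology X B) {} X {} id) (hom_induced p X {} X B id) (hom_boundary p X B)
     (hom_boundary (p+1) (subtopology X A) (A \<inter> B))
     (hom_induced (p+1) (subtopology X A) (A \<inter> B) X B id) (hom_boundary (p+1) X B)"
proof -
  have sub: "subtopology (subtopology X A) (A \<inter> B) = subtopology X (A \<inter> B)"
    by (simp add: subtopology_subtopology)
  have cont: "continuous_map (subtopology X (A \<inter> B)) (subtopology X A) id"
    "continuous_map (subtopology X (A \<inter> B)) (subtopology X B) id"
    "continuous_map (subtopology X A) X id" "continuous_map (subtopology X B) X id"
    by (auto simp: continuous_map_in_subtopology continuous_map_from_subtopology)
  have nat: "hom_boundary p X B (hom_induced p (subtopology X A) (A \<inter> B) X B id r)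
        = incl_hom (p-1) X (A \<inter> B) B (hom_boundary p (subtopology X A) (A \<inter> B) r)" for r p
    using naturality_hom_induced[of "subtopology X A" X id "A \<inter> B" B p] cont
    by (simp add: sub fun_eq_iff)
  show ?thesis
  proof (rule exact_ladder.intro)
    show "kernel (homology_group p (subtopology X A)) (relative_homology_group p (subtopology X A) (A \<inter> B))
        (hom_induced p (subtopology X A) {} (subtopology X A) (A \<inter> B) id) =
        incl_hom p X (A \<inter> B) A ` carrier (homology_group p (subtopology X (A \<inter> B)))"
      using homology_exactness_axiom_3[of p "subtopology X A" "A \<inter> B"] by (simp add: sub)
    show "kernel (relative_homology_group p (subtopology X A) (A \<inter> B))
       (homology_group (p - 1) (subtopology X (A \<inter> B))) (hom_boundary p (subtopology X A) (A \<inter> B)) =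
      hom_induced p (subtopology X A) {} (subtopology X A) (A \<inter> B) id ` carrier (homology_group p (subtopology X A))"
      using homology_exactness_axiom_1[of p "subtopology X A" "A \<inter> B"] by (simp add: sub)
    show "kernel (homology_group (p - 1) (subtopology X (A \<inter> B))) (homology_group (p - 1) (subtopology X A))
        (incl_hom (p - 1) X (A \<inter> B) A) =
      hom_boundary p (subtopology X A) (A \<inter> B) ` carrier (relative_homology_group p (subtopology X A) (A \<inter> B))"
      using homology_exactness_axiom_2[of p "subtopology X A" "A \<inter> B"] by (simp add: sub)
    show "kernel (homology_group p (subtopology X (A \<inter> B))) (homology_group p (subtopology X A))
        (incl_hom p X (A \<inter> B) A) =
      hom_boundary (p+1) (subtopology X A) (A \<inter> B) ` carrier (relative_homology_group (p+1) (subtopology X A) (A \<inter> B))"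
      using homology_exactness_axiom_2[of "p+1" "subtopology X A" "A \<inter> B"] by (simp add: sub)
    show "kernel (homology_group p X) (relative_homology_group p X B) (hom_induced p X {} X B id) =
      hom_induced p (subtopology X B) {} X {} id ` carrier (homology_group p (subtopology X B))"
      using homology_exactness_axiom_3[of p X B] by simp
    show "kernel (relative_homology_group p X B) (homology_group (p - 1) (subtopology X B)) (hom_boundary p X B) =
      hom_induced p X {} X B id ` carrier (homology_group p X)"
      using homology_exactness_axiom_1[of p X B] by simp
    show "kernel (homology_group p (subtopology X B)) (homology_group p X) (hom_induced p (subtopology X B) {} X {} id) =
      hom_boundary (p + 1) X B ` carrier (relative_homology_group (p + 1) X B)"
      using homology_exactness_axiom_2[of "p+1" X B] by simp
    show "hom_induced p (subtopology X A) {} X {} id (incl_hom p X (A \<inter> B) A c) =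
         hom_induced p (subtopology X B) {} X {} id (incl_hom p X (A \<inter> B) B c)" for c
      using cont by (simp add: hom_induced_compose')
    show "hom_induced p X {} X B id (hom_induced p (subtopology X A) {} X {} id a) =
         hom_induced p (subtopology X A) (A \<inter> B) X B id
          (hom_induced p (subtopology X A) {} (subtopology X A) (A \<inter> B) id a)" for a
      using cont by (simp add: hom_induced_compose')
    show "hom_boundary p (subtopology X A) (A \<inter> B) \<in> hom (relative_homology_group p (subtopology X A) (A \<inter> B))
         (homology_group (p - 1) (subtopology X (A \<inter> B)))"
      using hom_boundary_hom[of p "subtopology X A" "A \<inter> B"] by (simp add: sub)
    show "hom_boundary (p+1) (subtopology X A) (A \<inter> B) \<in> hom (relative_homology_group (p+1) (subtopology X A) (A \<inter> B))
         (homology_group p (subtopology X (A \<inter> B)))"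
      using hom_boundary_hom[of "p+1" "subtopology X A" "A \<inter> B"] by (simp add: sub)
    show "hom_boundary (p+1) X B \<in> hom (relative_homology_group (p+1) X B) (homology_group p (subtopology X B))"
      using hom_boundary_hom[of "p+1" X B] by simp
    show "hom_boundary (p+1) X B (hom_induced (p+1) (subtopology X A) (A \<inter> B) X B id r) =
         incl_hom p X (A \<inter> B) B (hom_boundary (p+1) (subtopology X A) (A \<inter> B) r)" for r
      using nat[of "p+1" r] by simp
  qed (simp_all add: hom_induced_hom hom_boundary_hom excision_iso nat)
qed

theorem mayer_vietoris_rank:
  assumes "finite_rank (homology_group p (subtopology X A))" "finite_rank (homology_group p (subtopology X B))"
    "finite_rank (homology_group p (subtopology X (A \<inter> B)))"
    "finite_rank (homology_group (p-1) (subtopology X (A \<inter> B)))"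
  shows "finite_rank (homology_group p X)"
    and "betti p X + betti p (subtopology X (A \<inter> B)) = betti p (subtopology X A) + betti p (subtopology X B)
           + rank_on (homology_group p (subtopology X (A \<inter> B))) (common_kernel p X A B)
           + rank_on (homology_group (p-1) (subtopology X (A \<inter> B))) (common_kernel (p-1) X A B)"
  using exact_ladder.rank_formula[OF ladder assms] by (simp_all add: betti_def common_kernel_def)

theorem mayer_vietoris_exact_middle:
  assumes "a \<in> carrier (homology_group p (subtopology X A))" "b \<in> carrier (homology_group p (subtopology X B))"
    "hom_induced p (subtopology X A) {} X {} id a = hom_induced p (subtopology X B) {} X {} id b"
  obtains c where "c \<in> carrier (homology_group p (subtopology X (A \<inter> B)))"
    "incl_hom p X (A \<inter> B) A c = a" "incl_hom p X (A \<inter> B) B c = b"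
  by (rule exact_ladder.exact_middle[OF ladder assms]) (rule that)

theorem mayer_vietoris_surj:
  assumes "common_kernel (p-1) X A B \<subseteq> {\<one>\<^bsub>homology_group (p-1) (subtopology X (A \<inter> B))\<^esub>}"
    and x: "x \<in> carrier (homology_group p X)"
  obtains a b where "a \<in> carrier (homology_group p (subtopology X A))"
    "b \<in> carrier (homology_group p (subtopology X B))"
    "x = hom_induced p (subtopology X A) {} X {} id a \<otimes>\<^bsub>homology_group p X\<^esub> hom_induced p (subtopology X B) {} X {} id b"
proof -
  interpret exact_ladder
     "homology_group p (subtopology X (A \<inter> B))" "homology_group p (subtopology X A)"
     "relative_homology_group p (subtopology X A) (A \<inter> B)"
     "homology_group (p-1) (subtopology X (A \<inter> B))" "homology_group (p-1) (subtopology X A)"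
     "homology_group p (subtopology X B)" "homology_group p X" "relative_homology_group p X B"
     "homology_group (p-1) (subtopology X B)"
     "relative_homology_group (p+1) (subtopology X A) (A \<inter> B)" "relative_homology_group (p+1) X B"
     "incl_hom p X (A \<inter> B) A" "hom_induced p (subtopology X A) {} (subtopology X A) (A \<inter> B) id"
     "hom_boundary p (subtopology X A) (A \<inter> B)" "incl_hom (p-1) X (A \<inter> B) A"
     "incl_hom p X (A \<inter> B) B" "hom_induced p (subtopology X A) {} X {} id"
     "hom_induced p (subtopology X A) (A \<inter> B) X B id" "incl_hom (p-1) X (A \<inter> B) B"
     "hom_induced p (subtopology X B) {} X {} id" "hom_induced p X {} X B id" "hom_boundary p X B"
     "hom_boundary (p+1) (subtopology X A) (A \<inter> B)"
     "hom_induced (p+1) (subtopology X A) (A \<inter> B) X B id" "hom_boundary (p+1) X B"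
    by (rule ladder)
  have "\<delta> x \<in> common_kernel (p-1) X A B"
    using image_delta x unfolding common_kernel_def by blast
  then have "x \<in> kernel (homology_group p X) (homology_group (p-1) (subtopology X (A \<inter> B))) \<delta>"
    using assms by (auto simp: kernel_def)
  then show ?thesis by (rule kernel_delta) (rule that)
qed

corollary homology_inj_of_piece:
  assumes C: "trivial_group (homology_group p (subtopology X (A \<inter> B)))"
  shows "inj_on (hom_induced p (subtopology X A) {} X {} id) (carrier (homology_group p (subtopology X A)))"
proof -
  let ?j = "hom_induced p (subtopology X A) {} X {} id"
  have one: "hom_induced p (subtopology X B) {} X {} id \<one>\<^bsub>homology_group p (subtopology X B)\<^esub> = \<one>\<^bsub>homology_group p X\<^esub>"
    "incl_hom p X (A \<inter> B) A \<one>\<^bsub>homology_group p (subtopology X (A \<inter> B))\<^esub> = \<one>\<^bsub>homology_group p (subtopology X A)\<^esub>"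
    by (rule hom_induced_one)+
  interpret j: group_hom "homology_group p (subtopology X A)" "homology_group p X" ?j
    by (simp add: group_hom_axioms_def group_hom_def hom_induced_hom)
  show ?thesis
  proof (rule j.inj_on_one_iff[THEN iffD2], intro allI impI)
    fix a assume a: "a \<in> carrier (homology_group p (subtopology X A))" "?j a = \<one>\<^bsub>homology_group p X\<^esub>"
    show "a = \<one>\<^bsub>homology_group p (subtopology X A)\<^esub>"
    proof (rule mayer_vietoris_exact_middle[of a p "\<one>\<^bsub>homology_group p (subtopology X B)\<^esub>"])
      fix c assume "c \<in> carrier (homology_group p (subtopology X (A \<inter> B)))" "incl_hom p X (A \<inter> B) A c = a"
      then show ?thesis using C one(2) by (auto simp: trivial_group_def)
    qed (use a one in \<open>simp_all add: monoid.one_closed[OF group.is_monoid[OF group_relative_homology_group]]\<close>)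
  qed
qed

corollary homology_iso_of_piece:
  assumes C: "trivial_group (homology_group p (subtopology X (A \<inter> B)))"
    and B: "trivial_group (homology_group p (subtopology X B))"
    and k: "common_kernel (p-1) X A B \<subseteq> {\<one>\<^bsub>homology_group (p-1) (subtopology X (A \<inter> B))\<^esub>}"
  shows "homology_group p (subtopology X A) \<cong> homology_group p X"
proof -
  let ?j = "hom_induced p (subtopology X A) {} X {} id"
  have one: "hom_induced p (subtopology X B) {} X {} id \<one>\<^bsub>homology_group p (subtopology X B)\<^esub> = \<one>\<^bsub>homology_group p X\<^esub>"
    by (rule hom_induced_one)
  interpret j: group_hom "homology_group p (subtopology X A)" "homology_group p X" ?j
    by (simp add: group_hom_axioms_def group_hom_def hom_induced_hom)
  have "inj_on ?j (carrier (homology_group p (subtopology X A)))"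
    by (rule homology_inj_of_piece[OF C])
  moreover have "?j ` carrier (homology_group p (subtopology X A)) = carrier (homology_group p X)"
  proof (intro equalityI subsetI)
    fix x assume x: "x \<in> carrier (homology_group p X)"
    obtain a b where ab: "a \<in> carrier (homology_group p (subtopology X A))"
      "b \<in> carrier (homology_group p (subtopology X B))"
      "x = ?j a \<otimes>\<^bsub>homology_group p X\<^esub> hom_induced p (subtopology X B) {} X {} id b"
      by (rule mayer_vietoris_surj[OF k x])
    then have "x = ?j a" using B one by (auto simp: trivial_group_def)
    then show "x \<in> ?j ` carrier (homology_group p (subtopology X A))" using ab by blast
  qed auto
  ultimately have "?j \<in> iso (homology_group p (subtopology X A)) (homology_group p X)"
    by (auto simp: iso_def bij_betw_def hom_induced_hom)
  then show ?thesis by (auto simp: is_iso_def)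
qed

corollary homology_trivial_of_pieces:
  assumes C: "trivial_group (homology_group (p-1) (subtopology X (A \<inter> B)))"
    and A: "trivial_group (homology_group p (subtopology X A))"
    and B: "trivial_group (homology_group p (subtopology X B))"
  shows "trivial_group (homology_group p X)"
proof -
  have one: "hom_induced p (subtopology X B) {} X {} id \<one>\<^bsub>homology_group p (subtopology X B)\<^esub> = \<one>\<^bsub>homology_group p X\<^esub>"
    "hom_induced p (subtopology X A) {} X {} id \<one>\<^bsub>homology_group p (subtopology X A)\<^esub> = \<one>\<^bsub>homology_group p X\<^esub>"
    by (rule hom_induced_one)+
  have k: "common_kernel (p-1) X A B \<subseteq> {\<one>\<^bsub>homology_group (p-1) (subtopology X (A \<inter> B))\<^esub>}"
    using C by (auto simp: common_kernel_def trivial_group_def)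
  interpret H: group "homology_group p X" by simp
  have "x = \<one>\<^bsub>homology_group p X\<^esub>" if x: "x \<in> carrier (homology_group p X)" for x
    by (rule mayer_vietoris_surj[OF k x]) (use A B one in \<open>auto simp: trivial_group_def\<close>)
  then show ?thesis by (auto simp: trivial_group_def)
qed

end

section \<open>Homology of subspaces\<close>

abbreviation hgroup :: "int \<Rightarrow> 'a::topological_space set \<Rightarrow> 'a chain set monoid" where
  "hgroup p S \<equiv> homology_group p (top_of_set S)"

abbreviation hmap :: "int \<Rightarrow> 'a::topological_space set \<Rightarrow> 'b::topological_space set \<Rightarrow> ('a \<Rightarrow> 'b) \<Rightarrow> 'a chain set \<Rightarrow> 'b chain set" where
  "hmap p S T f \<equiv> hom_induced p (top_of_set S) {} (top_of_set T) {} f"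

abbreviation bnum :: "int \<Rightarrow> 'a::topological_space set \<Rightarrow> nat" where
  "bnum p S \<equiv> betti p (top_of_set S)"

abbreviation hfin :: "int \<Rightarrow> 'a::topological_space set \<Rightarrow> bool" where
  "hfin p S \<equiv> finite_rank (hgroup p S)"

abbreviation htriv :: "int \<Rightarrow> 'a::topological_space set \<Rightarrow> bool" where
  "htriv p S \<equiv> trivial_group (hgroup p S)"

definition common_ker :: "int \<Rightarrow> 'a::topological_space set \<Rightarrow> 'a set \<Rightarrow> 'a chain set set" where
  "common_ker p A B = {c \<in> carrier (hgroup p (A \<inter> B)).
     hmap p (A \<inter> B) A id c = \<one>\<^bsub>hgroup p A\<^esub> \<and> hmap p (A \<inter> B) B id c = \<one>\<^bsub>hgroup p B\<^esub>}"

lemma rank_homology_iso: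
  assumes "homology_group p X \<cong> homology_group q Y"
  shows "finite_rank (homology_group p X) \<longleftrightarrow> finite_rank (homology_group q Y)"
    and "finite_rank (homology_group p X) \<Longrightarrow> betti q Y = betti p X"
  using rank_is_iso[OF abelian_homology_group abelian_homology_group assms] by (auto simp: betti_def)

lemma homotopy_invariance:
  assumes "X homotopy_equivalent_space Y"
  shows "finite_rank (homology_group p X) \<longleftrightarrow> finite_rank (homology_group p Y)"
    and "finite_rank (homology_group p X) \<Longrightarrow> betti p Y = betti p X"
    and "trivial_group (homology_group p X) \<longleftrightarrow> trivial_group (homology_group p Y)"
proof -
  have iso: "homology_group p X \<cong> homology_group p Y"
    by (rule homotopy_equivalent_space_imp_isomorphic_homology_groups[OF assms])
  show "finite_rank (homology_group p X) \<longleftrightarrow> finite_rank (homology_group p Y)"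
    "finite_rank (homology_group p X) \<Longrightarrow> betti p Y = betti p X"
    using rank_homology_iso[OF iso] by auto
  show "trivial_group (homology_group p X) \<longleftrightarrow> trivial_group (homology_group p Y)"
    by (rule isomorphic_group_triviality[OF iso]) simp_all
qed

lemma trivial_imp_rank:
  assumes "trivial_group (homology_group p X)"
  shows "finite_rank (homology_group p X)" "betti p X = 0"
  using rank_trivial[OF abelian_homology_group assms] by (auto simp: betti_def)

lemma homotopy_equivalent_deformation:
  fixes A :: "'a::topological_space set"
  assumes cont: "continuous_on ({0..1::real} \<times> A) H" and BA: "B \<subseteq> A"
    and H: "\<And>t x. t \<in> {0..1} \<Longrightarrow> x \<in> A \<Longrightarrow> H (t, x) \<in> A" "\<And>x. x \<in> A \<Longrightarrow> H (0, x) = x"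
      "\<And>x. x \<in> A \<Longrightarrow> H (1, x) \<in> B" "\<And>t x. t \<in> {0..1} \<Longrightarrow> x \<in> B \<Longrightarrow> H (t, x) \<in> B"
  shows "top_of_set A homotopy_equivalent_space top_of_set B"
proof -
  let ?f = "\<lambda>x. H (1, x)"
  have cf: "continuous_on A ?f"
    by (rule continuous_on_compose2[OF cont]) (auto intro!: continuous_intros)
  have P: "prod_topology (top_of_set {0..1::real}) (top_of_set Z) = top_of_set ({0..1} \<times> Z)" for Z :: "'a set"
    by (metis prod_topology_subtopology_eu)
  have "homotopic_with (\<lambda>x. True) (top_of_set A) (top_of_set A) id (id \<circ> ?f)"
    by (subst homotopic_with) (use cont H in \<open>auto simp: P intro!: exI[of _ H]\<close>)
  moreover have "homotopic_with (\<lambda>x. True) (top_of_set B) (top_of_set B) id (?f \<circ> id)"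
    by (subst homotopic_with)
      (use BA H in \<open>auto simp: P intro!: exI[of _ H] continuous_on_subset[OF cont]\<close>)
  ultimately show ?thesis
    unfolding homotopy_equivalent_space_def
    using cf BA H by (intro exI[of _ ?f] exI[of _ id])
      (auto simp: homotopic_with_sym[of _ _ _ id])
qed

lemma homology_contractible:
  fixes S :: "'a::real_normed_vector set"
  assumes "contractible S" "S \<noteq> {}"
  shows "hfin p S" "bnum 0 S = 1" "p \<noteq> 0 \<Longrightarrow> htriv p S"
proof -
  obtain a where a: "a \<in> S" using assms by auto
  have eq: "top_of_set S homotopy_equivalent_space top_of_set {a}"
    using assms by (intro homotopy_eqv_contractible_sets) auto
  have pt: "homology_group 0 (top_of_set {a}) \<cong> integer_group"
    by (rule homology_coefficients) auto
  have 0: "hfin 0 {a}" "bnum 0 {a} = 1"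
    using rank_is_iso[OF abelian_homology_group abelian_integer_group pt] rank_integer_group
    by (auto simp: betti_def)
  have n: "htriv p {a}" if "p \<noteq> 0" for p
    using that by (intro homology_dimension_axiom) auto
  show "hfin p S" "bnum 0 S = 1" "p \<noteq> 0 \<Longrightarrow> htriv p S"
    using homotopy_invariance[OF eq, of p] homotopy_invariance[OF eq, of 0] 0 n trivial_imp_rank(1)
    by (cases "p = 0"; auto)+
qed

lemma homology_path_connected:
  assumes "path_connected S" "S \<noteq> {}"
  shows "hfin 0 S" "bnum 0 S = 1"
proof -
  have "path_connected_space (top_of_set S)"
    using assms path_connectedin_euclidean[of S] unfolding path_connectedin_def by blast
  then have "hgroup 0 S \<cong> integer_group"
    using assms by (intro isomorphic_integer_zeroth_homology_group) auto
  from rank_is_iso[OF abelian_homology_group abelian_integer_group this]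
  show "hfin 0 S" "bnum 0 S = 1"
    using rank_integer_group by (auto simp: betti_def)
qed

lemma homology_empty [simp]:
  "trivial_group (homology_group p trivial_topology)" "finite_rank (homology_group p trivial_topology)"
  "betti p trivial_topology = 0"
  using trivial_homology_group_empty[of trivial_topology p] trivial_imp_rank[of p trivial_topology] by auto

lemma hmap_one: "hmap p S T f \<one>\<^bsub>hgroup p S\<^esub> = \<one>\<^bsub>hgroup p T\<^esub>"
  by (rule hom_induced_one)

lemma open_cover_pair_sets:
  assumes "openin (top_of_set (A \<union> B)) A" "openin (top_of_set (A \<union> B)) B"
  shows "open_cover_pair (top_of_set (A \<union> B)) A B"
  using assms by unfold_locales auto

lemma subtopology_of_Un:
  "subtopology (top_of_set (A \<union> B)) A = top_of_set A"
  "subtopology (top_of_set (A \<union> B)) B = top_of_set B"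
  "subtopology (top_of_set (A \<union> B)) (A \<inter> B) = top_of_set (A \<inter> B)"
  by (auto simp: subtopology_subtopology Int_absorb1 intro!: arg_cong[of _ _ top_of_set])

lemma common_kernel_sets: "common_kernel p (top_of_set (A \<union> B)) A B = common_ker p A B"
  by (simp add: common_kernel_def common_ker_def subtopology_of_Un)

lemma mayer_vietoris:
  fixes A B :: "'a::topological_space set"
  assumes "openin (top_of_set (A \<union> B)) A" "openin (top_of_set (A \<union> B)) B"
    and "hfin p A" "hfin p B" "hfin p (A \<inter> B)" "hfin (p-1) (A \<inter> B)"
  shows "hfin p (A \<union> B)"
    and "bnum p (A \<union> B) + bnum p (A \<inter> B) = bnum p A + bnum p B
           + rank_on (hgroup p (A \<inter> B)) (common_ker p A B)
           + rank_on (hgroup (p-1) (A \<inter> B)) (common_ker (p-1) A B)"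
  using open_cover_pair.mayer_vietoris_rank[OF open_cover_pair_sets[OF assms(1,2)], of p] assms
  by (simp_all add: subtopology_of_Un common_kernel_sets)

lemma common_ker_rank:
  "hfin p (A \<inter> B) \<Longrightarrow> rank_on (hgroup p (A \<inter> B)) (common_ker p A B) \<le> bnum p (A \<inter> B)"
  "common_ker p A B \<subseteq> {\<one>\<^bsub>hgroup p (A \<inter> B)\<^esub>} \<Longrightarrow> rank_on (hgroup p (A \<inter> B)) (common_ker p A B) = 0"
  "htriv p (A \<inter> B) \<Longrightarrow> rank_on (hgroup p (A \<inter> B)) (common_ker p A B) = 0"
proof -
  interpret comm_group "hgroup p (A \<inter> B)" by (rule abelian_homology_group)
  have sub: "common_ker p A B \<subseteq> carrier (hgroup p (A \<inter> B))" by (auto simp: common_ker_def)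
  show "hfin p (A \<inter> B) \<Longrightarrow> rank_on (hgroup p (A \<inter> B)) (common_ker p A B) \<le> bnum p (A \<inter> B)"
    using finite_rank_on_subset(2)[OF _ sub] by (simp add: betti_def group_rank_eq_rank_on)
  show *: "common_ker p A B \<subseteq> {\<one>\<^bsub>hgroup p (A \<inter> B)\<^esub>} \<Longrightarrow> rank_on (hgroup p (A \<inter> B)) (common_ker p A B) = 0"
    using finite_rank_on_subset(2)[OF rank_on_one(1), of "common_ker p A B"] rank_on_one(2) by simp
  show "htriv p (A \<inter> B) \<Longrightarrow> rank_on (hgroup p (A \<inter> B)) (common_ker p A B) = 0"
    using sub by (intro *) (auto simp: trivial_group_def)
qed

lemma homology_disjoint_union:
  fixes A B :: "'a::topological_space set"
  assumes "openin (top_of_set (A \<union> B)) A" "openin (top_of_set (A \<union> B)) B" "A \<inter> B = {}"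
    and "hfin p A" "hfin p B"
  shows "hfin p (A \<union> B)" "bnum p (A \<union> B) = bnum p A + bnum p B"
  using mayer_vietoris[OF assms(1,2,4,5)] common_ker_rank(3)[of p A B] common_ker_rank(3)[of "p-1" A B]
  by (auto simp: assms(3))

lemma homology_trivial_union:
  fixes A B :: "'a::topological_space set"
  assumes "openin (top_of_set (A \<union> B)) A" "openin (top_of_set (A \<union> B)) B"
    and "htriv p A" "htriv p B" "htriv (p-1) (A \<inter> B)"
  shows "htriv p (A \<union> B)"
  using open_cover_pair.homology_trivial_of_pieces[OF open_cover_pair_sets[OF assms(1,2)], of p] assms
  by (simp add: subtopology_of_Un)

lemma homology_iso_union:
  fixes A B :: "'a::topological_space set"
  assumes "openin (top_of_set (A \<union> B)) A" "openin (top_of_set (A \<union> B)) B"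
    and "htriv p (A \<inter> B)" "htriv p B" "common_ker (p-1) A B \<subseteq> {\<one>\<^bsub>hgroup (p-1) (A \<inter> B)\<^esub>}"
  shows "hgroup p A \<cong> hgroup p (A \<union> B)"
  using open_cover_pair.homology_iso_of_piece[OF open_cover_pair_sets[OF assms(1,2)], of p] assms
  by (simp add: subtopology_of_Un common_kernel_sets)

lemma homology_inj_union:
  fixes A B :: "'a::topological_space set"
  assumes "openin (top_of_set (A \<union> B)) A" "openin (top_of_set (A \<union> B)) B" "htriv p (A \<inter> B)"
  shows "inj_on (hmap p A (A \<union> B) id) (carrier (hgroup p A))"
  using open_cover_pair.homology_inj_of_piece[OF open_cover_pair_sets[OF assms(1,2)], of p] assms
  by (simp add: subtopology_of_Un)

text \<open>Induction on the number of sets; each new one adds a point up to homotopy.\<close>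

lemma homology_disjoint_contractibles:
  fixes \<U> :: "'a::real_normed_vector set set"
  assumes "finite \<U>" "pairwise disjnt \<U>"
    and "\<And>U. U \<in> \<U> \<Longrightarrow> openin (top_of_set (\<Union>\<U>)) U" "\<And>U. U \<in> \<U> \<Longrightarrow> contractible U \<and> U \<noteq> {}"
  shows "hfin p (\<Union>\<U>)" "bnum 0 (\<Union>\<U>) = card \<U>" "p \<noteq> 0 \<Longrightarrow> htriv p (\<Union>\<U>)"
proof -
  have "(\<forall>p. hfin p (\<Union>\<U>)) \<and> bnum 0 (\<Union>\<U>) = card \<U> \<and> (\<forall>p. p \<noteq> 0 \<longrightarrow> htriv p (\<Union>\<U>))"
    using assms
  proof (induction \<U> rule: finite_induct)
    case empty
    then show ?case by auto
  next
    case (insert U \<U>)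
    have op: "openin (top_of_set (U \<union> \<Union>\<U>)) V" if "V \<in> insert U \<U>" for V
      using insert.prems(2)[OF that] by simp
    then have "openin (top_of_set (\<Union>\<U>)) V" if "V \<in> \<U>" for V
      using that by (intro openin_subset_trans[OF op[of V]]) auto
    then have IH: "\<And>p. hfin p (\<Union>\<U>)" "bnum 0 (\<Union>\<U>) = card \<U>" "\<And>p. p \<noteq> 0 \<Longrightarrow> htriv p (\<Union>\<U>)"
      using insert by (auto simp: pairwise_insert)
    have disj: "U \<inter> \<Union>\<U> = {}"
      using insert by (auto simp: pairwise_insert disjnt_def)
    have o: "openin (top_of_set (U \<union> \<Union>\<U>)) U" "openin (top_of_set (U \<union> \<Union>\<U>)) (\<Union>\<U>)"
      using op by (auto intro: openin_Union)
    have U: "contractible U" "U \<noteq> {}" using insert by auto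
    show ?case
      using homology_disjoint_union[OF o disj] homology_trivial_union[OF o] IH
        homology_contractible[OF U] disj insert(1,2) by auto
  qed
  then show "hfin p (\<Union>\<U>)" "bnum 0 (\<Union>\<U>) = card \<U>" "p \<noteq> 0 \<Longrightarrow> htriv p (\<Union>\<U>)" by auto
qed

section \<open>Finiteness of Betti numbers\<close>

text \<open>Induction on \<open>m\<close> for all families at once: the last set meets the union of the others in a union of \<open>m\<close> convex
open sets, so every step at most doubles the bound.\<close>

lemma rank_union_convex_open:
  fixes U :: "nat \<Rightarrow> 'a::real_normed_vector set"
  assumes "\<And>i. i < m \<Longrightarrow> open (U i) \<and> convex (U i)"
  shows "hfin p (\<Union>i<m. U i) \<and> bnum p (\<Union>i<m. U i) + 1 \<le> 2 ^ m"
  using assms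
proof (induction m arbitrary: U p)
  case 0
  then show ?case by simp
next
  case (Suc m)
  let ?A = "\<Union>i<m. U i" and ?B = "U m"
  have eq: "(\<Union>i<Suc m. U i) = ?A \<union> ?B" by (auto simp: lessThan_Suc)
  have AB: "?A \<inter> ?B = (\<Union>i<m. U i \<inter> U m)" by auto
  have op: "open ?A" "open ?B" using Suc.prems by auto
  have A: "hfin p ?A" "bnum p ?A + 1 \<le> 2 ^ m" using Suc.IH[of U p] Suc.prems by auto
  have C: "hfin q (?A \<inter> ?B)" "bnum q (?A \<inter> ?B) + 1 \<le> 2 ^ m" for q
    unfolding AB using Suc.IH[of "\<lambda>i. U i \<inter> U m" q] Suc.prems
    by (simp_all add: convex_Int open_Int)
  have B: "hfin p ?B" "bnum p ?B \<le> 1"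
  proof -
    have "hfin p ?B \<and> bnum p ?B \<le> 1"
    proof (cases "?B = {}")
      case True
      then show ?thesis by simp
    next
      case False
      have "contractible ?B" using Suc.prems by (intro convex_imp_contractible) auto
      then show ?thesis using homology_contractible[OF _ False] trivial_imp_rank(2)[of p "top_of_set ?B"]
        by (cases "p = 0") auto
    qed
    then show "hfin p ?B" "bnum p ?B \<le> 1" by auto
  qed
  have o: "openin (top_of_set (?A \<union> ?B)) ?A" "openin (top_of_set (?A \<union> ?B)) ?B"
    using op by (auto intro!: open_subset)
  show ?case
    using mayer_vietoris[OF o A(1) B(1) C(1) C(1)] common_ker_rank(1)[OF C(1)[of p]]
      common_ker_rank(1)[OF C(1)[of "p-1"]] A(2) B(2) C(2)[of "p-1"] unfolding eq by auto
qed

text \<open>The number \<open>m\<close> of pieces does not depend on the compact set, and it is this uniform bound that bounds the ranks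
of all homology groups.\<close>

definition convexly_exhausted :: "'a::real_normed_vector set \<Rightarrow> bool" where
  "convexly_exhausted S \<longleftrightarrow> (\<exists>m. \<forall>L. compact L \<longrightarrow> L \<subseteq> S \<longrightarrow>
     (\<exists>D :: nat \<Rightarrow> 'a set. (\<forall>i<m. compact (D i) \<and> convex (D i)) \<and> L \<subseteq> (\<Union>i<m. D i) \<and> (\<Union>i<m. D i) \<subseteq> S))"

text \<open>Finitely many classes live on a compact set, hence on a union \<open>K\<close> of \<open>m\<close> compact convex sets.
  Pulled back along a neighbourhood retraction they come from the union of the small open
  thickenings of these convex sets, whose homology has rank below \<open>2 ^ m\<close>.\<close>

theorem finite_rank_ENR:
  fixes S :: "'a::euclidean_space set"
  assumes "ENR S" "convexly_exhausted S"
  shows "hfin p S"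
proof (cases "p < 0")
  case True
  then show ?thesis by (intro trivial_imp_rank trivial_homology_group)
next
  case False
  then obtain n where p: "p = int n" by (metis int_eq_iff not_less)
  obtain m where m: "\<And>L. compact L \<Longrightarrow> L \<subseteq> S \<Longrightarrow> \<exists>D :: nat \<Rightarrow> 'a set. (\<forall>i<m. compact (D i) \<and> convex (D i))
       \<and> L \<subseteq> (\<Union>i<m. D i) \<and> (\<Union>i<m. D i) \<subseteq> S"
    using assms(2) unfolding convexly_exhausted_def by blast
  obtain N where N: "open N" "S retract_of N" using assms(1) unfolding ENR_def by blast
  then obtain r where r: "retraction N S r" unfolding retract_of_def by blast
  have "card B \<le> 2 ^ m" if B: "independent_family (hgroup p S) (\<lambda>b. b) B" for B
  proof -
    have finB: "finite B" "B \<subseteq> carrier (hgroup p S)" using B by (auto simp: independent_family_def)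
    have "\<forall>b\<in>B. \<exists>c. singular_relcycle n (top_of_set S) {} c \<and> b = homologous_rel_set n (top_of_set S) {} c"
      using finB(2) by (auto simp: p carrier_relative_homology_group)
    then obtain c where c: "\<And>b. b \<in> B \<Longrightarrow> singular_relcycle n (top_of_set S) {} (c b)"
      "\<And>b. b \<in> B \<Longrightarrow> b = homologous_rel_set n (top_of_set S) {} (c b)"
      unfolding bchoice_iff by blast
    define L where "L = (\<Union>b\<in>B. \<Union>f\<in>Poly_Mapping.keys (c b). f ` standard_simplex n)"
    have simp: "continuous_map (subtopology (powertop_real UNIV) (standard_simplex n)) (top_of_set S) f"
      if "b \<in> B" "f \<in> Poly_Mapping.keys (c b)" for b f
      using c(1)[OF that(1)] that(2) by (auto simp: singular_cycle singular_chain_def singular_simplex_def)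
    have cf: "compact (f ` standard_simplex n) \<and> f ` standard_simplex n \<subseteq> S"
      if "b \<in> B" "f \<in> Poly_Mapping.keys (c b)" for b f
    proof -
      have "compactin (top_of_set S) (f ` standard_simplex n)"
        using compactin_standard_simplex[of n]
        by (intro image_compactin[OF _ simp[OF that]]) (simp add: compactin_subtopology)
      then show ?thesis by (simp add: compactin_subtopology compactin_euclidean_iff)
    qed
    then have "compact L" "L \<subseteq> S"
      unfolding L_def using finB by (auto intro!: compact_UN)
    from m[OF this] obtain D :: "nat \<Rightarrow> 'a set" where
      D: "\<And>i. i < m \<Longrightarrow> compact (D i) \<and> convex (D i)" "L \<subseteq> (\<Union>i<m. D i)" "(\<Union>i<m. D i) \<subseteq> S" by metis
    have "compact (\<Union>i<m. D i)" using D by auto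
    moreover have "(\<Union>i<m. D i) \<subseteq> N" using D(3) r by (auto simp: retraction_def)
    ultimately obtain \<epsilon> where \<epsilon>: "\<epsilon> > 0" "(\<Union>x\<in>(\<Union>i<m. D i). ball x \<epsilon>) \<subseteq> N"
      using compact_subset_open_imp_ball_epsilon_subset[OF _ N(1)] by metis
    define W where "W i = (\<Union>x\<in>D i. \<Union>y\<in>ball 0 \<epsilon>. {x + y})" for i
    have W: "open (W i) \<and> convex (W i)" if "i < m" for i
      unfolding W_def using D(1)[OF that] by (auto intro!: convex_sums open_sums)
    have Wball: "W i = (\<Union>x\<in>D i. ball x \<epsilon>)" for i
      unfolding W_def ball_def by (auto simp: dist_norm) (metis add_diff_cancel_left' diff_add_cancel add.commute norm_minus_commute)
    let ?W = "\<Union>i<m. W i"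
    have WN: "?W \<subseteq> N" using \<epsilon> by (auto simp: Wball)
    have LW: "L \<subseteq> ?W" using D(2) \<epsilon>(1) by (force simp: Wball)
    have contr: "continuous_map (top_of_set ?W) (top_of_set S) r"
      using r WN by (auto simp: retraction_def intro: continuous_on_subset)
    have "b \<in> hmap p ?W S r ` carrier (hgroup p ?W)" if b: "b \<in> B" for b
    proof -
      have "singular_relcycle n (subtopology (top_of_set S) L) {} (c b)"
        using c(1)[OF b] b unfolding singular_cycle singular_chain_subtopology L_def by blast
      then have "singular_relcycle n (subtopology euclidean L) {} (c b)"
        using \<open>L \<subseteq> S\<close> by (simp add: subtopology_subtopology Int_absorb1)
      then have cW: "singular_relcycle n (top_of_set ?W) {} (c b)" and cL: "singular_chain n (top_of_set L) (c b)"
        using LW singular_cycle_mono[of n euclidean L "c b" ?W] by (auto simp: singular_cycle)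
      have "chain_map n r (c b) = c b"
        using chain_map_id_gen[OF cL, of r] r \<open>L \<subseteq> S\<close> by (auto simp: retraction_def)
      then have "hmap p ?W S r (homologous_rel_set n (top_of_set ?W) {} (c b)) = b"
        using hom_induced_chain_map[OF contr _ cW, of "{}"] c(2)[OF b] by (simp add: p)
      moreover have "homologous_rel_set n (top_of_set ?W) {} (c b) \<in> carrier (hgroup p ?W)"
        using cW by (auto simp: p carrier_relative_homology_group)
      ultimately show ?thesis by (metis image_eqI)
    qed
    then have "B \<subseteq> hmap p ?W S r ` carrier (hgroup p ?W)" by blast
    moreover have W': "hfin p ?W" "bnum p ?W + 1 \<le> 2 ^ m"
      using rank_union_convex_open[OF W] by auto
    note im = finite_rank_image[OF abelian_homology_group abelian_homology_group hom_induced_empty_hom W'(1), of "top_of_set S" r]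
    ultimately have "card B \<le> rank_on (hgroup p S) (hmap p ?W S r ` carrier (hgroup p ?W))"
      using comm_group.card_le_rank_on[OF abelian_homology_group im(1) B] by simp
    then show ?thesis using im(2) W'(2) by (simp add: betti_def)
  qed
  then show ?thesis
    using comm_group.finite_rank_onI(1)[OF abelian_homology_group] by blast
qed

text \<open>Remove from a finite union of compact convex sets the zeros of an affine map: a compact subset keeps
  a distance from the zero set, so some coordinate of the map is bounded away from \<open>0\<close>, and each
  of these conditions cuts a convex piece out of each of the given convex sets.\<close>

lemma compact_convex_pieces:
  fixes P :: "'a::euclidean_space set set" and l :: "'a \<Rightarrow> 'b::euclidean_space"
  assumes fin: "finite P" and P: "\<And>C. C \<in> P \<Longrightarrow> compact C \<and> convex C"
    and l: "\<And>x. l x = f x + w" "linear f"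
  shows "ENR {x \<in> \<Union>P. l x \<noteq> 0}" "convexly_exhausted {x \<in> \<Union>P. l x \<noteq> 0}"
proof -
  have contl: "continuous_on T l" for T
    unfolding l(1) using l(2) by (intro continuous_intros linear_continuous_on linear_conv_bounded_linear[THEN iffD1])
  have "ENR (\<Union>P)" using fin P by (intro ENR_finite_Union_convex_closed) (auto intro: compact_imp_closed)
  moreover have "openin (top_of_set (\<Union>P)) {x \<in> \<Union>P. l x \<noteq> 0}"
    using continuous_openin_preimage_gen[OF contl[of "\<Union>P"], of "- {0}"]
    by (simp add: vimage_def Int_def Collect_conj_eq[symmetric] open_Compl)
  ultimately show "ENR {x \<in> \<Union>P. l x \<noteq> 0}" by (rule ENR_openin)
  define I where "I = P \<times> (Basis :: 'b set) \<times> {1, -1 :: real}"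
  have finI: "finite I" unfolding I_def using fin by auto
  then obtain h where h: "bij_betw h {..<card I} I"
    by (metis ex_bij_betw_nat_finite atLeast0LessThan)
  show "convexly_exhausted {x \<in> \<Union>P. l x \<noteq> 0}"
    unfolding convexly_exhausted_def
  proof (intro exI[of _ "card I"] allI impI)
    fix L assume L: "compact L" "L \<subseteq> {x \<in> \<Union>P. l x \<noteq> 0}"
    obtain \<epsilon> where \<epsilon>: "\<epsilon> > 0" "\<And>x. x \<in> L \<Longrightarrow> \<epsilon> \<le> norm (l x)"
    proof (cases "L = {}")
      case True
      then show ?thesis using that[of 1] by auto
    next
      case False
      have "continuous_on L (\<lambda>x. norm (l x))" using contl by (intro continuous_intros)
      from continuous_attains_inf[OF L(1) False this] obtain x where
        "x \<in> L" "\<And>y. y \<in> L \<Longrightarrow> norm (l x) \<le> norm (l y)" by auto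
      then show ?thesis using that[of "norm (l x)"] L(2) by auto
    qed
    define \<delta> where "\<delta> = \<epsilon> / DIM('b)"
    have \<delta>: "\<delta> > 0" using \<epsilon>(1) by (simp add: \<delta>_def)
    define E where "E = (\<lambda>(C, i, s). {x \<in> C. s * (l x \<bullet> i) \<ge> \<delta>})"
    have E: "compact (E k) \<and> convex (E k) \<and> E k \<subseteq> {x \<in> \<Union>P. l x \<noteq> 0}" if k: "k \<in> I" for k
    proof -
      obtain C i s where kk: "k = (C, i, s)" "C \<in> P" "i \<in> Basis" "s = 1 \<or> s = -1"
        using k by (auto simp: I_def)
      have eq: "E k = C \<inter> {x. s * (l x \<bullet> i) \<ge> \<delta>}" by (auto simp: E_def kk)
      have "closed {x. s * (l x \<bullet> i) \<ge> \<delta>}"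
        by (intro closed_Collect_le continuous_intros contl)
      moreover have "convex {x. s * (l x \<bullet> i) \<ge> \<delta>}"
      proof (rule convexI)
        fix x y u v assume xy: "x \<in> {x. s * (l x \<bullet> i) \<ge> \<delta>}" "y \<in> {x. s * (l x \<bullet> i) \<ge> \<delta>}"
          and uv: "(0::real) \<le> u" "0 \<le> v" "u + v = 1"
        have "l (u *\<^sub>R x + v *\<^sub>R y) = u *\<^sub>R f x + v *\<^sub>R f y + (u + v) *\<^sub>R w"
          unfolding l(1) using l(2) uv by (simp add: linear_add linear_scale)
        also have "\<dots> = u *\<^sub>R l x + v *\<^sub>R l y" unfolding l(1) by (simp add: algebra_simps)
        finally have "s * (l (u *\<^sub>R x + v *\<^sub>R y) \<bullet> i) = u * (s * (l x \<bullet> i)) + v * (s * (l y \<bullet> i))"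
          by (simp add: inner_add_left algebra_simps)
        moreover have "u * (s * (l x \<bullet> i)) + v * (s * (l y \<bullet> i)) \<ge> u * \<delta> + v * \<delta>"
          using xy uv by (intro add_mono mult_left_mono) auto
        moreover have "u * \<delta> + v * \<delta> = \<delta>" using uv by (simp flip: distrib_right)
        ultimately show "u *\<^sub>R x + v *\<^sub>R y \<in> {x. s * (l x \<bullet> i) \<ge> \<delta>}" by simp
      qed
      ultimately show ?thesis
        using P[OF kk(2)] \<delta> kk unfolding eq by (auto intro: convex_Int)
    qed
    have cov: "\<exists>k\<in>I. x \<in> E k" if x: "x \<in> L" for x
    proof -
      obtain C where C: "C \<in> P" "x \<in> C" using L(2) x by auto
      have "\<exists>i\<in>Basis. \<delta> \<le> \<bar>l x \<bullet> i\<bar>"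
      proof (rule ccontr)
        assume "\<not> (\<exists>i\<in>Basis. \<delta> \<le> \<bar>l x \<bullet> i\<bar>)"
        then have "(\<Sum>i\<in>Basis. \<bar>l x \<bullet> i\<bar>) < (\<Sum>i\<in>(Basis::'b set). \<delta>)"
          by (intro sum_strict_mono) auto
        also have "\<dots> = \<epsilon>" by (simp add: \<delta>_def)
        finally show False using \<epsilon>(2)[OF x] norm_le_l1[of "l x"] by linarith
      qed
      then obtain i where i: "i \<in> Basis" "\<delta> \<le> \<bar>l x \<bullet> i\<bar>" by auto
      then have "x \<in> E (C, i, if l x \<bullet> i \<ge> 0 then 1 else -1)"
        using C by (auto simp: E_def)
      then show ?thesis using C i by (intro bexI[of _ "(C, i, if l x \<bullet> i \<ge> 0 then 1 else -1)"]) (auto simp: I_def)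
    qed
    have hI: "h i \<in> I" if "i < card I" for i using h that by (auto simp: bij_betw_def)
    have un: "(\<Union>i<card I. E (h i)) = (\<Union>k\<in>I. E k)"
      using h by (metis bij_betw_def image_image)
    show "\<exists>D. (\<forall>i<card I. compact (D i) \<and> convex (D i)) \<and> L \<subseteq> (\<Union>i<card I. D i)
        \<and> (\<Union>i<card I. D i) \<subseteq> {x \<in> \<Union>P. l x \<noteq> 0}"
    proof (intro exI[of _ "\<lambda>i. E (h i)"] conjI)
      show "L \<subseteq> (\<Union>i<card I. E (h i))" "(\<Union>i<card I. E (h i)) \<subseteq> {x \<in> \<Union>P. l x \<noteq> 0}"
        unfolding un using cov E by blast+
    qed (use E hI in blast)
  qed
qed

corollary finite_rank_pieces:
  fixes P :: "'a::euclidean_space set set" and l :: "'a \<Rightarrow> 'b::euclidean_space"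
  assumes "finite P" "\<And>C. C \<in> P \<Longrightarrow> compact C \<and> convex C" "\<And>x. l x = f x + w" "linear f"
  shows "hfin p {x \<in> \<Union>P. l x \<noteq> 0}"
  by (rule finite_rank_ENR; rule compact_convex_pieces[OF assms])

section \<open>Injectivity criteria on homology\<close>

lemma one_in_homology [simp]: "\<one>\<^bsub>relative_homology_group p X S\<^esub> \<in> carrier (relative_homology_group p X S)"
  by (rule monoid.one_closed[OF group.is_monoid[OF group_relative_homology_group]])

lemma hom_finprod:
  assumes "comm_group G" "comm_group H" "f \<in> hom G H" "finite I" "x \<in> I \<rightarrow> carrier G"
  shows "f (finprod G x I) = finprod H (\<lambda>i. f (x i)) I"
proof -
  interpret G: comm_group G by fact
  interpret H: comm_group H by fact
  have "f (x i) \<in> carrier H" if "i \<in> I" for i using assms that by (auto simp: hom_def)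
  moreover have "finprod G (\<lambda>i. x i [^]\<^bsub>G\<^esub> (1::int)) I = finprod G x I"
    using assms(5) by (intro G.finprod_cong') (auto simp: G.int_pow_1 Pi_iff)
  moreover have "finprod H (\<lambda>i. f (x i) [^]\<^bsub>H\<^esub> (1::int)) I = finprod H (\<lambda>i. f (x i)) I"
    using calculation(1) by (intro H.finprod_cong') (auto simp: H.int_pow_1)
  ultimately show ?thesis
    using hom_finprod_int_pow[OF assms, of "\<lambda>_. 1"] by simp
qed

text \<open>A constant map factors through a point, which has homology in degree zero only.\<close>

lemma hmap_constant:
  fixes V :: "'a::topological_space set" and T :: "'b::t1_space set"
  assumes "p \<noteq> 0" and f: "continuous_on V f" "f ` V \<subseteq> T" "\<And>x. x \<in> V \<Longrightarrow> f x = y"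
    and c: "c \<in> carrier (hgroup p V)"
  shows "hmap p V T f c = \<one>\<^bsub>hgroup p T\<^esub>"
proof (cases "V = {}")
  case True
  then have "htriv p V" by simp
  then have "c = \<one>\<^bsub>hgroup p V\<^esub>" using c by (auto simp: trivial_group_def)
  then show ?thesis using hmap_one by metis
next
  case False
  then have y: "y \<in> T" using f by auto
  have t: "htriv p {y}" using assms(1) by (intro homology_dimension_axiom) auto
  have "hmap p V T f c = hmap p V T (id \<circ> f) c" by simp
  also have "\<dots> = hmap p {y} T id (hmap p V {y} f c)"
    using f y by (subst hom_induced_compose') auto
  also have "hmap p V {y} f c = \<one>\<^bsub>hgroup p {y}\<^esub>"
    using t hom_induced_carrier[of p "top_of_set V" "{}" "top_of_set {y}" "{}" f c]
    by (auto simp: trivial_group_def)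
  finally show ?thesis by (simp add: hmap_one)
qed

text \<open>A class on a disjoint union of open pieces vanishes once it is killed by one test map for each
  piece, provided that the test map of a piece is constant on all others.\<close>

lemma test_maps_detect:
  fixes \<U> :: "'a::topological_space set set" and T :: "'a set \<Rightarrow> 'b::t1_space set"
  assumes fin: "finite \<U>" and disj: "pairwise disjnt \<U>"
    and op: "\<And>U. U \<in> \<U> \<Longrightarrow> openin (top_of_set (\<Union>\<U>)) U" and p: "p \<noteq> 0"
    and cont: "\<And>U. U \<in> \<U> \<Longrightarrow> continuous_on (\<Union>\<U>) (f U) \<and> f U ` \<Union>\<U> \<subseteq> T U"
    and const: "\<And>U V. U \<in> \<U> \<Longrightarrow> V \<in> \<U> \<Longrightarrow> U \<noteq> V \<Longrightarrow> \<exists>y. \<forall>x\<in>V. f U x = y"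
    and inj: "\<And>U. U \<in> \<U> \<Longrightarrow> inj_on (hmap p U (T U) (f U)) (carrier (hgroup p U))"
    and c: "c \<in> carrier (hgroup p (\<Union>\<U>))"
    and dies: "\<And>U. U \<in> \<U> \<Longrightarrow> hmap p (\<Union>\<U>) (T U) (f U) c = \<one>\<^bsub>hgroup p (T U)\<^esub>"
  shows "c = \<one>\<^bsub>hgroup p (\<Union>\<U>)\<^esub>"
proof -
  let ?X = "\<Union>\<U>" and ?j = "\<lambda>U. hmap p U (\<Union>\<U>) id"
  interpret X: comm_group "hgroup p ?X" by (rule abelian_homology_group)
  have sub: "subtopology (top_of_set ?X) U = top_of_set U" if "U \<in> \<U>" for U
    using that by (simp add: subtopology_subtopology Int_absorb1 Union_upper)
  have jc: "?j U z \<in> carrier (hgroup p ?X)" for U z by (rule hom_induced_carrier)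
  have "c \<in> (\<lambda>x. gfinprod (hgroup p ?X) (\<lambda>V. hom_induced p (subtopology (top_of_set ?X) V) {} (top_of_set ?X) {} id (x V)) \<U>)
      ` carrier (sum_group \<U> (\<lambda>U. homology_group p (subtopology (top_of_set ?X) U)))"
    using homology_additivity_axiom[OF disj, of "top_of_set ?X" p] op c
    by (auto simp: iso_def bij_betw_def)
  then obtain x where x: "x \<in> carrier (sum_group \<U> (\<lambda>U. homology_group p (subtopology (top_of_set ?X) U)))"
    "c = gfinprod (hgroup p ?X) (\<lambda>V. hom_induced p (subtopology (top_of_set ?X) V) {} (top_of_set ?X) {} id (x V)) \<U>"
    by blast
  have xc: "x U \<in> carrier (hgroup p U)" if "U \<in> \<U>" for U
    using x(1) that sub by (auto simp: carrier_sum_group PiE_iff)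
  have "c = finprod (hgroup p ?X) (\<lambda>V. hom_induced p (subtopology (top_of_set ?X) V) {} (top_of_set ?X) {} id (x V)) \<U>"
    unfolding x(2) using fin by (intro X.gfinprod_eq_finprod) (auto simp: hom_induced_carrier)
  also have "\<dots> = finprod (hgroup p ?X) (\<lambda>V. ?j V (x V)) \<U>"
    using jc sub by (intro X.finprod_cong') auto
  finally have c_eq: "c = finprod (hgroup p ?X) (\<lambda>V. ?j V (x V)) \<U>" .
  have x1: "x U = \<one>\<^bsub>hgroup p U\<^esub>" if U: "U \<in> \<U>" for U
  proof -
    interpret T: comm_group "hgroup p (T U)" by (rule abelian_homology_group)
    let ?f = "hmap p ?X (T U) (f U)"
    have comp: "?f (?j V z) = hmap p V (T U) (f U) z" if "V \<in> \<U>" for V z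
      using cont[OF U] that by (subst hom_induced_compose') (auto simp: Union_upper)
    have "hmap p V (T U) (f U) (x V) = \<one>\<^bsub>hgroup p (T U)\<^esub>" if V: "V \<in> \<U>" "V \<noteq> U" for V
    proof -
      obtain y where "\<forall>x\<in>V. f U x = y" using const[OF U V(1)] V(2) by auto
      moreover have "continuous_on V (f U)" "f U ` V \<subseteq> T U"
        using cont[OF U] V(1) by (auto intro: continuous_on_subset)
      ultimately show ?thesis
        using xc[OF V(1)] by (intro hmap_constant[OF p]) auto
    qed
    moreover have "?f c = finprod (hgroup p (T U)) (\<lambda>V. ?f (?j V (x V))) \<U>"
      unfolding c_eq using jc fin
      by (intro hom_finprod abelian_homology_group hom_induced_empty_hom) auto
    moreover have "\<dots> = finprod (hgroup p (T U)) (\<lambda>V. if V = U then hmap p U (T U) (f U) (x U) else \<one>\<^bsub>hgroup p (T U)\<^esub>) \<U>"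
      using calculation(1) comp by (intro T.finprod_cong') (auto simp: hom_induced_carrier)
    moreover have "\<dots> = hmap p U (T U) (f U) (x U)"
      using T.finprod_singleton_swap[OF U fin, of "\<lambda>_. hmap p U (T U) (f U) (x U)"]
      by (simp add: hom_induced_carrier eq_commute[of U])
    ultimately have "hmap p U (T U) (f U) (x U) = hmap p U (T U) (f U) \<one>\<^bsub>hgroup p U\<^esub>"
      using dies[OF U] by (simp add: hmap_one)
    then show ?thesis
      using inj_onD[OF inj[OF U], of "x U" "\<one>\<^bsub>hgroup p U\<^esub>"] xc[OF U] by simp
  qed
  show ?thesis
    unfolding c_eq using x1 by (intro X.finprod_one_eqI) (simp add: hmap_one)
qed

text \<open>Degree-zero homology is generated by points, and points joined by a path are homologous.\<close>

lemma hom_induced_0_eq: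
  assumes f: "continuous_map X Y f" and g: "continuous_map X Y g"
    and fg: "\<And>x. x \<in> topspace X \<Longrightarrow> path_component_of Y (f x) (g x)"
    and c: "c \<in> carrier (homology_group 0 X)"
  shows "hom_induced 0 X {} Y {} f c = hom_induced 0 X {} Y {} g c"
proof -
  obtain z where z: "singular_relcycle 0 X {} z" "c = homologous_rel_set 0 X {} z"
    using c by (auto simp: carrier_relative_homology_group_0)
  have "Poly_Mapping.keys z \<subseteq> singular_simplex_set 0 X"
    using z(1) by (auto simp: singular_cycle singular_chain_def)
  then have "homologous_rel 0 Y {} (chain_map 0 f z) (chain_map 0 g z)"
  proof (induction z rule: frag_induction)
    case zero
    then show ?case by (simp add: homologous_rel_refl)
  next
    case (one \<sigma>)
    then have \<sigma>: "singular_simplex 0 X \<sigma>" by simp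
    let ?p = "\<lambda>j::nat. if j = 0 then 1 else 0 :: real"
    have p: "\<sigma> ?p \<in> topspace X"
      using \<sigma> by (auto simp: singular_simplex_def continuous_map_def standard_simplex_0)
    let ?C = "path_component_of_set Y (f (\<sigma> ?p))"
    have C: "path_connected_space (subtopology Y ?C)"
      using path_connectedin_path_component_of[of Y "f (\<sigma> ?p)"] by (simp add: path_connectedin_def)
    have s: "singular_simplex 0 Y (simplex_map 0 f \<sigma>)" "singular_simplex 0 Y (simplex_map 0 g \<sigma>)"
      using \<sigma> f g by (auto intro: singular_simplex_simplex_map)
    have "f (\<sigma> ?p) \<in> ?C" "g (\<sigma> ?p) \<in> ?C"
      using fg[OF p] by (auto simp: path_component_of_refl)
        (metis path_component_of_refl path_component_in_topspace)
    then have "singular_simplex 0 (subtopology Y ?C) (simplex_map 0 f \<sigma>)"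
      "singular_simplex 0 (subtopology Y ?C) (simplex_map 0 g \<sigma>)"
      using s by (auto simp: singular_simplex_subtopology simplex_map_def standard_simplex_0)
    from iso_integer_zeroth_homology_group_aux[OF C this]
    have "homologous_rel 0 (subtopology Y ?C) {} (frag_of (simplex_map 0 f \<sigma>)) (frag_of (simplex_map 0 g \<sigma>))" .
    then have "homologous_rel 0 (subtopology Y (topspace Y)) {} (frag_of (simplex_map 0 f \<sigma>)) (frag_of (simplex_map 0 g \<sigma>))"
      unfolding homologous_rel_def
      by (rule singular_boundary_mono[rotated]) (rule path_component_of_subset_topspace)
    then show ?case by simp
  next
    case (diff a b)
    then show ?case by (simp add: chain_map_diff homologous_rel_diff)
  qed
  then show ?thesis
    using hom_induced_chain_map[OF f, of "{}" "{}" 0 z] hom_induced_chain_map[OF g, of "{}" "{}" 0 z] z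
    by (simp add: homologous_rel_set_eq)
qed

text \<open>A continuous map back that returns every point to its own path component is a left inverse in degree zero.\<close>

lemma hmap_0_inj:
  fixes S :: "'a::topological_space set" and T :: "'b::topological_space set"
  assumes f: "continuous_on S f" "f ` S \<subseteq> T" and g: "continuous_on T g" "g ` T \<subseteq> S"
    and gf: "\<And>x. x \<in> S \<Longrightarrow> path_component S (g (f x)) x"
  shows "inj_on (hmap 0 S T f) (carrier (hgroup 0 S))"
proof (rule inj_on_inverseI)
  fix c assume c: "c \<in> carrier (hgroup 0 S)"
  have "hmap 0 T S g (hmap 0 S T f c) = hmap 0 S S (g \<circ> f) c"
    using f g by (intro hom_induced_compose') auto
  also have "\<dots> = hmap 0 S S id c"
  proof (rule hom_induced_0_eq[OF _ _ _ c])
    show "continuous_map (top_of_set S) (top_of_set S) (g \<circ> f)"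
      using f g continuous_on_compose2[OF g(1) f(1) f(2)] by (simp add: o_def) blast
    show "path_component_of (top_of_set S) ((g \<circ> f) x) (id x)" if "x \<in> topspace (top_of_set S)" for x
      using gf[of x] that by (auto simp: path_component_of_def path_component_def pathin_def path_def
          pathstart_def pathfinish_def path_image_def continuous_map_in_subtopology)
  qed auto
  also have "\<dots> = c" by (rule hom_induced_id[OF c])
  finally show "hmap 0 T S g (hmap 0 S T f c) = c" .
qed

lemma homology_class_split:
  fixes A B :: "'a::topological_space set"
  assumes "openin (top_of_set (A \<union> B)) A" "openin (top_of_set (A \<union> B)) B" "A \<inter> B = {}"
    and "x \<in> carrier (hgroup p (A \<union> B))"
  obtains a b where "a \<in> carrier (hgroup p A)" "b \<in> carrier (hgroup p B)"
    "x = hmap p A (A \<union> B) id a \<otimes>\<^bsub>hgroup p (A \<union> B)\<^esub> hmap p B (A \<union> B) id b"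
proof -
  have "common_kernel (p-1) (top_of_set (A \<union> B)) A B
      \<subseteq> {\<one>\<^bsub>homology_group (p-1) (subtopology (top_of_set (A \<union> B)) (A \<inter> B))\<^esub>}"
    using homology_empty(1)[of "p-1", where ?'a='a]
    by (auto simp: assms(3) common_kernel_def trivial_group_def)
  from open_cover_pair.mayer_vietoris_surj[OF open_cover_pair_sets[OF assms(1,2)] this assms(4)]
  show ?thesis using that unfolding subtopology_of_Un by blast
qed

lemma hmap_compose:
  assumes "continuous_on S f" "f ` S \<subseteq> T" "continuous_on T g" "g ` T \<subseteq> Z"
  shows "hmap p T Z g (hmap p S T f x) = hmap p S Z (g \<circ> f) x"
  using assms by (intro hom_induced_compose') auto

text \<open>Injectivity on homology may be checked separately on the two halves of a separation of the target.\<close>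

lemma hmap_inj_disjoint:
  fixes A1 A2 B1 B2 :: "'a::topological_space set"
  assumes A: "openin (top_of_set (A1 \<union> A2)) A1" "openin (top_of_set (A1 \<union> A2)) A2"
    and B: "openin (top_of_set (B1 \<union> B2)) B1" "openin (top_of_set (B1 \<union> B2)) B2" "B1 \<inter> B2 = {}"
    and sub: "A1 \<subseteq> B1" "A2 \<subseteq> B2"
    and inj: "inj_on (hmap p A1 B1 id) (carrier (hgroup p A1))" "inj_on (hmap p A2 B2 id) (carrier (hgroup p A2))"
    and x: "x \<in> carrier (hgroup p (A1 \<union> A2))" "hmap p (A1 \<union> A2) (B1 \<union> B2) id x = \<one>\<^bsub>hgroup p (B1 \<union> B2)\<^esub>"
  shows "x = \<one>\<^bsub>hgroup p (A1 \<union> A2)\<^esub>"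
proof -
  interpret hB: comm_group "hgroup p (B1 \<union> B2)" by (rule abelian_homology_group)
  interpret hB2: comm_group "hgroup p B2" by (rule abelian_homology_group)
  interpret hA: comm_group "hgroup p (A1 \<union> A2)" by (rule abelian_homology_group)
  interpret j: group_hom "hgroup p B2" "hgroup p (B1 \<union> B2)" "hmap p B2 (B1 \<union> B2) id"
    by (simp add: group_hom_axioms_def group_hom_def hom_induced_hom)
  have dA: "A1 \<inter> A2 = {}" using sub B(3) by auto
  obtain a b where ab: "a \<in> carrier (hgroup p A1)" "b \<in> carrier (hgroup p A2)"
    "x = hmap p A1 (A1 \<union> A2) id a \<otimes>\<^bsub>hgroup p (A1 \<union> A2)\<^esub> hmap p A2 (A1 \<union> A2) id b"
    by (rule homology_class_split[OF A dA x(1)])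
  let ?a = "hmap p A1 B1 id a" and ?b = "hmap p A2 B2 id b"
  have car: "?a \<in> carrier (hgroup p B1)" "?b \<in> carrier (hgroup p B2)" by (rule hom_induced_carrier)+
  have c1: "hmap p (A1 \<union> A2) (B1 \<union> B2) id (hmap p A1 (A1 \<union> A2) id a) = hmap p B1 (B1 \<union> B2) id ?a"
    using sub by (subst (1 2) hmap_compose) auto
  have c2: "hmap p (A1 \<union> A2) (B1 \<union> B2) id (hmap p A2 (A1 \<union> A2) id b) = hmap p B2 (B1 \<union> B2) id ?b"
    using sub by (subst (1 2) hmap_compose) auto
  have "hmap p B1 (B1 \<union> B2) id ?a \<otimes>\<^bsub>hgroup p (B1 \<union> B2)\<^esub> hmap p B2 (B1 \<union> B2) id ?b = \<one>\<^bsub>hgroup p (B1 \<union> B2)\<^esub>"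
    using x(2) unfolding ab(3) c1[symmetric] c2[symmetric]
    by (subst (asm) hom_mult[OF hom_induced_hom]) (auto simp: hom_induced_carrier)
  then have "hmap p B1 (B1 \<union> B2) id ?a = inv\<^bsub>hgroup p (B1 \<union> B2)\<^esub> hmap p B2 (B1 \<union> B2) id ?b"
    by (simp add: hB.inv_equality hom_induced_carrier)
  also have "\<dots> = hmap p B2 (B1 \<union> B2) id (inv\<^bsub>hgroup p B2\<^esub> ?b)"
    using car by simp
  finally have eq: "hmap p B1 (B1 \<union> B2) id ?a = hmap p B2 (B1 \<union> B2) id (inv\<^bsub>hgroup p B2\<^esub> ?b)" .
  obtain c where c: "c \<in> carrier (homology_group p (subtopology (top_of_set (B1 \<union> B2)) (B1 \<inter> B2)))"
    "incl_hom p (top_of_set (B1 \<union> B2)) (B1 \<inter> B2) B1 c = ?a"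
    "incl_hom p (top_of_set (B1 \<union> B2)) (B1 \<inter> B2) B2 c = inv\<^bsub>hgroup p B2\<^esub> ?b"
    by (rule open_cover_pair.mayer_vietoris_exact_middle[OF open_cover_pair_sets[OF B(1,2)],
        unfolded subtopology_of_Un, OF car(1) hB2.inv_closed[OF car(2)] eq]) (rule that, simp_all add: subtopology_of_Un)
  have "c = \<one>\<^bsub>homology_group p (subtopology (top_of_set (B1 \<union> B2)) (B1 \<inter> B2))\<^esub>"
    using c(1) homology_empty(1)[of p, where ?'a='a] by (auto simp: B(3) trivial_group_def)
  then have "?a = \<one>\<^bsub>hgroup p B1\<^esub>" "inv\<^bsub>hgroup p B2\<^esub> ?b = \<one>\<^bsub>hgroup p B2\<^esub>"
    using c(2,3) by (auto simp: subtopology_of_Un hom_induced_one)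
  then have "?a = hmap p A1 B1 id \<one>\<^bsub>hgroup p A1\<^esub>" "?b = hmap p A2 B2 id \<one>\<^bsub>hgroup p A2\<^esub>"
    using hB2.inv_eq_1_iff[OF car(2)] by (simp_all add: hmap_one)
  then have "a = \<one>\<^bsub>hgroup p A1\<^esub>" "b = \<one>\<^bsub>hgroup p A2\<^esub>"
    using inj_onD[OF inj(1), of a "\<one>\<^bsub>hgroup p A1\<^esub>"] inj_onD[OF inj(2), of b "\<one>\<^bsub>hgroup p A2\<^esub>"] ab
    by simp_all
  then show ?thesis using ab(3) by (simp add: hmap_one)
qed

section \<open>Products with a graph\<close>

lemma fst_convex_factor_iso:
  fixes X :: "'a::real_normed_vector set" and C :: "'b::real_normed_vector set"
  assumes "convex C" "C \<noteq> {}"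
  shows "hmap p (X \<times> C) X fst \<in> iso (hgroup p (X \<times> C)) (hgroup p X)"
proof -
  obtain q where q: "q \<in> C" using assms by auto
  have P: "prod_topology (top_of_set {0..1::real}) (top_of_set (X \<times> C)) = top_of_set ({0..1} \<times> (X \<times> C))"
    by (metis prod_topology_subtopology_eu)
  have "homotopic_with (\<lambda>x. True) (top_of_set (X \<times> C)) (top_of_set (X \<times> C)) id ((\<lambda>x. (x, q)) \<circ> fst)"
  proof (subst homotopic_with, simp, intro exI[of _ "\<lambda>(t::real, x, y). (x, (1 - t) *\<^sub>R y + t *\<^sub>R q)"] conjI)
    show "continuous_map (prod_topology (top_of_set {0..1}) (top_of_set (X \<times> C))) (top_of_set (X \<times> C))
       (\<lambda>(t::real, x, y). (x, (1 - t) *\<^sub>R y + t *\<^sub>R q))"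
      using q assms(1) unfolding P
      by (auto simp: case_prod_unfold convexD intro!: continuous_intros)
  qed auto
  then have "homotopic_with (\<lambda>h. True) (top_of_set (X \<times> C)) (top_of_set (X \<times> C)) ((\<lambda>x. (x, q)) \<circ> fst) id"
    by (rule homotopic_with_symD)
  moreover have "homotopic_with (\<lambda>k. True) (top_of_set X) (top_of_set X) (fst \<circ> (\<lambda>x. (x, q))) id"
    by (rule homotopic_with_equal) (auto simp: o_def)
  ultimately show ?thesis
    using q by (intro homotopy_equivalence_homology_group_isomorphism) (auto intro!: continuous_intros)
qed

lemma homology_convex_factor:
  fixes X :: "'a::real_normed_vector set" and C :: "'b::real_normed_vector set"
  assumes "convex C" "C \<noteq> {}"
  shows "hfin p (X \<times> C) \<longleftrightarrow> hfin p X" "hfin p X \<Longrightarrow> bnum p (X \<times> C) = bnum p X"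
    "htriv p (X \<times> C) \<longleftrightarrow> htriv p X"
proof -
  have iso: "hgroup p (X \<times> C) \<cong> hgroup p X"
    using fst_convex_factor_iso[OF assms] by (auto simp: is_iso_def)
  show f: "hfin p (X \<times> C) \<longleftrightarrow> hfin p X" by (rule rank_homology_iso(1)[OF iso])
  show "hfin p X \<Longrightarrow> bnum p (X \<times> C) = bnum p X" using rank_homology_iso(2)[OF iso] f by simp
  show "htriv p (X \<times> C) \<longleftrightarrow> htriv p X" by (rule isomorphic_group_triviality[OF iso]) simp_all
qed

lemma hmap_inj_of_compose:
  assumes "continuous_on S f" "f ` S \<subseteq> T" "continuous_on T g" "g ` T \<subseteq> Z"
    and "inj_on (hmap p S Z (g \<circ> f)) (carrier (hgroup p S))"
  shows "inj_on (hmap p S T f) (carrier (hgroup p S))"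
  using assms(5) hmap_compose[OF assms(1-4), of p] unfolding inj_on_def by metis

lemma hmap_homotopic:
  fixes S :: "'a::topological_space set" and T :: "'b::topological_space set"
  assumes "continuous_on ({0..1::real} \<times> S) H" "H ` ({0..1} \<times> S) \<subseteq> T"
    and "\<And>x. x \<in> S \<Longrightarrow> H (0, x) = f x" "\<And>x. x \<in> S \<Longrightarrow> H (1, x) = g x"
  shows "hmap p S T f = hmap p S T g"
proof (rule homology_homotopy_empty)
  have P: "prod_topology (top_of_set {0..1::real}) (top_of_set S) = top_of_set ({0..1} \<times> S)"
    by (metis prod_topology_subtopology_eu)
  show "homotopic_with (\<lambda>h. True) (top_of_set S) (top_of_set T) f g"
    by (subst homotopic_with) (use assms in \<open>auto simp: P intro!: exI[of _ H]\<close>)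
qed

text \<open>A compact set to which the segment from \<open>a\<close> to \<open>b\<close> is glued along its endpoints. The
  coordinate \<open>\<tau>\<close> extends the affine parameter of the segment to the whole space.\<close>

locale glued_segment =
  fixes G :: "'a::euclidean_space set" and a b :: 'a
  assumes compact_G: "compact G" and ne: "a \<noteq> b" and meet: "closed_segment a b \<inter> G = {a, b}"
begin

definition "u s = a + s *\<^sub>R (b - a)" for s :: real
definition "\<tau> y = ((y - a) \<bullet> (b - a)) / ((b - a) \<bullet> (b - a))"
definition "m = u (1/2)"

abbreviation "G' \<equiv> G \<union> closed_segment a b"

lemma u_simps [simp]: "u 0 = a" "u 1 = b" "\<tau> (u s) = s" "u s = u t \<longleftrightarrow> s = t" "u s = a \<longleftrightarrow> s = 0" "u s = b \<longleftrightarrow> s = 1"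
proof -
  show \<tau>u: "\<tau> (u s) = s" for s using ne by (simp add: \<tau>_def u_def)
  then show 1: "u s = u t \<longleftrightarrow> s = t" for s t by metis
  show 2: "u 0 = a" "u 1 = b" by (auto simp: u_def)
  show "u s = a \<longleftrightarrow> s = 0" "u s = b \<longleftrightarrow> s = 1" using 1[of s 0] 1[of s 1] 2 by auto
qed

lemma segment_u: "closed_segment a b = u ` {0..1}"
proof -
  have "u s = (1 - s) *\<^sub>R a + s *\<^sub>R b" for s by (simp add: u_def algebra_simps)
  then show ?thesis unfolding closed_segment_def by auto
qed

lemma u_in_G: "0 \<le> s \<Longrightarrow> s \<le> 1 \<Longrightarrow> u s \<in> G \<longleftrightarrow> s = 0 \<or> s = 1"
  using meet segment_u
  by (metis IntI Int_iff atLeastAtMost_iff imageI insert_iff singletonD u_simps(1,2,4))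

lemma ab_G: "a \<in> G" "b \<in> G" using meet by auto

lemma cont_u: "continuous_on S u" and cont_\<tau>: "continuous_on T \<tau>"
  unfolding u_def \<tau>_def by (intro continuous_intros; use ne in auto)+

lemma convex_u: "convex I \<Longrightarrow> convex (u ` I)"
proof -
  assume I: "convex I"
  have "convex ((\<lambda>s. s *\<^sub>R (b - a)) ` I)"
    by (intro convex_linear_image I linearI) (auto simp: scaleR_left_distrib)
  then have "convex ((\<lambda>x. a + x) ` (\<lambda>s. s *\<^sub>R (b - a)) ` I)" by (rule convex_translation)
  then show ?thesis by (simp add: u_def image_image)
qed

lemma closed_u: "compact I \<Longrightarrow> closed (u ` I)"
  using cont_u by (intro compact_imp_closed compact_continuous_image)

lemma open_edge: "open_segment a b = u ` {0<..<1}"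
  unfolding open_segment_def segment_u
  using u_simps(5,6) by (auto simp: less_le)

abbreviation "L \<equiv> u ` {0<..<1/2}"
abbreviation "R \<equiv> u ` {1/2<..<1}"
abbreviation "O' \<equiv> u ` {0<..<1}"

lemma G'_eq: "G' = G \<union> u ` {0..1}" by (simp add: segment_u)

lemma pieces: "G' - {m} = G \<union> u ` {0..<1/2} \<union> u ` {1/2<..1}"
  unfolding G'_eq m_def using u_in_G[of "1/2"] by (auto simp: image_iff)

lemma O'_minus: "O' \<inter> (G' - {m}) = L \<union> R"
  unfolding G'_eq m_def by (auto simp: image_iff)

lemma openin_complement: "closed C \<Longrightarrow> openin (top_of_set S) (S - C)"
  by (simp add: openin_diff closed_subset openin_closedin_eq closedin_closed_Int Diff_Diff_Int)

lemma open_O': "openin (top_of_set G') O'"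
proof -
  have "O' = G' - G" unfolding G'_eq using u_in_G by (auto simp: image_iff)
  then show ?thesis using openin_complement[of G G'] compact_G compact_imp_closed by metis
qed

lemma open_LR: "openin (top_of_set (L \<union> R)) L" "openin (top_of_set (L \<union> R)) R"
proof -
  have "L = (L \<union> R) - u ` {1/2..1}" "R = (L \<union> R) - u ` {0..1/2}" by (auto simp: image_iff)
  then show "openin (top_of_set (L \<union> R)) L" "openin (top_of_set (L \<union> R)) R"
    using openin_complement[of "u ` {1/2..1}" "L \<union> R"] openin_complement[of "u ` {0..1/2}" "L \<union> R"] closed_u
    by auto
qed

definition "\<rho> y = (if y \<in> G then y else if \<tau> y < 1/2 then a else b)"

lemma \<rho>_simps: "y \<in> G \<Longrightarrow> \<rho> y = y" "s \<in> {0..<1/2} \<Longrightarrow> \<rho> (u s) = a" "s \<in> {1/2<..1} \<Longrightarrow> \<rho> (u s) = b"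
  using u_in_G[of s] by (auto simp: \<rho>_def)

lemma cont_\<rho>: "continuous_on (G' - {m}) \<rho>"
proof -
  let ?A = "u ` {0..<1/2}" and ?B = "u ` {1/2<..1}"
  have m: "m = u (1/2)" by (simp add: m_def)
  have c1: "closedin (top_of_set (G \<union> ?A)) G" "closedin (top_of_set (G \<union> ?A \<union> ?B)) (G \<union> ?A)"
    "closedin (top_of_set (G \<union> ?A)) ?A" "closedin (top_of_set (G \<union> ?A \<union> ?B)) ?B"
  proof -
    have G: "closed G" using compact_G by (rule compact_imp_closed)
    show "closedin (top_of_set (G \<union> ?A)) G" using G by (auto intro: closed_subset)
    have e: "?A = (G \<union> ?A) \<inter> u ` {0..1/2}" "?B = (G \<union> ?A \<union> ?B) \<inter> u ` {1/2..1}"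
      "G \<union> ?A = (G \<union> ?A \<union> ?B) \<inter> (G \<union> u ` {0..1/2})"
      by (auto simp: image_iff u_in_G)
    show "closedin (top_of_set (G \<union> ?A)) ?A"
      by (subst e(1)) (intro closedin_closed_Int closed_u; simp)
    show "closedin (top_of_set (G \<union> ?A \<union> ?B)) ?B"
      by (subst e(2)) (intro closedin_closed_Int closed_u; simp)
    show "closedin (top_of_set (G \<union> ?A \<union> ?B)) (G \<union> ?A)"
      by (subst e(3)) (intro closedin_closed_Int closed_Un G closed_u; simp)
  qed
  have "continuous_on G \<rho>" by (rule continuous_on_eq[OF continuous_on_id]) (simp add: \<rho>_simps)
  moreover have "continuous_on ?A \<rho>" by (rule continuous_on_eq[OF continuous_on_const[of _ a]]) (auto simp: \<rho>_simps)
  moreover have "continuous_on ?B \<rho>" by (rule continuous_on_eq[OF continuous_on_const[of _ b]]) (auto simp: \<rho>_simps)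
  ultimately show ?thesis
    unfolding pieces using c1 by (intro continuous_on_Un_local) auto
qed

text \<open>Without its midpoint the segment retracts to its endpoints, while \<open>G\<close> stays fixed.\<close>

definition "push t y = (1 - t) *\<^sub>R y + t *\<^sub>R \<rho> y" for t :: real

lemma push_G': assumes "y \<in> G' - {m}" "t \<in> {0..1}" shows "push t y \<in> G' - {m}"
proof -
  consider "y \<in> G" | s where "s \<in> {0..<1/2}" "y = u s" | s where "s \<in> {1/2<..1}" "y = u s"
    using assms(1) unfolding pieces by blast
  then show ?thesis
  proof cases
    case 1
    then have "push t y = y" by (simp add: push_def \<rho>_simps flip: scaleR_left_distrib)
    then show ?thesis using assms(1) by simp
  next
    case 2
    then have "push t y = u ((1 - t) * s)"
      by (simp add: push_def \<rho>_simps) (simp add: u_def algebra_simps)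
    moreover have "(1 - t) * s \<le> 1 * s" using 2 assms(2) by (intro mult_right_mono) auto
    ultimately show ?thesis using 2 assms(2) unfolding pieces by auto
  next
    case 3
    then have "push t y = u (1 - (1 - t) * (1 - s))"
      by (simp add: push_def \<rho>_simps) (simp add: u_def algebra_simps)
    moreover have "(1 - t) * (1 - s) \<le> 1 * (1 - s)" using 3 assms(2) by (intro mult_right_mono) auto
    moreover have "0 \<le> (1 - t) * (1 - s)" using 3 assms(2) by simp
    ultimately show ?thesis using 3 unfolding pieces by auto
  qed
qed

lemma push_1: "y \<in> G' - {m} \<Longrightarrow> push 1 y \<in> G"
  unfolding pieces push_def using ab_G by (auto simp: \<rho>_simps)

lemma push_0 [simp]: "push 0 y = y" by (simp add: push_def)

lemma push_fix: "y \<in> G \<Longrightarrow> push t y = y"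
  by (simp add: push_def \<rho>_simps flip: scaleR_left_distrib)

lemma m_notin: "m \<notin> G" using u_in_G[of "1/2"] by (simp add: m_def)

lemma cont_push:
  fixes X :: "'c::topological_space set"
  shows "continuous_on ({0..1} \<times> X \<times> (G' - {m})) (\<lambda>z. (fst (snd z), push (fst z) (snd (snd z))))"
  unfolding push_def
  by (intro continuous_intros continuous_on_compose2[OF cont_\<rho>]) auto

lemma push_equiv:
  fixes X :: "'c::topological_space set"
  shows "top_of_set (X \<times> (G' - {m})) homotopy_equivalent_space top_of_set (X \<times> G)"
proof (rule homotopy_equivalent_deformation[OF cont_push])
  fix t :: real and x assume t: "t \<in> {0..1}" and x: "x \<in> X \<times> (G' - {m})"
  show "(fst (snd (t, x)), push (fst (t, x)) (snd (snd (t, x)))) \<in> X \<times> (G' - {m})"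
    using push_G'[of "snd x" t] t x by auto
next
  fix x assume x: "x \<in> X \<times> (G' - {m})"
  show "(fst (snd (1, x)), push (fst (1, x)) (snd (snd (1, x)))) \<in> X \<times> G"
    using push_1[of "snd x"] x by auto
qed (use m_notin push_fix in auto)

context
  fixes X :: "'c::euclidean_space set"
  assumes Xfin: "\<And>p. hfin p X" and XGfin: "\<And>p. hfin p (X \<times> G)"
begin

abbreviation "U \<equiv> X \<times> (G' - {m})"
abbreviation "W \<equiv> X \<times> O'"

lemma UW: "U \<union> W = X \<times> G'" "U \<inter> W = X \<times> L \<union> X \<times> R" "X \<times> L \<inter> X \<times> R = {}"
proof -
  have "G' - {m} \<union> O' = G'" unfolding G'_eq m_def by auto
  then show "U \<union> W = X \<times> G'" by blast
  show "U \<inter> W = X \<times> L \<union> X \<times> R" using O'_minus by blast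
qed auto

lemma open_UW: "openin (top_of_set (U \<union> W)) U" "openin (top_of_set (U \<union> W)) W"
  unfolding UW using open_O' openin_complement[of "{m}" G']
  by (auto intro!: openin_Times)

lemma open_XLR: "openin (top_of_set (X \<times> L \<union> X \<times> R)) (X \<times> L)" "openin (top_of_set (X \<times> L \<union> X \<times> R)) (X \<times> R)"
  using open_LR by (auto simp: Sigma_Un_distrib2[symmetric] intro!: openin_Times)

lemma convex_nonempty: "convex L" "L \<noteq> {}" "convex R" "R \<noteq> {}" "convex O'" "O' \<noteq> {}"
proof -
  have "(1/4::real) \<in> {0<..<1/2}" "(3/4::real) \<in> {1/2<..<1}" "(1/2::real) \<in> {0<..<1}" by auto
  then show "L \<noteq> {}" "R \<noteq> {}" "O' \<noteq> {}" by blast+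
qed (auto intro: convex_u)

lemma ranks_UW:
  "hfin p U" "bnum p U = bnum p (X \<times> G)" "hfin p W" "bnum p W = bnum p X"
  "hfin p (U \<inter> W)" "bnum p (U \<inter> W) = 2 * bnum p X"
proof -
  show "hfin p U" "bnum p U = bnum p (X \<times> G)"
    using homotopy_invariance[OF push_equiv[of X], of p] XGfin by auto
  show "hfin p W" "bnum p W = bnum p X"
    using homology_convex_factor[OF convex_nonempty(5,6), where X=X and p=p] Xfin by auto
  show "hfin p (U \<inter> W)" "bnum p (U \<inter> W) = 2 * bnum p X"
    unfolding UW using homology_disjoint_union[OF open_XLR UW(3)]
      homology_convex_factor[OF convex_nonempty(1,2), where X=X and p=p]
      homology_convex_factor[OF convex_nonempty(3,4), where X=X and p=p] Xfin by auto
qed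

lemma hfin_glued: "hfin p (X \<times> G')"
  using mayer_vietoris(1)[OF open_UW ranks_UW(1,3,5,5)] unfolding UW .

lemma htriv_glued:
  assumes "htriv p (X \<times> G)" "htriv p X" "htriv (p-1) X"
  shows "htriv p (X \<times> G')"
proof -
  have "htriv p U" using homotopy_invariance(3)[OF push_equiv[of X], of p] assms by auto
  moreover have "htriv p W" using homology_convex_factor(3)[OF convex_nonempty(5,6), where X=X and p=p] assms by auto
  moreover have "htriv (p-1) (U \<inter> W)"
    unfolding UW using homology_trivial_union[OF open_XLR, of "p-1"] UW(3) assms
      homology_convex_factor(3)[OF convex_nonempty(1,2), where X=X and p="p-1"]
      homology_convex_factor(3)[OF convex_nonempty(3,4), where X=X and p="p-1"]
    by auto
  ultimately show ?thesis using homology_trivial_union[OF open_UW, of p] unfolding UW by auto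
qed

text \<open>If \<open>a\<close> and \<open>b\<close> lie in different pieces of \<open>G\<close>, so do the two halves of the punctured segment,
  and no class dies.\<close>

lemma common_ker_separated:
  assumes PQ: "P \<union> Q = G" "P \<inter> Q = {}" "closed P" "closed Q" "a \<in> P" "b \<in> Q"
  shows "common_ker p U W \<subseteq> {\<one>\<^bsub>hgroup p (U \<inter> W)\<^esub>}"
proof
  fix c assume "c \<in> common_ker p U W"
  then have c: "c \<in> carrier (hgroup p (U \<inter> W))" "hmap p (U \<inter> W) U id c = \<one>\<^bsub>hgroup p U\<^esub>"
    by (auto simp: common_ker_def)
  let ?B1 = "P \<union> u ` {0..<1/2}" and ?B2 = "Q \<union> u ` {1/2<..1}"
  have notP: "b \<notin> P" "a \<notin> Q" using PQ by auto
  have uP: "u s \<in> P \<longleftrightarrow> s = 0" "u s \<in> Q \<longleftrightarrow> s = 1" if "0 \<le> s" "s \<le> 1" for s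
    using u_in_G[OF that] PQ notP by auto
  have un: "?B1 \<union> ?B2 = G' - {m}" unfolding pieces using PQ(1) by auto
  have disj: "?B1 \<inter> ?B2 = {}"
    using PQ(2) uP by (auto simp: image_iff)
  have e: "?B1 = (?B1 \<union> ?B2) - (Q \<union> u ` {1/2..1})" "?B2 = (?B1 \<union> ?B2) - (P \<union> u ` {0..1/2})"
    using PQ(2) uP by (auto simp: image_iff)
  have op: "openin (top_of_set (?B1 \<union> ?B2)) ?B1" "openin (top_of_set (?B1 \<union> ?B2)) ?B2"
    by (subst e(1), intro openin_complement closed_Un PQ closed_u, simp)
      (subst e(2), intro openin_complement closed_Un PQ closed_u, simp)
  have XB: "X \<times> ?B1 \<union> X \<times> ?B2 = U" using un by blast
  have opX: "openin (top_of_set (X \<times> ?B1 \<union> X \<times> ?B2)) (X \<times> ?B1)" "openin (top_of_set (X \<times> ?B1 \<union> X \<times> ?B2)) (X \<times> ?B2)"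
    using op unfolding Sigma_Un_distrib2[symmetric] by (auto intro!: openin_Times)
  have inj1: "inj_on (hmap p (X \<times> L) (X \<times> ?B1) id) (carrier (hgroup p (X \<times> L)))"
    by (rule hmap_inj_of_compose[where g=fst and Z=X])
      (use fst_convex_factor_iso[OF convex_nonempty(1,2), of p X] in \<open>auto intro!: continuous_intros simp: iso_def bij_betw_def\<close>)
  have inj2: "inj_on (hmap p (X \<times> R) (X \<times> ?B2) id) (carrier (hgroup p (X \<times> R)))"
    by (rule hmap_inj_of_compose[where g=fst and Z=X])
      (use fst_convex_factor_iso[OF convex_nonempty(3,4), of p X] in \<open>auto intro!: continuous_intros simp: iso_def bij_betw_def\<close>)
  have "c = \<one>\<^bsub>hgroup p (X \<times> L \<union> X \<times> R)\<^esub>"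
  proof (rule hmap_inj_disjoint[OF open_XLR opX _ _ _ inj1 inj2])
    show "X \<times> ?B1 \<inter> X \<times> ?B2 = {}" using disj by blast
    show "c \<in> carrier (hgroup p (X \<times> L \<union> X \<times> R))" using c(1) unfolding UW .
    show "hmap p (X \<times> L \<union> X \<times> R) (X \<times> ?B1 \<union> X \<times> ?B2) id c = \<one>\<^bsub>hgroup p (X \<times> ?B1 \<union> X \<times> ?B2)\<^esub>"
      using c(2) unfolding UW XB .
  qed auto
  then show "c \<in> {\<one>\<^bsub>hgroup p (U \<inter> W)\<^esub>}" unfolding UW by simp
qed

text \<open>If a path in \<open>G\<close> joins \<open>a\<close> to \<open>b\<close>, the inclusion of the two half cylinders into \<open>U\<close> is homotopic to
  the projection to \<open>X\<close> followed by \<open>x \<mapsto> (x, a)\<close>; as this projection factors through \<open>W\<close>, everything that dies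
  in \<open>W\<close> also dies in \<open>U\<close>.\<close>

lemma common_ker_joined:
  assumes "path_component G a b"
  shows "rank_on (hgroup p (U \<inter> W)) (common_ker p U W) = bnum p X"
proof -
  obtain \<gamma> where \<gamma>: "path \<gamma>" "path_image \<gamma> \<subseteq> G" "pathstart \<gamma> = a" "pathfinish \<gamma> = b"
    using assms by (auto simp: path_component_def)
  let ?D = "X \<times> (L \<union> R)"
  have D: "U \<inter> W = ?D" unfolding UW by blast
  have LRG: "L \<union> R \<subseteq> G' - {m}" using O'_minus by blast
  define \<theta> where "\<theta> y = (if \<tau> y < 1/2 then 0 else 1 :: real)" for y
  have c\<theta>: "continuous_on (L \<union> R) \<theta>"
  proof (rule continuous_on_Un_local_open[OF open_LR])
    show "continuous_on L \<theta>" by (rule continuous_on_eq[OF continuous_on_const[of _ 0]]) (auto simp: \<theta>_def)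
    show "continuous_on R \<theta>" by (rule continuous_on_eq[OF continuous_on_const[of _ 1]]) (auto simp: \<theta>_def)
  qed
  have \<gamma>01: "\<gamma> 0 = a" "\<gamma> 1 = b" using \<gamma>(3,4) by (simp_all add: pathstart_def pathfinish_def)
  have \<rho>\<theta>: "\<rho> y = \<gamma> (\<theta> y)" if y: "y \<in> L \<union> R" for y
  proof -
    consider s where "s \<in> {0<..<1/2}" "y = u s" | s where "s \<in> {1/2<..<1}" "y = u s" using y by blast
    then show ?thesis by cases (simp_all add: \<theta>_def \<rho>_simps \<gamma>01)
  qed
  have \<gamma>G: "\<gamma> s \<in> G' - {m}" if "s \<in> {0..1}" for s
  proof -
    have "\<gamma> s \<in> G" using \<gamma>(2) that unfolding path_image_def by blast
    then show ?thesis using m_notin by auto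
  qed
  have h1: "hmap p ?D U id = hmap p ?D U (\<lambda>z. (fst z, \<rho> (snd z)))"
  proof (rule hmap_homotopic[where H="\<lambda>z. (fst (snd z), push (fst z) (snd (snd z)))"])
    show "continuous_on ({0..1} \<times> ?D) (\<lambda>z. (fst (snd z), push (fst z) (snd (snd z))))"
      by (rule continuous_on_subset[OF cont_push[of X]]) (intro Sigma_mono LRG subset_refl)
    show "(\<lambda>z. (fst (snd z), push (fst z) (snd (snd z)))) ` ({0..1} \<times> ?D) \<subseteq> U"
    proof (intro image_subsetI)
      fix z :: "real \<times> 'c \<times> 'a" assume z: "z \<in> {0..1} \<times> ?D"
      then have "push (fst z) (snd (snd z)) \<in> G' - {m}"
        using LRG by (intro push_G') (auto simp del: Un_iff Diff_iff)
      then show "(fst (snd z), push (fst z) (snd (snd z))) \<in> U" using z by auto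
    qed
  qed (auto simp: push_def)
  have \<theta>01: "(1 - t) * \<theta> y \<in> {0..1}" if "t \<in> {0..1}" for t y
    using that by (auto simp: \<theta>_def)
  have h2: "hmap p ?D U (\<lambda>z. (fst z, \<rho> (snd z))) = hmap p ?D U (\<lambda>z. (fst z, a))"
  proof (rule hmap_homotopic[where H="\<lambda>z. (fst (snd z), \<gamma> ((1 - fst z) * \<theta> (snd (snd z))))"])
    show "continuous_on ({0..1} \<times> ?D) (\<lambda>z. (fst (snd z), \<gamma> ((1 - fst z) * \<theta> (snd (snd z)))))"
      by (intro continuous_intros continuous_on_compose2[OF \<gamma>(1)[unfolded path_def]]
          continuous_on_compose2[OF c\<theta>]) (use \<theta>01 in auto)
    show "(\<lambda>z. (fst (snd z), \<gamma> ((1 - fst z) * \<theta> (snd (snd z))))) ` ({0..1} \<times> ?D) \<subseteq> U"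
    proof (intro image_subsetI)
      fix z :: "real \<times> 'c \<times> 'a" assume z: "z \<in> {0..1} \<times> ?D"
      then have "\<gamma> ((1 - fst z) * \<theta> (snd (snd z))) \<in> G' - {m}"
        by (intro \<gamma>G \<theta>01) auto
      then show "(fst (snd z), \<gamma> ((1 - fst z) * \<theta> (snd (snd z)))) \<in> U" using z by auto
    qed
  qed (simp_all add: \<rho>\<theta> \<gamma>01 mem_Times_iff)
  have fact: "hmap p ?D U id c = \<one>\<^bsub>hgroup p U\<^esub>" if "hmap p ?D W id c = \<one>\<^bsub>hgroup p W\<^esub>" for c
  proof -
    have aG: "a \<in> G' - {m}" using ab_G m_notin by auto
    have "hmap p ?D U id c = hmap p ?D U ((\<lambda>x. (x, a)) \<circ> (fst \<circ> id)) c"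
      unfolding h1 h2 by (simp add: o_def)
    also have "\<dots> = hmap p X U (\<lambda>x. (x, a)) (hmap p ?D X (fst \<circ> id) c)"
      by (rule hmap_compose[symmetric]) (use aG in \<open>auto intro!: continuous_intros simp del: Un_iff Diff_iff\<close>)
    also have "hmap p ?D X (fst \<circ> id) c = hmap p W X fst (hmap p ?D W id c)"
      by (rule hmap_compose[symmetric]) (auto intro!: continuous_intros)
    finally show ?thesis using that by (simp add: hmap_one id_def)
  qed
  then have ker: "common_ker p U W = kernel (hgroup p (U \<inter> W)) (hgroup p W) (hmap p (U \<inter> W) W id)"
    unfolding common_ker_def kernel_def D by auto
  have surj: "z \<in> hmap p ?D W id ` carrier (hgroup p ?D)" if z: "z \<in> carrier (hgroup p W)" for z
  proof -
    obtain q where q: "q \<in> L" using convex_nonempty(2) by (meson ex_in_conv)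
    then have qO: "q \<in> O'" by auto
    have "hmap p W W (\<lambda>z. (fst z, q)) = hmap p W W id"
    proof (rule hmap_homotopic[where H="\<lambda>z. (fst (snd z), (1 - fst z) *\<^sub>R q + fst z *\<^sub>R snd (snd z))"])
      show "(\<lambda>z. (fst (snd z), (1 - fst z) *\<^sub>R q + fst z *\<^sub>R snd (snd z))) ` ({0..1} \<times> W) \<subseteq> W"
      proof (intro image_subsetI)
        fix z :: "real \<times> 'c \<times> 'a" assume z: "z \<in> {0..1} \<times> W"
        have "(1 - fst z) *\<^sub>R q + fst z *\<^sub>R snd (snd z) \<in> O'"
          using z by (intro convexD[OF convex_nonempty(5) qO]) auto
        then show "(fst (snd z), (1 - fst z) *\<^sub>R q + fst z *\<^sub>R snd (snd z)) \<in> W" using z by auto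
      qed
    qed (auto intro!: continuous_intros)
    then have "z = hmap p W W (id \<circ> (\<lambda>z. (fst z, q))) z" using hom_induced_id[OF z] by simp
    also have "\<dots> = hmap p ?D W id (hmap p W ?D (\<lambda>z. (fst z, q)) z)"
      by (rule hmap_compose[symmetric]) (use q in \<open>auto intro!: continuous_intros\<close>)
    finally show ?thesis by (rule image_eqI) (rule hom_induced_carrier)
  qed
  have im: "hmap p (U \<inter> W) W id ` carrier (hgroup p (U \<inter> W)) = carrier (hgroup p W)"
    unfolding D
  proof (rule equalityI)
    show "hmap p ?D W id ` carrier (hgroup p ?D) \<subseteq> carrier (hgroup p W)"
      by (rule image_subsetI) (rule hom_induced_carrier)
    show "carrier (hgroup p W) \<subseteq> hmap p ?D W id ` carrier (hgroup p ?D)"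
      by (rule subsetI) (rule surj)
  qed
  have "bnum p (U \<inter> W) = rank_on (hgroup p (U \<inter> W)) (common_ker p U W) + bnum p W"
    using rank_nullity'[OF abelian_homology_group abelian_homology_group hom_induced_empty_hom ranks_UW(5), of p "top_of_set W" id]
    unfolding im ker betti_def group_rank_eq_rank_on .
  then show ?thesis using ranks_UW by simp
qed

text \<open>Joining two separated pieces merges two copies of \<open>X\<close>.\<close>

lemma bnum_glued_separated:
  assumes "P \<union> Q = G" "P \<inter> Q = {}" "closed P" "closed Q" "a \<in> P" "b \<in> Q"
  shows "int (bnum p (X \<times> G')) = int (bnum p (X \<times> G)) - int (bnum p X)"
proof -
  have none: "rank_on (hgroup q (U \<inter> W)) (common_ker q U W) = 0" for q
    by (rule common_ker_rank(2)[OF common_ker_separated[OF assms]])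
  show ?thesis
    using mayer_vietoris(2)[OF open_UW ranks_UW(1,3,5,5), of p]
    unfolding UW(1) ranks_UW(2,4,6) none by linarith
qed

text \<open>The new loop contributes a copy of \<open>X\<close> shifted by one degree.\<close>

lemma bnum_glued_joined:
  assumes "path_component G a b"
  shows "bnum p (X \<times> G') = bnum p (X \<times> G) + bnum (p-1) X"
  using mayer_vietoris(2)[OF open_UW ranks_UW(1,3,5,5), of p]
  unfolding UW(1) ranks_UW(2,4,6) common_ker_joined[OF assms] by linarith

end

end

section \<open>Linear graphs\<close>

text \<open>A linear graph is given by its vertices and its closed edges; isolated vertices are allowed, so that
  edges can be removed one at a time.\<close>

definition lgraph :: "'a::euclidean_space set \<Rightarrow> 'a set set \<Rightarrow> bool" where
  "lgraph V E \<longleftrightarrow> finite V \<and> finite E \<and>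
     (\<forall>e\<in>E. \<exists>a\<in>V. \<exists>b\<in>V. a \<noteq> b \<and> e = closed_segment a b \<and> e \<inter> V = {a, b}) \<and>
     (\<forall>e\<in>E. \<forall>f\<in>E. e \<noteq> f \<longrightarrow> e \<inter> f \<subseteq> V)"

abbreviation gspace :: "'a::euclidean_space set \<Rightarrow> 'a set set \<Rightarrow> 'a set" where
  "gspace V E \<equiv> V \<union> \<Union>E"

text \<open>Finite unions of compact convex sets are closed under products and contain all graphs, and their complements of affine
subspaces have finite Betti numbers.\<close>

definition convex_pieces :: "'a::euclidean_space set \<Rightarrow> bool" where
  "convex_pieces S \<longleftrightarrow> (\<exists>P. finite P \<and> (\<forall>C\<in>P. compact C \<and> convex C) \<and> S = \<Union>P)"

lemma openin_minus_closed: "closed C \<Longrightarrow> openin (top_of_set S) (S - C)"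
  by (simp add: openin_diff closed_subset openin_closedin_eq closedin_closed_Int Diff_Diff_Int)

lemma convex_piecesE:
  assumes "convex_pieces S"
  obtains P where "finite P" "\<And>C. C \<in> P \<Longrightarrow> compact C \<and> convex C" "S = \<Union>P"
  using assms unfolding convex_pieces_def by (elim exE conjE) (rule that, simp_all)

lemma convex_pieces_Times:
  assumes "convex_pieces S" "convex_pieces T"
  shows "convex_pieces (S \<times> T)"
proof -
  obtain P where P: "finite P" "\<And>C. C \<in> P \<Longrightarrow> compact C \<and> convex C" "S = \<Union>P"
    by (rule convex_piecesE[OF assms(1)]) (rule that, simp_all)
  obtain Q where Q: "finite Q" "\<And>C. C \<in> Q \<Longrightarrow> compact C \<and> convex C" "T = \<Union>Q"
    by (rule convex_piecesE[OF assms(2)]) (rule that, simp_all)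
  let ?R = "(\<lambda>(C, D). C \<times> D) ` (P \<times> Q)"
  have "finite ?R" using P(1) Q(1) by simp
  moreover have "\<forall>C\<in>?R. compact C \<and> convex C"
    using P(2) Q(2) by (auto simp: compact_Times convex_Times)
  moreover have "S \<times> T = \<Union>?R" unfolding P(3) Q(3) by auto
  ultimately show ?thesis unfolding convex_pieces_def by (intro exI[of _ ?R] conjI)
qed

lemma convex_pieces_hfin:
  assumes "convex_pieces S" shows "hfin p S"
proof -
  obtain P where P: "finite P" "\<And>C. C \<in> P \<Longrightarrow> compact C \<and> convex C" "S = \<Union>P"
    by (rule convex_piecesE[OF assms]) (rule that, simp_all)
  have eq: "S = {x \<in> \<Union>P. (1::real) \<noteq> 0}" using P(3) by auto
  show ?thesis
    unfolding eq by (rule finite_rank_pieces[OF P(1,2), where f="\<lambda>_. 0" and w=1]) (simp_all add: linear_zero)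
qed

lemma convex_pieces_hfin_minus:
  assumes "convex_pieces S" shows "hfin p (S - {v})"
proof -
  obtain P where P: "finite P" "\<And>C. C \<in> P \<Longrightarrow> compact C \<and> convex C" "S = \<Union>P"
    by (rule convex_piecesE[OF assms]) (rule that, simp_all)
  have eq: "S - {v} = {x \<in> \<Union>P. x - v \<noteq> 0}" using P(3) by auto
  show ?thesis
    unfolding eq by (rule finite_rank_pieces[OF P(1,2), where f="\<lambda>x. x" and w="- v"]) (simp_all add: linear_ident)
qed

abbreviation conf :: "'a set \<Rightarrow> ('a \<times> 'a) set" where
  "conf S \<equiv> {(x, y). x \<in> S \<and> y \<in> S \<and> x \<noteq> y}"

lemma conf_iff: "z \<in> conf S \<longleftrightarrow> fst z \<in> S \<and> snd z \<in> S \<and> fst z \<noteq> snd z"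
  by (simp add: case_prod_unfold)

text \<open>The diagonal is the zero set of the linear map \<open>fst - snd\<close>.\<close>

lemma convex_pieces_hfin_conf:
  assumes "convex_pieces S" shows "hfin p (conf S)"
proof -
  obtain P where P: "finite P" "\<And>C. C \<in> P \<Longrightarrow> compact C \<and> convex C" "S \<times> S = \<Union>P"
    by (rule convex_piecesE[OF convex_pieces_Times[OF assms assms]]) (rule that, simp_all)
  have lin: "linear (\<lambda>z::'a \<times> 'a. fst z - snd z)"
    by (intro linearI) (auto simp: algebra_simps)
  have eq: "conf S = {z \<in> \<Union>P. fst z - snd z \<noteq> 0}" unfolding P(3)[symmetric] by auto
  show ?thesis
    unfolding eq by (rule finite_rank_pieces[OF P(1,2) _ lin, where w=0]) simp_all
qed

lemma convex_pieces_compact: "convex_pieces S \<Longrightarrow> compact S"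
  unfolding convex_pieces_def by (auto intro: compact_Union)

lemma convex_pieces_locally: "convex_pieces S \<Longrightarrow> locally path_connected S"
proof -
  assume "convex_pieces S"
  then obtain P where P: "finite P" "\<And>C. C \<in> P \<Longrightarrow> compact C \<and> convex C" "S = \<Union>P"
    by (rule convex_piecesE) (rule that, simp_all)
  have "ENR S" unfolding P(3)
    using P(2) by (intro ENR_finite_Union_convex_closed[OF P(1)]) (auto simp: compact_imp_closed)
  then show ?thesis by (rule ENR_imp_locally_path_connected)
qed

lemma lgraphD:
  assumes "lgraph V E"
  shows "finite V" "finite E" "e \<in> E \<Longrightarrow> \<exists>a\<in>V. \<exists>b\<in>V. a \<noteq> b \<and> e = closed_segment a b \<and> e \<inter> V = {a, b}"
    "e \<in> E \<Longrightarrow> f \<in> E \<Longrightarrow> e \<noteq> f \<Longrightarrow> e \<inter> f \<subseteq> V"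
  using assms unfolding lgraph_def by simp_all

lemma lgraph_edge:
  assumes "lgraph V E" "e \<in> E"
  obtains a b where "a \<in> V" "b \<in> V" "a \<noteq> b" "e = closed_segment a b" "e \<inter> V = {a, b}"
  using lgraphD(3)[OF assms] by (elim bexE conjE) (rule that)

lemma convex_pieces_gspace:
  assumes "lgraph V E" shows "convex_pieces (gspace V E)"
proof -
  have "compact e \<and> convex e" if "e \<in> E" for e
    by (rule lgraph_edge[OF assms that]) simp
  then show ?thesis
    unfolding convex_pieces_def using assms
    by (intro exI[of _ "(\<lambda>v. {v}) ` V \<union> E"]) (auto simp: lgraph_def)
qed

lemma lgraph_subset: "lgraph V E \<Longrightarrow> F \<subseteq> E \<Longrightarrow> lgraph V F"
proof -
  assume *: "lgraph V E" and F: "F \<subseteq> E"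
  have "e \<in> E" if "e \<in> F" for e using F that by blast
  then show ?thesis
    unfolding lgraph_def using lgraphD[OF *] finite_subset[OF F] by simp
qed

lemma glued_segment_lgraph:
  assumes G: "lgraph V (insert e E)" and e: "e \<notin> E" "e = closed_segment a b" "a \<noteq> b" "e \<inter> V = {a, b}"
  shows "glued_segment (gspace V E) a b"
proof
  show "compact (gspace V E)"
    by (intro convex_pieces_compact convex_pieces_gspace lgraph_subset[OF G]) auto
  have "e \<inter> f \<subseteq> V" if "f \<in> E" for f using lgraphD(4)[OF G, of e f] that e(1) by auto
  then show "closed_segment a b \<inter> gspace V E = {a, b}" using e by blast
qed (use e in auto)

lemma homology_homeomorphic:
  assumes "S homeomorphic T"
  shows "hfin p S \<longleftrightarrow> hfin p T" "hfin p S \<Longrightarrow> bnum p T = bnum p S" "htriv p S \<longleftrightarrow> htriv p T"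
  using homotopy_invariance[OF homeomorphic_imp_homotopy_eqv[OF assms], of p] by auto

lemma homeomorphic_sing_Times: "{q} \<times> S homeomorphic S"
  unfolding homeomorphic_def homeomorphism_def
  by (intro exI[of _ snd] exI[of _ "\<lambda>x. (q, x)"]) (auto intro!: continuous_intros simp: image_iff)

lemma product_with_points:
  fixes X :: "'c::euclidean_space set" and V :: "'a::euclidean_space set"
  assumes "finite V" "\<And>p. hfin p X"
  shows "hfin p (X \<times> V)" "bnum p (X \<times> V) = card V * bnum p X" "htriv p X \<Longrightarrow> htriv p (X \<times> V)"
proof -
  have "hfin p (X \<times> V) \<and> bnum p (X \<times> V) = card V * bnum p X \<and> (htriv p X \<longrightarrow> htriv p (X \<times> V))"
    using assms(1)
  proof (induction V rule: finite_induct)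
    case empty
    then show ?case by simp
  next
    case (insert v V)
    have eq: "X \<times> insert v V = X \<times> {v} \<union> X \<times> V" by auto
    have disj: "X \<times> {v} \<inter> X \<times> V = {}" using insert by auto
    have d: "openin (top_of_set ({v} \<union> V)) {v}" "openin (top_of_set ({v} \<union> V)) V"
    proof -
      have e: "({v} \<union> V) - V = {v}" "({v} \<union> V) - {v} = V" using insert(2) by auto
      have "closed V" using insert(1) by (rule finite_imp_closed)
      from openin_minus_closed[OF this, of "{v} \<union> V"] openin_minus_closed[OF closed_singleton[of v], of "{v} \<union> V"]
      show "openin (top_of_set ({v} \<union> V)) {v}" "openin (top_of_set ({v} \<union> V)) V"
        unfolding e .
    qed
    have op: "openin (top_of_set (X \<times> {v} \<union> X \<times> V)) (X \<times> {v})" "openin (top_of_set (X \<times> {v} \<union> X \<times> V)) (X \<times> V)"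
      using d unfolding Sigma_Un_distrib2[symmetric] by (auto intro!: openin_Times)
    have v: "hfin q (X \<times> {v})" "bnum q (X \<times> {v}) = bnum q X" "htriv q X \<Longrightarrow> htriv q (X \<times> {v})" for q
      using homology_convex_factor[of "{v}", where X=X and p=q] assms(2) by auto
    show ?case
      using homology_disjoint_union[OF op disj v(1)] homology_trivial_union[OF op] disj v insert
      unfolding eq by auto
  qed
  then show "hfin p (X \<times> V)" "bnum p (X \<times> V) = card V * bnum p X" "htriv p X \<Longrightarrow> htriv p (X \<times> V)"
    by auto
qed

text \<open>Path components of a locally path-connected space are open and closed.\<close>

lemma path_component_separation:
  assumes "convex_pieces G" "a \<in> G" "b \<in> G" "\<not> path_component G a b"
  obtains P Q where "P \<union> Q = G" "P \<inter> Q = {}" "closed P" "closed Q" "a \<in> P" "b \<in> Q"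
proof -
  let ?P = "path_component_set G a"
  have l: "locally path_connected G" and c: "closed G"
    using assms by (auto intro: convex_pieces_locally convex_pieces_compact compact_imp_closed)
  have o: "openin (top_of_set G) ?P" "closedin (top_of_set G) ?P"
    using l by (auto intro: openin_path_component_locally_path_connected closedin_path_component_locally_path_connected)
  have "closedin (top_of_set G) (G - ?P)" using o(1) by (intro closedin_diff) auto
  then have "closed ?P" "closed (G - ?P)" using o(2) c by (auto intro: closedin_closed_trans)
  moreover have "?P \<subseteq> G" by (rule path_component_subset)
  ultimately show ?thesis
    using assms by (intro that[of ?P "G - ?P"]) (auto simp: path_component_refl_eq)
qed

text \<open>The shape of the formula, with constants depending on the graph only, suffices: inserting a point
  for \<open>X\<close> identifies \<open>c1\<close> as the first Betti number of the graph.\<close>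

theorem product_with_graph:
  fixes V :: "'a::euclidean_space set"
  assumes "lgraph V E"
  shows "\<exists>c0 c1 :: int. \<forall>X :: 'c::euclidean_space set. (\<forall>p. hfin p X) \<longrightarrow>
     (\<forall>p. hfin p (X \<times> gspace V E) \<and>
          int (bnum p (X \<times> gspace V E)) = c0 * int (bnum p X) + c1 * int (bnum (p-1) X) \<and>
          (htriv p X \<longrightarrow> htriv (p-1) X \<longrightarrow> htriv p (X \<times> gspace V E)))"
proof -
  have "finite E" using assms by (simp add: lgraph_def)
  then show ?thesis using assms
  proof (induction E rule: finite_induct)
    case empty
    then have fin: "finite V" by (simp add: lgraph_def)
    have "int (bnum p (X \<times> V)) = int (card V) * int (bnum p X) + 0 * int (bnum (p-1) X)"
      "hfin p (X \<times> V)" "htriv p X \<Longrightarrow> htriv p (X \<times> V)"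
      if "\<forall>p. hfin p X" for X :: "'c set" and p
      using product_with_points[OF fin, of X p] that by simp_all
    then show ?case by - (rule exI[of _ "int (card V)"], rule exI[of _ 0], simp)
  next
    case (insert e E)
    obtain a b where ab: "a \<in> V" "b \<in> V" "a \<noteq> b" "e = closed_segment a b" "e \<inter> V = {a, b}"
      using lgraph_edge[OF insert.prems, of e] by auto
    let ?G = "gspace V E"
    interpret glued_segment ?G a b
      using glued_segment_lgraph[OF insert.prems insert.hyps(2) ab(4,3,5)] .
    have lg: "lgraph V E" by (rule lgraph_subset[OF insert.prems]) auto
    have G'eq: "gspace V (insert e E) = ?G \<union> closed_segment a b" using ab by auto
    obtain c0 c1 :: int where "\<forall>X :: 'c set. (\<forall>p. hfin p X) \<longrightarrow>
     (\<forall>p. hfin p (X \<times> ?G) \<and> int (bnum p (X \<times> ?G)) = c0 * int (bnum p X) + c1 * int (bnum (p-1) X) \<and>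
          (htriv p X \<longrightarrow> htriv (p-1) X \<longrightarrow> htriv p (X \<times> ?G)))"
      using insert.IH[OF lg] by (elim exE) (rule that)
    note c = this[THEN spec, THEN mp, THEN spec]
    have gl: "hfin p (X \<times> (?G \<union> closed_segment a b))"
        "htriv p X \<longrightarrow> htriv (p-1) X \<longrightarrow> htriv p (X \<times> (?G \<union> closed_segment a b))"
      if "\<forall>p. hfin p X" for X :: "'c set" and p
      using hfin_glued[of X p] htriv_glued[of X p] c[OF that] that by auto
    show ?case
    proof (cases "path_component ?G a b")
      case True
      have "int (bnum p (X \<times> (?G \<union> closed_segment a b))) = c0 * int (bnum p X) + (c1 + 1) * int (bnum (p-1) X)"
        if "\<forall>p. hfin p X" for X :: "'c set" and p
        using bnum_glued_joined[OF _ _ True, of X p] c[OF that] that by (auto simp: algebra_simps)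
      then show ?thesis
        by - (rule exI[of _ c0], rule exI[of _ "c1 + 1"], unfold G'eq, use gl in simp)
    next
      case False
      obtain P Q where PQ: "P \<union> Q = ?G" "P \<inter> Q = {}" "closed P" "closed Q" "a \<in> P" "b \<in> Q"
        using path_component_separation[OF convex_pieces_gspace[OF lg] ab_G False] by blast
      have "int (bnum p (X \<times> (?G \<union> closed_segment a b))) = (c0 - 1) * int (bnum p X) + c1 * int (bnum (p-1) X)"
        if "\<forall>p. hfin p X" for X :: "'c set" and p
        using bnum_glued_separated[OF _ _ PQ, of X p] c[OF that] that by (auto simp: algebra_simps)
      then show ?thesis
        by - (rule exI[of _ "c0 - 1"], rule exI[of _ c1], unfold G'eq, use gl in simp)
    qed
  qed
qed

text \<open>Edges are attached one by one, and an edge affects the degrees zero and one only.\<close>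

lemma graph_htriv:
  fixes V :: "'a::euclidean_space set"
  assumes "lgraph V E" "p \<ge> 2"
  shows "htriv p (gspace V E)"
proof -
  have pt: "hfin q {0::real}" "q \<noteq> 0 \<Longrightarrow> htriv q {0::real}" for q
    using homology_contractible[where S="{0::real}"] by auto
  have "htriv p {0::real}" "htriv (p-1) {0::real}" using pt(2) assms(2) by simp_all
  then have "htriv p ({0::real} \<times> gspace V E)"
    using product_with_graph[OF assms(1), where 'c=real] pt(1) by (elim exE) simp
  then show ?thesis using homology_homeomorphic(3)[OF homeomorphic_sing_Times] by blast
qed

text \<open>The first term of the product formula vanishes, because \<open>X\<close> has no homology in degree two.\<close>

lemma betti_2_product:
  fixes X :: "'c::euclidean_space set" and V :: "'a::euclidean_space set"
  assumes G: "lgraph V E" and X: "\<And>p. hfin p X" "htriv 2 X"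
  shows "bnum 2 (X \<times> gspace V E) = bnum 1 X * bnum 1 (gspace V E)"
proof -
  let ?G = "gspace V E"
  obtain c0 c1 :: int where "\<forall>X :: 'c set. (\<forall>p. hfin p X) \<longrightarrow>
     (\<forall>p. hfin p (X \<times> ?G) \<and>
          int (bnum p (X \<times> ?G)) = c0 * int (bnum p X) + c1 * int (bnum (p-1) X) \<and>
          (htriv p X \<longrightarrow> htriv (p-1) X \<longrightarrow> htriv p (X \<times> ?G)))"
    using product_with_graph[OF G, where 'c='c] by (elim exE) (rule that)
  note c = this[THEN spec, THEN mp, THEN spec, THEN conjunct2, THEN conjunct1]
  have pt: "hfin q {0::'c}" "q \<noteq> 0 \<Longrightarrow> htriv q {0::'c}" "bnum 0 {0::'c} = 1" for q
    using homology_contractible[where S="{0::'c}"] by auto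
  have "hfin 1 ?G" by (intro convex_pieces_hfin convex_pieces_gspace G)
  then have "int (bnum 1 ?G) = int (bnum 1 ({0::'c} \<times> ?G))"
    using homology_homeomorphic[OF homeomorphic_sing_Times[of "0::'c" ?G], of 1] by simp
  also have "\<dots> = c1" using c[of "{0}" 1] pt(1,3) trivial_imp_rank(2)[OF pt(2)[of 1]] by simp
  finally have "int (bnum 1 ?G) = c1" .
  moreover have "int (bnum 2 (X \<times> ?G)) = c0 * int (bnum 2 X) + c1 * int (bnum 1 X)"
    using c[of X 2] X(1) by simp
  moreover have "bnum 2 X = 0" using trivial_imp_rank(2)[OF X(2)] .
  ultimately have "int (bnum 2 (X \<times> ?G)) = int (bnum 1 X * bnum 1 ?G)" by simp
  then show ?thesis by linarith
qed

subsection \<open>Removing a vertex\<close>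

definition edges_at :: "'a set set \<Rightarrow> 'a \<Rightarrow> 'a set set" where
  "edges_at E v = {e \<in> E. v \<in> e}"

context
  fixes V :: "'a::euclidean_space set" and E v
  assumes G: "lgraph V E" and v: "v \<in> V"
begin

abbreviation "\<Gamma> \<equiv> gspace V E"

lemma open_edge_eq:
  assumes "e \<in> E" "v \<in> e"
  obtains w where "w \<in> V" "w \<noteq> v" "e = closed_segment v w" "e - V = open_segment v w" "e \<inter> V = {v, w}"
proof -
  obtain a b where ab: "a \<in> V" "b \<in> V" "a \<noteq> b" "e = closed_segment a b" "e \<inter> V = {a, b}"
    by (rule lgraph_edge[OF G assms(1)])
  have o: "e - V = open_segment a b" using ab by (auto simp: open_segment_def)
  consider "v = a" | "v = b" using ab v assms by blast
  then show ?thesis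
  proof cases
    case 1
    then show ?thesis using ab o by (intro that[of b]) auto
  next
    case 2
    then show ?thesis using ab o by (intro that[of a]) (auto simp: closed_segment_commute open_segment_commute)
  qed
qed

definition "rays = (\<lambda>e. e - V) ` edges_at E v"
definition "star = insert v (\<Union>rays)"

lemma rays_props:
  "finite rays" "card rays = card (edges_at E v)" "pairwise disjnt rays"
  "r \<in> rays \<Longrightarrow> convex r \<and> r \<noteq> {} \<and> r \<subseteq> \<Gamma> - V"
  "r \<in> rays \<Longrightarrow> openin (top_of_set \<Gamma>) r"
proof -
  have fin: "finite E" "finite V" using G by (auto simp: lgraph_def)
  show "finite rays" using fin by (auto simp: rays_def edges_at_def)
  have ne: "e - V \<noteq> {}" and cv: "convex (e - V)" if e: "e \<in> edges_at E v" for e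
  proof -
    obtain w where "w \<noteq> v" "e - V = open_segment v w"
      using e by (auto simp: edges_at_def elim: open_edge_eq)
    then show "e - V \<noteq> {}" "convex (e - V)" by simp_all
  qed
  have disj: "(e - V) \<inter> (f - V) = {}" if "e \<in> E" "f \<in> E" "e \<noteq> f" for e f
    using lgraphD(4)[OF G that] by blast
  have "inj_on (\<lambda>e. e - V) (edges_at E v)"
  proof (rule inj_onI, rule ccontr)
    fix e f assume ef: "e \<in> edges_at E v" "f \<in> edges_at E v" "e - V = f - V" "e \<noteq> f"
    then show False using disj[of e f] ne[of e] by (auto simp: edges_at_def)
  qed
  then show "card rays = card (edges_at E v)" unfolding rays_def by (rule card_image)
  show "pairwise disjnt rays"
    unfolding pairwise_def rays_def disjnt_def edges_at_def using disj by auto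
  show "r \<in> rays \<Longrightarrow> convex r \<and> r \<noteq> {} \<and> r \<subseteq> \<Gamma> - V"
    using ne cv by (auto simp: rays_def edges_at_def)
  show "openin (top_of_set \<Gamma>) r" if r: "r \<in> rays"
  proof -
    obtain e where e: "e \<in> E" "r = e - V" using r by (auto simp: rays_def edges_at_def)
    have "r = \<Gamma> - gspace V (E - {e})"
      using e disj by auto
    moreover have "closed (gspace V (E - {e}))"
      by (intro compact_imp_closed convex_pieces_compact convex_pieces_gspace lgraph_subset[OF G]) auto
    ultimately show ?thesis using openin_minus_closed by metis
  qed
qed

lemma star_props:
  "contractible star" "v \<in> star" "openin (top_of_set \<Gamma>) star"
  "(\<Gamma> - {v}) \<union> star = \<Gamma>" "(\<Gamma> - {v}) \<inter> star = \<Union>rays"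
proof -
  show "v \<in> star" by (simp add: star_def)
  have "starlike star"
    unfolding starlike_def
  proof (intro bexI[of _ v] ballI)
    fix x assume x: "x \<in> star"
    show "closed_segment v x \<subseteq> star"
    proof (cases "x = v")
      case False
      then obtain e where e: "e \<in> edges_at E v" "x \<in> e - V" using x by (auto simp: star_def rays_def)
      then obtain w where w: "e - V = open_segment v w" using open_edge_eq[of e] by (auto simp: edges_at_def)
      have "x \<in> closed_segment v w" using e(2) unfolding w by (auto simp: open_segment_def)
      then have sub: "open_segment v x \<subseteq> open_segment v w" by (simp add: subset_open_segment)
      have "closed_segment v x \<subseteq> insert v (open_segment v w)"
        using e(2) sub unfolding w closed_segment_eq_open by blast
      then show ?thesis using e(1) w by (auto simp: star_def rays_def)
    qed (simp add: star_def)
  qed (simp add: star_def)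
  then show "contractible star" by (rule starlike_imp_contractible)
  have sub: "\<Union>rays \<subseteq> \<Gamma> - V" using rays_props(4) by blast
  then show "(\<Gamma> - {v}) \<union> star = \<Gamma>" "(\<Gamma> - {v}) \<inter> star = \<Union>rays"
    using v by (auto simp: star_def)
  have fin: "finite E" "finite V" using G by (auto simp: lgraph_def)
  let ?C = "(V - {v}) \<union> \<Union>{e \<in> E. v \<notin> e}"
  have "closed e" if "e \<in> E" for e
    by (rule lgraph_edge[OF G that]) simp
  then have "closed (\<Union>{e \<in> E. v \<notin> e})" using fin by (intro closed_Union) auto
  then have "closed ?C" using fin by (intro closed_Un[OF finite_imp_closed]) auto
  moreover have "star = \<Gamma> - ?C"
  proof -
    have "e \<inter> f \<subseteq> V" if "e \<in> E" "f \<in> E" "v \<in> e" "v \<notin> f" for e f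
      using lgraphD(4)[OF G that(1,2)] that(3,4) by blast
    then show ?thesis using v by (auto simp: star_def rays_def edges_at_def)
  qed
  ultimately show "openin (top_of_set \<Gamma>) star" using openin_minus_closed by metis
qed

lemma rays_homology:
  "hfin p (\<Union>rays)" "bnum 0 (\<Union>rays) = card (edges_at E v)" "p \<noteq> 0 \<Longrightarrow> htriv p (\<Union>rays)"
proof -
  have op: "openin (top_of_set (\<Union>rays)) r" if "r \<in> rays" for r
    by (rule openin_subset_trans[OF rays_props(5)[OF that]]) (use that rays_props(4) in blast)+
  have c: "contractible r \<and> r \<noteq> {}" if "r \<in> rays" for r
    using rays_props(4)[OF that] convex_imp_contractible by blast
  show "hfin p (\<Union>rays)" "bnum 0 (\<Union>rays) = card (edges_at E v)" "p \<noteq> 0 \<Longrightarrow> htriv p (\<Union>rays)"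
    using homology_disjoint_contractibles[OF rays_props(1,3) op c] rays_props(2) by auto
qed

lemma open_minus_v: "openin (top_of_set ((\<Gamma> - {v}) \<union> star)) (\<Gamma> - {v})"
    "openin (top_of_set ((\<Gamma> - {v}) \<union> star)) star"
proof -
  show "openin (top_of_set ((\<Gamma> - {v}) \<union> star)) star" using star_props by simp
  show "openin (top_of_set ((\<Gamma> - {v}) \<union> star)) (\<Gamma> - {v})"
    unfolding star_props(4) using openin_minus_closed[of "{v}" \<Gamma>] by simp
qed

text \<open>The star of \<open>v\<close> is contractible and meets the complement of \<open>v\<close> in disjoint open edges, which have no homology in
positive degrees.\<close>

lemma minus_vertex_inj_general:
  assumes "p \<noteq> 0"
  shows "inj_on (hmap p (\<Gamma> - {v}) \<Gamma> id) (carrier (hgroup p (\<Gamma> - {v})))"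
proof -
  have "htriv p ((\<Gamma> - {v}) \<inter> star)" unfolding star_props(5) by (rule rays_homology(3)[OF assms])
  from homology_inj_union[OF open_minus_v this] show ?thesis unfolding star_props(4) .
qed

text \<open>The punctured graph embeds, on homology, into the graph.\<close>

theorem minus_vertex_htriv:
  assumes "p \<ge> 2" shows "htriv p (\<Gamma> - {v})"
proof -
  interpret h: group_hom "hgroup p (\<Gamma> - {v})" "hgroup p \<Gamma>" "hmap p (\<Gamma> - {v}) \<Gamma> id"
    by (simp add: group_hom_axioms_def group_hom_def hom_induced_hom)
  have inj: "inj_on (hmap p (\<Gamma> - {v}) \<Gamma> id) (carrier (hgroup p (\<Gamma> - {v})))"
    by (rule minus_vertex_inj_general) (use assms in simp)
  have "x = \<one>\<^bsub>hgroup p (\<Gamma> - {v})\<^esub>" if "x \<in> carrier (hgroup p (\<Gamma> - {v}))" for x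
    using graph_htriv[OF G assms] inj_onD[OF inj, of x "\<one>\<^bsub>hgroup p (\<Gamma> - {v})\<^esub>"] that hom_induced_carrier[of p "top_of_set (\<Gamma> - {v})" "{}" "top_of_set \<Gamma>" "{}" id x]
    by (auto simp: trivial_group_def)
  then show ?thesis by (auto simp: trivial_group_def)
qed

text \<open>Mayer--Vietoris for the complement of \<open>v\<close> and the star of \<open>v\<close> in degrees one and zero; the unknown kernel term is
the same in both and is eliminated.\<close>

theorem minus_vertex_betti:
  assumes "path_connected \<Gamma>"
  shows "int (bnum 1 \<Gamma>) - int (bnum 1 (\<Gamma> - {v})) = int (card (edges_at E v)) - int (bnum 0 (\<Gamma> - {v}))"
proof -
  have fin: "hfin p (\<Gamma> - {v})" for p
    by (intro convex_pieces_hfin_minus convex_pieces_gspace G)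
  have st: "hfin p star" "bnum 0 star = 1" "p \<noteq> 0 \<Longrightarrow> bnum p star = 0" for p
    using homology_contractible[OF star_props(1)] star_props(2) trivial_imp_rank(2)[of p "top_of_set star"] by auto
  have \<Gamma>0: "bnum 0 \<Gamma> = 1" using homology_path_connected(2)[OF assms] v by auto
  have rf: "hfin p ((\<Gamma> - {v}) \<inter> star)" for p unfolding star_props(5) by (rule rays_homology(1))
  have rt: "p \<noteq> 0 \<Longrightarrow> rank_on (hgroup p ((\<Gamma> - {v}) \<inter> star)) (common_ker p (\<Gamma> - {v}) star) = 0" for p
    by (intro common_ker_rank(3)) (simp add: star_props(5) rays_homology(3))
  note mv = mayer_vietoris(2)[OF open_minus_v fin st(1) rf rf, unfolded star_props(4)]
  have "bnum 1 \<Gamma> = bnum 1 (\<Gamma> - {v}) + rank_on (hgroup 0 ((\<Gamma> - {v}) \<inter> star)) (common_ker 0 (\<Gamma> - {v}) star)"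
    using mv[of 1] rt[of 1] st(3)[of 1] trivial_imp_rank(2)[OF rays_homology(3)[of 1]] by (simp add: star_props(5))
  moreover have "1 + card (edges_at E v) = bnum 0 (\<Gamma> - {v}) + 1 + rank_on (hgroup 0 ((\<Gamma> - {v}) \<inter> star)) (common_ker 0 (\<Gamma> - {v}) star)"
    using mv[of 0] rt[of "-1"] st(2) \<Gamma>0 rays_homology(2) by (simp add: star_props(5))
  ultimately show ?thesis by linarith
qed

end

section \<open>Two points on a space with a bridge\<close>

definition retr :: "'a set \<Rightarrow> 'a \<Rightarrow> 'a \<Rightarrow> 'a" where
  "retr S a x = (if x \<in> S then x else a)"

lemma continuous_on_swap:
  fixes T :: "('a::topological_space \<times> 'b::topological_space) set"
  shows "continuous_on T prod.swap"
  unfolding prod.swap_def by (intro continuous_intros)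

lemma swap_homeo:
  fixes A :: "('a::topological_space \<times> 'b::topological_space) set"
  shows "homeomorphic_map (top_of_set A) (top_of_set (prod.swap ` A)) prod.swap"
proof -
  have "homeomorphic_maps (top_of_set A) (top_of_set (prod.swap ` A)) prod.swap prod.swap"
    by (auto simp: homeomorphic_maps_def continuous_on_swap)
  then show ?thesis by (auto simp: homeomorphic_map_maps)
qed

lemma swap_homology:
  fixes A :: "('a::topological_space \<times> 'b::topological_space) set"
  shows "hfin p (prod.swap ` A) \<longleftrightarrow> hfin p A" "hfin p A \<Longrightarrow> bnum p (prod.swap ` A) = bnum p A"
    "htriv p (prod.swap ` A) \<longleftrightarrow> htriv p A"
  using homotopy_invariance[OF homeomorphic_imp_homotopy_equivalent_space[OF
        homeomorphic_map_imp_homeomorphic_space[OF swap_homeo[of A]]], of p] by auto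

lemma swap_Times: "prod.swap ` (A \<times> B) = B \<times> A"
  by force

lemma inj_on_hmap_comp:
  assumes "inj_on (hmap p S T f) (carrier (hgroup p S))" "inj_on (hmap p T Z g) (carrier (hgroup p T))"
    and "continuous_on S f" "f ` S \<subseteq> T" "continuous_on T g" "g ` T \<subseteq> Z"
    and "\<And>x. x \<in> S \<Longrightarrow> k x = g (f x)"
  shows "inj_on (hmap p S Z k) (carrier (hgroup p S))"
proof -
  have "hmap p S Z k = hmap p S Z (g \<circ> f)" using assms(7) by (intro hom_induced_eq) simp
  then have "hmap p S Z k z = hmap p T Z g (hmap p S T f z)" for z
    using hmap_compose[OF assms(3-6)] by simp
  moreover have "hmap p S T f z \<in> carrier (hgroup p T)" for z by (rule hom_induced_carrier)
  ultimately show ?thesis using assms(1,2) unfolding inj_on_def by simp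
qed

lemma snd_convex_factor_inj:
  fixes X :: "'a::real_normed_vector set" and C :: "'b::real_normed_vector set"
  assumes "convex C" "C \<noteq> {}"
  shows "inj_on (hmap p (C \<times> X) X snd) (carrier (hgroup p (C \<times> X)))"
proof -
  have "inj_on (hmap p (C \<times> X) (X \<times> C) prod.swap) (carrier (hgroup p (C \<times> X)))"
    using homeomorphic_map_homology_iso[OF swap_homeo[of "C \<times> X"], of p]
    by (simp add: swap_Times iso_def bij_betw_def)
  moreover have "inj_on (hmap p (X \<times> C) X fst) (carrier (hgroup p (X \<times> C)))"
    using fst_convex_factor_iso[OF assms, of p X] by (simp add: iso_def bij_betw_def)
  ultimately show ?thesis
    by (rule inj_on_hmap_comp)
      (auto intro!: continuous_intros continuous_on_swap simp: swap_Times)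
qed

text \<open>Two disjoint compact sets joined by a segment. The height \<open>h\<close> collapses \<open>S1\<close> to \<open>0\<close> and \<open>S2\<close>
  to \<open>1\<close>. It separates the pairs of points of the whole space into \<open>h x < h y\<close>, \<open>h x > h y\<close> and
  pairs lying both in \<open>S1\<close> or both in \<open>S2\<close>.\<close>

locale bridge =
  fixes S1 S2 :: "'a::euclidean_space set" and a b :: 'a
  assumes compact: "compact S1" "compact S2" and ends: "a \<in> S1" "b \<in> S2" and disj: "S1 \<inter> S2 = {}"
    and meets: "closed_segment a b \<inter> S1 = {a}" "closed_segment a b \<inter> S2 = {b}"
begin

sublocale glued_segment "S1 \<union> S2" a b
proof
  show "compact (S1 \<union> S2)" using compact by (rule compact_Un)
  show "a \<noteq> b" using ends disj by auto
  show "closed_segment a b \<inter> (S1 \<union> S2) = {a, b}" using meets by blast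
qed

lemma flip: "bridge S2 S1 b a"
  using compact ends disj meets by unfold_locales (auto simp: closed_segment_commute)

definition "Y = S1 \<union> S2 \<union> closed_segment a b"

lemma Y_eq: "Y = S1 \<union> S2 \<union> u ` {0..1}"
  by (simp add: Y_def segment_u)

definition h :: "'a \<Rightarrow> real" where "h x = (if x \<in> S1 then 0 else if x \<in> S2 then 1 else \<tau> x)"

abbreviation "r1 \<equiv> retr S1 a"
abbreviation "r2 \<equiv> retr S2 b"

text \<open>Exchanging the two pieces reverses the bridge. The statements about \<open>V2\<close> and \<open>B\<close> are obtained from those about \<open>V1\<close> and \<open>A\<close> by this symmetry.\<close>

lemma flip_h: "bridge.h S2 S1 b a x = 1 - h x"
proof -
  interpret f: bridge S2 S1 b a by (rule flip)
  have d: "(b - a) \<bullet> (b - a) \<noteq> 0" using ne by simp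
  have "(x - b) \<bullet> (a - b) = (b - a) \<bullet> (b - a) - (x - a) \<bullet> (b - a)"
    "(a - b) \<bullet> (a - b) = (b - a) \<bullet> (b - a)"
    by (simp_all add: inner_diff_left inner_diff_right inner_commute algebra_simps)
  then have "f.\<tau> x = 1 - \<tau> x" using d by (simp add: f.\<tau>_def \<tau>_def diff_divide_distrib)
  then show ?thesis using disj by (auto simp: f.h_def h_def)
qed

lemma u_notin: "0 < s \<Longrightarrow> s < 1 \<Longrightarrow> u s \<notin> S1 \<and> u s \<notin> S2"
  using u_in_G[of s] by auto

lemma on_S1: "x \<in> S1 \<Longrightarrow> h x = 0" "x \<in> S1 \<Longrightarrow> r1 x = x" "x \<in> S1 \<Longrightarrow> r2 x = b"
  using disj by (auto simp: h_def retr_def)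

lemma on_S2: "x \<in> S2 \<Longrightarrow> h x = 1" "x \<in> S2 \<Longrightarrow> r2 x = x" "x \<in> S2 \<Longrightarrow> r1 x = a"
  using disj by (auto simp: h_def retr_def)

lemma on_u:
  assumes "0 \<le> s" "s \<le> 1"
  shows "h (u s) = s" "r1 (u s) = a" "r2 (u s) = b"
proof -
  consider "s = 0" | "s = 1" | "0 < s" "s < 1" using assms by linarith
  then have "h (u s) = s \<and> r1 (u s) = a \<and> r2 (u s) = b"
  proof cases
    case 1 then show ?thesis using on_S1[OF ends(1)] by simp
  next
    case 2 then show ?thesis using on_S2[OF ends(2)] by simp
  next
    case 3 then show ?thesis using u_notin[of s] by (simp add: h_def retr_def)
  qed
  then show "h (u s) = s" "r1 (u s) = a" "r2 (u s) = b" by simp_all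
qed

lemma Y_cases:
  assumes "x \<in> Y"
  obtains (S1) "x \<in> S1" "h x = 0" "r1 x = x" "r2 x = b" | (S2) "x \<in> S2" "h x = 1" "r1 x = a" "r2 x = x"
  | (edge) s where "0 < s" "s < 1" "x = u s" "h x = s" "r1 x = a" "r2 x = b"
proof -
  have "\<exists>s. 0 < s \<and> s < 1 \<and> x = u s" if no: "x \<notin> S1" "x \<notin> S2"
  proof -
    obtain s where s: "0 \<le> s" "s \<le> 1" "x = u s" using assms no unfolding Y_eq by auto
    have "s \<noteq> 0" "s \<noteq> 1" using s(3) ends no by auto
    then show ?thesis using s by (intro exI[of _ s]) auto
  qed
  then consider "x \<in> S1" | "x \<in> S2" | s where "0 < s" "s < 1" "x = u s" by blast
  then show ?thesis
  proof cases
    case 1 then show ?thesis using on_S1 by (intro that(1))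
  next
    case 2 then show ?thesis using on_S2 by (intro that(2))
  next
    case 3 then show ?thesis using on_u[of s] by (intro that(3)[of s]) auto
  qed
qed

lemma h_range: "x \<in> Y \<Longrightarrow> 0 \<le> h x \<and> h x \<le> 1"
  by (erule Y_cases) auto

lemma r_range: "r1 x \<in> S1" "r2 x \<in> S2"
  using ends by (auto simp: retr_def)

lemma cont_pieces:
  assumes "continuous_on S1 f" "continuous_on S2 f" "continuous_on (closed_segment a b) f"
  shows "continuous_on Y f"
  unfolding Y_def using assms compact by (intro continuous_on_closed_Un) (auto intro: compact_imp_closed)

lemma cont_h: "continuous_on Y h" and cont_r1: "continuous_on Y r1" and cont_r2: "continuous_on Y r2"
proof -
  show "continuous_on Y h"
  proof (rule cont_pieces)
    show "continuous_on S1 h" by (rule continuous_on_eq[OF continuous_on_const[of _ 0]]) (simp add: on_S1)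
    show "continuous_on S2 h" by (rule continuous_on_eq[OF continuous_on_const[of _ 1]]) (simp add: on_S2)
    show "continuous_on (closed_segment a b) h"
      by (rule continuous_on_eq[OF cont_\<tau>]) (auto simp: segment_u on_u)
  qed
  show "continuous_on Y r1"
  proof (rule cont_pieces)
    show "continuous_on S1 r1" by (rule continuous_on_eq[OF continuous_on_id]) (simp add: on_S1)
    show "continuous_on S2 r1" by (rule continuous_on_eq[OF continuous_on_const[of _ a]]) (simp add: on_S2)
    show "continuous_on (closed_segment a b) r1"
      by (rule continuous_on_eq[OF continuous_on_const[of _ a]]) (auto simp: segment_u on_u)
  qed
  show "continuous_on Y r2"
  proof (rule cont_pieces)
    show "continuous_on S1 r2" by (rule continuous_on_eq[OF continuous_on_const[of _ b]]) (simp add: on_S1)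
    show "continuous_on S2 r2" by (rule continuous_on_eq[OF continuous_on_id]) (simp add: on_S2)
    show "continuous_on (closed_segment a b) r2"
      by (rule continuous_on_eq[OF continuous_on_const[of _ b]]) (auto simp: segment_u on_u)
  qed
qed

text \<open>At time \<open>1\<close> the bridge has shrunk to one of its ends. The piece behind the other end would be torn off already at
time \<open>0\<close>, so \<open>slide1\<close> serves only for heights below \<open>1\<close> and \<open>slide2\<close> only for heights above \<open>0\<close>.\<close>

definition "slide1 t x = r1 x + ((1 - t) * h x) *\<^sub>R (b - a)" for t :: real
definition "slide2 t x = r2 x - ((1 - t) * (1 - h x)) *\<^sub>R (b - a)" for t :: real

lemma slide1_S1: "x \<in> S1 \<Longrightarrow> slide1 t x = x" by (simp add: slide1_def on_S1)
lemma slide2_S2: "x \<in> S2 \<Longrightarrow> slide2 t x = x" by (simp add: slide2_def on_S2)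

lemma slide1_u: "0 \<le> s \<Longrightarrow> s \<le> 1 \<Longrightarrow> slide1 t (u s) = u ((1 - t) * s)"
  by (simp add: slide1_def on_u) (simp add: u_def)

lemma slide2_u: "0 \<le> s \<Longrightarrow> s \<le> 1 \<Longrightarrow> slide2 t (u s) = u (1 - (1 - t) * (1 - s))"
proof -
  assume s: "0 \<le> s" "s \<le> 1"
  have "b - k *\<^sub>R (b - a) = u (1 - k)" for k
    unfolding u_def scaleR_left_diff_distrib by simp
  then show ?thesis unfolding slide2_def on_u[OF s] .
qed

lemma slide1_props:
  assumes "x \<in> Y" "h x < 1" "t \<in> {0..1}"
  shows "slide1 t x \<in> Y" "h (slide1 t x) \<le> h x" "r1 (slide1 t x) = r1 x" "slide1 0 x = x" "slide1 1 x \<in> S1"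
proof -
  have "slide1 t x \<in> Y \<and> h (slide1 t x) \<le> h x \<and> r1 (slide1 t x) = r1 x \<and> slide1 0 x = x \<and> slide1 1 x \<in> S1"
    using assms(1)
  proof (cases rule: Y_cases)
    case (edge s)
    have *: "0 \<le> (1 - t) * s" "(1 - t) * s \<le> 1 * s"
      using edge(1) assms(3) by (auto intro!: mult_right_mono mult_nonneg_nonneg)
    then have **: "(1 - t) * s \<le> 1" using edge(2) by linarith
    have "slide1 t x \<in> Y" using * ** edge slide1_u[of s t] unfolding Y_eq by auto
    moreover have "h (slide1 t x) \<le> h x" "r1 (slide1 t x) = r1 x"
      using * ** edge slide1_u[of s t] on_u[of "(1 - t) * s"] by auto
    moreover have "slide1 0 x = x" "slide1 1 x \<in> S1" using edge(1-3) slide1_u[of s 0] slide1_u[of s 1] ends(1) by simp_all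
    ultimately show ?thesis by (intro conjI)
  qed (use slide1_S1 assms in auto)
  then show "slide1 t x \<in> Y" "h (slide1 t x) \<le> h x" "r1 (slide1 t x) = r1 x" "slide1 0 x = x" "slide1 1 x \<in> S1"
    by simp_all
qed

lemma slide2_props:
  assumes "x \<in> Y" "h x > 0" "t \<in> {0..1}"
  shows "slide2 t x \<in> Y" "h (slide2 t x) \<ge> h x" "slide2 0 x = x" "slide2 1 x \<in> S2"
proof -
  have "slide2 t x \<in> Y \<and> h (slide2 t x) \<ge> h x \<and> slide2 0 x = x \<and> slide2 1 x \<in> S2"
    using assms(1)
  proof (cases rule: Y_cases)
    case (edge s)
    have *: "0 \<le> (1 - t) * (1 - s)" "(1 - t) * (1 - s) \<le> 1 * (1 - s)"
      using edge(1,2) assms(3) by (auto intro!: mult_right_mono mult_nonneg_nonneg)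
    have le: "0 \<le> k \<Longrightarrow> k \<le> 1 * (1 - s) \<Longrightarrow> 0 \<le> 1 - k \<and> 1 - k \<le> 1" for k :: real
      using edge(1) by auto
    have le': "k \<le> 1 * (1 - s) \<Longrightarrow> s \<le> 1 - k" for k :: real by auto
    have ***: "s \<le> 1 - (1 - t) * (1 - s)" by (rule le'[OF *(2)])
    have **: "0 \<le> 1 - (1 - t) * (1 - s) \<and> 1 - (1 - t) * (1 - s) \<le> 1" by (rule le[OF *])
    have "slide2 t x \<in> Y" using ** edge slide2_u[of s t] unfolding Y_eq by auto
    moreover have "h (slide2 t x) \<ge> h x"
      using *** ** edge slide2_u[of s t] on_u[of "1 - (1 - t) * (1 - s)"] by simp
    moreover have "slide2 0 x = x" "slide2 1 x \<in> S2" using edge(1-3) slide2_u[of s 0] slide2_u[of s 1] ends(2) by simp_all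
    ultimately show ?thesis by (intro conjI)
  qed (use slide2_S2 assms in auto)
  then show "slide2 t x \<in> Y" "h (slide2 t x) \<ge> h x" "slide2 0 x = x" "slide2 1 x \<in> S2"
    by simp_all
qed

lemma cont_slide:
  assumes "continuous_on T f" "continuous_on T k" "k ` T \<subseteq> Y"
  shows "continuous_on T (\<lambda>z. slide1 (f z) (k z))" "continuous_on T (\<lambda>z. slide2 (f z) (k z))"
proof -
  note c = continuous_on_compose2[OF cont_h assms(2,3)] continuous_on_compose2[OF cont_r1 assms(2,3)]
    continuous_on_compose2[OF cont_r2 assms(2,3)]
  show "continuous_on T (\<lambda>z. slide1 (f z) (k z))" "continuous_on T (\<lambda>z. slide2 (f z) (k z))"
    unfolding slide1_def slide2_def by (intro continuous_intros c assms(1))+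
qed

text \<open>On \<open>V1\<close> both points stay clear of \<open>S2\<close> and remain distinct when they are slid to \<open>S1\<close>; \<open>V2\<close> is the mirror image.
On \<open>A\<close> and \<open>B\<close> the points are ordered by height and can be slid apart. These sets cover all configurations, because
two distinct points of equal height both lie in \<open>S1\<close> or both in \<open>S2\<close>. The sets \<open>V1\<close> and \<open>V2\<close> are disjoint, since
\<open>r1\<close> can separate two points only if one of them lies in \<open>S1\<close>, where the height is zero.\<close>

definition "V1 = {z. fst z \<in> Y \<and> snd z \<in> Y \<and> h (fst z) < 1 \<and> h (snd z) < 1 \<and> r1 (fst z) \<noteq> r1 (snd z)}"
definition "V2 = {z. fst z \<in> Y \<and> snd z \<in> Y \<and> h (fst z) > 0 \<and> h (snd z) > 0 \<and> r2 (fst z) \<noteq> r2 (snd z)}"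
definition "A = {z. fst z \<in> Y \<and> snd z \<in> Y \<and> h (fst z) < h (snd z)}"
definition "B = {z. fst z \<in> Y \<and> snd z \<in> Y \<and> h (snd z) < h (fst z)}"

lemma flip_sets:
  "bridge.V1 S2 S1 b a = V2" "bridge.A S2 S1 b a = B"
proof -
  interpret f: bridge S2 S1 b a by (rule flip)
  have G: "f.Y = Y" unfolding f.Y_def Y_def by (simp add: Un_commute closed_segment_commute)
  show "f.V1 = V2" unfolding f.V1_def V2_def G flip_h by simp
  show "f.A = B" unfolding f.A_def B_def G flip_h by simp
qed

lemma V1_props:
  assumes "z \<in> V1"
  shows "fst z \<in> Y" "snd z \<in> Y" "h (fst z) < 1" "h (snd z) < 1" "r1 (fst z) \<noteq> r1 (snd z)"
  using assms unfolding V1_def by simp_all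

text \<open>Sliding both points towards \<open>a\<close> does not change their images under \<open>r1\<close>, so they never collide.\<close>

lemma V1_equiv: "top_of_set V1 homotopy_equivalent_space top_of_set (conf S1)"
proof (rule homotopy_equivalent_deformation[where H="\<lambda>z. (slide1 (fst z) (fst (snd z)), slide1 (fst z) (snd (snd z)))"])
  show "continuous_on ({0..1} \<times> V1) (\<lambda>z. (slide1 (fst z) (fst (snd z)), slide1 (fst z) (snd (snd z))))"
  proof (rule continuous_on_Pair)
    show "continuous_on ({0..1} \<times> V1) (\<lambda>z. slide1 (fst z) (fst (snd z)))"
      by (rule cont_slide(1)[where f=fst and k="\<lambda>z. fst (snd z)"])
        (auto intro!: continuous_intros simp: V1_def)
    show "continuous_on ({0..1} \<times> V1) (\<lambda>z. slide1 (fst z) (snd (snd z)))"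
      by (rule cont_slide(1)[where f=fst and k="\<lambda>z. snd (snd z)"])
        (auto intro!: continuous_intros simp: V1_def)
  qed
  show "conf S1 \<subseteq> V1" by (auto simp: V1_def on_S1 Y_def)
  fix t :: real and z assume t: "t \<in> {0..1}"
  show "(slide1 (fst (t, z)) (fst (snd (t, z))), slide1 (fst (t, z)) (snd (snd (t, z)))) \<in> V1" if z: "z \<in> V1"
  proof -
    note V = V1_props[OF z]
    have "h (slide1 t (fst z)) < 1" "h (slide1 t (snd z)) < 1"
      using slide1_props(2)[OF V(1,3) t] slide1_props(2)[OF V(2,4) t] V(3,4) by linarith+
    then show ?thesis
      using slide1_props(1,3)[OF V(1,3) t] slide1_props(1,3)[OF V(2,4) t] V(5) by (simp add: V1_def)
  qed
  show "(slide1 (fst (t, z)) (fst (snd (t, z))), slide1 (fst (t, z)) (snd (snd (t, z)))) \<in> conf S1" if "z \<in> conf S1"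
    using that by (auto simp: slide1_S1)
next
  fix z assume z: "z \<in> V1"
  note V = V1_props[OF z]
  show "(slide1 (fst (0, z)) (fst (snd (0, z))), slide1 (fst (0, z)) (snd (snd (0, z)))) = z"
    using slide1_props(4)[OF V(1,3), of 0] slide1_props(4)[OF V(2,4), of 0] by simp
  have "r1 (slide1 1 (fst z)) \<noteq> r1 (slide1 1 (snd z))"
    using slide1_props(3)[OF V(1,3), of 1] slide1_props(3)[OF V(2,4), of 1] V(5) by simp
  then have "slide1 1 (fst z) \<noteq> slide1 1 (snd z)" by metis
  then show "(slide1 (fst (1, z)) (fst (snd (1, z))), slide1 (fst (1, z)) (snd (snd (1, z)))) \<in> conf S1"
    using slide1_props(5)[OF V(1,3), of 1] slide1_props(5)[OF V(2,4), of 1] by simp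
qed

lemma A_props:
  assumes "z \<in> A"
  shows "fst z \<in> Y" "snd z \<in> Y" "h (fst z) < h (snd z)" "h (fst z) < 1" "h (snd z) > 0"
proof -
  show *: "fst z \<in> Y" "snd z \<in> Y" "h (fst z) < h (snd z)"
    using assms unfolding A_def by simp_all
  show "h (fst z) < 1" "h (snd z) > 0"
    using h_range[OF *(1)] h_range[OF *(2)] *(3) by linarith+
qed

text \<open>The lower point slides down to \<open>a\<close> while the upper one slides up to \<open>b\<close>; the heights move apart.\<close>

lemma A_equiv: "top_of_set A homotopy_equivalent_space top_of_set (S1 \<times> S2)"
proof (rule homotopy_equivalent_deformation[where H="\<lambda>z. (slide1 (fst z) (fst (snd z)), slide2 (fst z) (snd (snd z)))"])
  show "continuous_on ({0..1} \<times> A) (\<lambda>z. (slide1 (fst z) (fst (snd z)), slide2 (fst z) (snd (snd z))))"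
  proof (rule continuous_on_Pair)
    show "continuous_on ({0..1} \<times> A) (\<lambda>z. slide1 (fst z) (fst (snd z)))"
      by (rule cont_slide(1)[where f=fst and k="\<lambda>z. fst (snd z)"])
        (auto intro!: continuous_intros simp: A_def)
    show "continuous_on ({0..1} \<times> A) (\<lambda>z. slide2 (fst z) (snd (snd z)))"
      by (rule cont_slide(2)[where f=fst and k="\<lambda>z. snd (snd z)"])
        (auto intro!: continuous_intros simp: A_def)
  qed
  show "S1 \<times> S2 \<subseteq> A" by (auto simp: A_def on_S1 on_S2 Y_def)
  fix t :: real and z assume t: "t \<in> {0..1}" 
  show "(slide1 (fst (t, z)) (fst (snd (t, z))), slide2 (fst (t, z)) (snd (snd (t, z)))) \<in> A" if z: "z \<in> A"
  proof -
    note A = A_props[OF z]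
    have "h (slide1 t (fst z)) < h (slide2 t (snd z))"
      using slide1_props(2)[OF A(1,4) t] slide2_props(2)[OF A(2,5) t] A(3) by linarith
    then show ?thesis
      using slide1_props(1)[OF A(1,4) t] slide2_props(1)[OF A(2,5) t] by (simp add: A_def)
  qed
  show "(slide1 (fst (t, z)) (fst (snd (t, z))), slide2 (fst (t, z)) (snd (snd (t, z)))) \<in> S1 \<times> S2" if "z \<in> S1 \<times> S2"
    using that by (auto simp: slide1_S1 slide2_S2)
next
  fix z assume z: "z \<in> A"
  note A = A_props(1,2,4,5)[OF z]
  show "(slide1 (fst (0, z)) (fst (snd (0, z))), slide2 (fst (0, z)) (snd (snd (0, z)))) = z"
    using slide1_props(4)[OF A(1,3), of 0] slide2_props(3)[OF A(2,4), of 0] by simp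
  show "(slide1 (fst (1, z)) (fst (snd (1, z))), slide2 (fst (1, z)) (snd (snd (1, z)))) \<in> S1 \<times> S2"
    using slide1_props(5)[OF A(1,3), of 1] slide2_props(4)[OF A(2,4), of 1] by simp
qed

lemma V2_equiv: "top_of_set V2 homotopy_equivalent_space top_of_set (conf S2)"
  using bridge.V1_equiv[OF flip] by (simp add: flip_sets)

lemma B_equiv: "top_of_set B homotopy_equivalent_space top_of_set (S2 \<times> S1)"
  using bridge.A_equiv[OF flip] by (simp add: flip_sets)

lemma V1A: "V1 \<inter> A = (S1 - {a}) \<times> O'"
proof (intro equalityI subsetI)
  fix z assume "z \<in> V1 \<inter> A"
  then have "z \<in> V1" "z \<in> A" by simp_all
  note V = V1_props[OF this(1)] and A = A_props[OF this(2)]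
  obtain s where s: "0 < s" "s < 1" "snd z = u s" "r1 (snd z) = a"
  proof -
    from V(2) show ?thesis
    proof (cases rule: Y_cases)
      case (edge s)
      then show ?thesis by (intro that[of s])
    qed (use V(4) A(5) in simp_all)
  qed
  have "fst z \<in> S1 - {a}"
    using V(1)
  proof (cases rule: Y_cases)
    case S1
    then show ?thesis using V(5) s(4) by auto
  qed (use V(3,5) s(4) in simp_all)
  then show "z \<in> (S1 - {a}) \<times> O'" using s(1-3) by (simp add: mem_Times_iff)
next
  fix z assume "z \<in> (S1 - {a}) \<times> O'"
  then have x: "fst z \<in> S1" "fst z \<noteq> a" "snd z \<in> O'" by auto
  from x(3) obtain s where s: "0 < s" "s < 1" "snd z = u s" by auto
  then have "snd z \<in> Y" "fst z \<in> Y" unfolding Y_eq using x(1) by auto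
  then show "z \<in> V1 \<inter> A"
    using s x(1,2) on_u[of s] on_S1[of "fst z"] by (simp add: V1_def A_def)
qed

lemma swap_sets: "B = prod.swap ` A" "prod.swap ` V1 = V1"
proof -
  show "B = prod.swap ` A"
  proof (intro equalityI subsetI)
    fix z assume "z \<in> B"
    then have "prod.swap z \<in> A" by (simp add: A_def B_def)
    then show "z \<in> prod.swap ` A" by (intro image_eqI[of _ _ "prod.swap z"]) simp_all
  qed (auto simp: A_def B_def)
  have sw: "prod.swap z \<in> V1" if "z \<in> V1" for z using that by (auto simp: V1_def)
  show "prod.swap ` V1 = V1"
  proof (intro equalityI subsetI)
    fix z assume "z \<in> V1"
    then show "z \<in> prod.swap ` V1" using sw by (intro image_eqI[of _ _ "prod.swap z"]) simp_all
  qed (use sw in auto)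
qed

lemma V1B: "V1 \<inter> B = O' \<times> (S1 - {a})"
proof -
  have "V1 \<inter> B = prod.swap ` V1 \<inter> prod.swap ` A" using swap_sets by simp
  also have "\<dots> = prod.swap ` (V1 \<inter> A)" by (rule image_Int[symmetric]) (rule inj_swap)
  also have "\<dots> = O' \<times> (S1 - {a})" unfolding V1A by (rule swap_Times)
  finally show ?thesis .
qed

lemma V2B: "V2 \<inter> B = (S2 - {b}) \<times> O'" and V2A: "V2 \<inter> A = O' \<times> (S2 - {b})"
proof -
  interpret f: bridge S2 S1 b a by (rule flip)
  have O: "f.O' = O'" unfolding f.open_edge[symmetric] open_edge[symmetric] by (rule open_segment_commute)
  show "V2 \<inter> B = (S2 - {b}) \<times> O'" using f.V1A unfolding flip_sets O .
  have "f.B = A" using f.flip_sets(2)[symmetric] .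
  then show "V2 \<inter> A = O' \<times> (S2 - {b})" using f.V1B unfolding flip_sets O by simp
qed

lemma V12: "V1 \<inter> V2 = {}"
proof -
  have r: "r1 x = a" if "x \<in> Y" "h x > 0" for x
    using that(1) by (cases rule: Y_cases) (use that(2) in simp_all)
  show ?thesis
  proof (rule ccontr)
    assume "V1 \<inter> V2 \<noteq> {}"
    then obtain z where "z \<in> V1" "z \<in> V2" by blast
    then have "r1 (fst z) = a" "r1 (snd z) = a" "r1 (fst z) \<noteq> r1 (snd z)"
      using r[of "fst z"] r[of "snd z"] unfolding V1_def V2_def by simp_all
    then show False by simp
  qed
qed

lemma AB: "A \<inter> B = {}" by (auto simp: A_def B_def)

lemma conf_cover: "(V1 \<union> V2) \<union> (A \<union> B) = conf Y"
proof (rule equalityI)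
  have "V1 \<subseteq> conf Y" "V2 \<subseteq> conf Y" "A \<subseteq> conf Y" "B \<subseteq> conf Y"
  proof -
    have "z \<in> conf Y" if "z \<in> V1" for z using that unfolding conf_iff V1_def by auto
    then show "V1 \<subseteq> conf Y" by (rule subsetI)
    have "z \<in> conf Y" if "z \<in> V2" for z using that unfolding conf_iff V2_def by auto
    then show "V2 \<subseteq> conf Y" by (rule subsetI)
    have "z \<in> conf Y" if "z \<in> A" for z using that unfolding conf_iff A_def by auto
    then show "A \<subseteq> conf Y" by (rule subsetI)
    have "z \<in> conf Y" if "z \<in> B" for z using that unfolding conf_iff B_def by auto
    then show "B \<subseteq> conf Y" by (rule subsetI)
  qed
  then show "(V1 \<union> V2) \<union> (A \<union> B) \<subseteq> conf Y" by simp
  show "conf Y \<subseteq> (V1 \<union> V2) \<union> (A \<union> B)"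
  proof
    fix z assume "z \<in> conf Y"
    then have z: "fst z \<in> Y" "snd z \<in> Y" "fst z \<noteq> snd z" unfolding conf_iff by simp_all
    have "z \<in> V1 \<union> V2" if eq: "h (fst z) = h (snd z)"
      using z(1)
    proof (cases rule: Y_cases)
      case S1
      have h0: "h (snd z) = 0" using S1(2) eq by simp
      from z(2) have "snd z \<in> S1"
        by (cases rule: Y_cases) (use h0 in simp_all)
      then show ?thesis using S1(1) z by (simp add: V1_def on_S1)
    next
      case S2
      have h1: "h (snd z) = 1" using S2(2) eq by simp
      from z(2) have "snd z \<in> S2"
        by (cases rule: Y_cases) (use h1 in simp_all)
      then show ?thesis using S2(1) z by (simp add: V2_def on_S2)
    next
      case (edge s)
      have hs: "h (snd z) = s" using edge(4) eq by simp
      from z(2) have "snd z = u s"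
        by (cases rule: Y_cases) (use edge(1,2) hs in simp_all)
      then show ?thesis using edge(3) z(3) by simp
    qed
    then show "z \<in> (V1 \<union> V2) \<union> (A \<union> B)"
      using z(1,2) less_linear[of "h (fst z)" "h (snd z)"] unfolding A_def B_def by blast
  qed
qed

lemma open_sets:
  "openin (top_of_set (conf Y)) V1" "openin (top_of_set (conf Y)) V2"
  "openin (top_of_set (conf Y)) A" "openin (top_of_set (conf Y)) B"
proof -
  have pre: "openin (top_of_set (conf Y)) {z \<in> conf Y. f z \<in> T}" if "continuous_on (conf Y) f" "open T"
    for f :: "'a \<times> 'a \<Rightarrow> 'c::topological_space" and T
    using continuous_openin_preimage_gen[OF that] by (simp add: vimage_def Int_def Collect_conj_eq[symmetric])
  have sub: "fst ` conf Y \<subseteq> Y" "snd ` conf Y \<subseteq> Y" by (auto)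
  note c = continuous_on_compose2[OF cont_h continuous_on_fst[OF continuous_on_id] sub(1)]
     continuous_on_compose2[OF cont_h continuous_on_snd[OF continuous_on_id] sub(2)]
     continuous_on_compose2[OF cont_r1 continuous_on_fst[OF continuous_on_id] sub(1)]
     continuous_on_compose2[OF cont_r1 continuous_on_snd[OF continuous_on_id] sub(2)]
     continuous_on_compose2[OF cont_r2 continuous_on_fst[OF continuous_on_id] sub(1)]
     continuous_on_compose2[OF cont_r2 continuous_on_snd[OF continuous_on_id] sub(2)]
  have d: "openin (top_of_set (conf Y)) {z \<in> conf Y. h (fst z) < h (snd z)}"
    "openin (top_of_set (conf Y)) {z \<in> conf Y. h (snd z) < h (fst z)}"
    using pre[OF continuous_on_diff[OF c(1) c(2)], of "{..<0}"] pre[OF continuous_on_diff[OF c(2) c(1)], of "{..<0}"]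
    by simp_all
  have e1: "A = {z \<in> conf Y. h (fst z) < h (snd z)}"
  proof -
    have "z \<in> A \<longleftrightarrow> z \<in> conf Y \<and> h (fst z) < h (snd z)" for z unfolding conf_iff A_def by auto
    then show ?thesis by blast
  qed
  have e2: "B = {z \<in> conf Y. h (snd z) < h (fst z)}"
  proof -
    have "z \<in> B \<longleftrightarrow> z \<in> conf Y \<and> h (snd z) < h (fst z)" for z unfolding conf_iff B_def by auto
    then show ?thesis by blast
  qed
  show "openin (top_of_set (conf Y)) A" "openin (top_of_set (conf Y)) B" unfolding e1 e2 by (rule d)+
  have "V1 = {z \<in> conf Y. h (fst z) \<in> {..<1}} \<inter> {z \<in> conf Y. h (snd z) \<in> {..<1}} \<inter> {z \<in> conf Y. r1 (fst z) - r1 (snd z) \<in> -{0}}"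
  proof -
    have "z \<in> V1 \<longleftrightarrow> z \<in> conf Y \<and> h (fst z) \<in> {..<1} \<and> h (snd z) \<in> {..<1} \<and> r1 (fst z) - r1 (snd z) \<in> -{0}" for z
      unfolding conf_iff V1_def by auto
    then show ?thesis by blast
  qed
  also have "openin (top_of_set (conf Y)) \<dots>"
    by (intro openin_Int pre[OF c(1)] pre[OF c(2)] pre[OF continuous_on_diff[OF c(3) c(4)]]) auto
  finally show "openin (top_of_set (conf Y)) V1" .
  have "V2 = {z \<in> conf Y. h (fst z) \<in> {0<..}} \<inter> {z \<in> conf Y. h (snd z) \<in> {0<..}} \<inter> {z \<in> conf Y. r2 (fst z) - r2 (snd z) \<in> -{0}}"
  proof -
    have "z \<in> V2 \<longleftrightarrow> z \<in> conf Y \<and> h (fst z) \<in> {0<..} \<and> h (snd z) \<in> {0<..} \<and> r2 (fst z) - r2 (snd z) \<in> -{0}" for z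
      unfolding conf_iff V2_def by auto
    then show ?thesis by blast
  qed
  also have "openin (top_of_set (conf Y)) \<dots>"
    by (intro openin_Int pre[OF c(1)] pre[OF c(2)] pre[OF continuous_on_diff[OF c(5) c(6)]]) auto
  finally show "openin (top_of_set (conf Y)) V2" .
qed

end

section \<open>The homology of two points on a space with a bridge\<close>

lemma continuous_on_id2: "continuous_on S id" unfolding id_def by (rule continuous_on_id)

text \<open>In the criterion the parts index their own test maps. Empty parts may coincide as sets; such a set is assigned the
first map listed for it.\<close>

lemma four_test_maps:
  fixes W1 W2 W3 W4 R Q :: "'a::topological_space set" and T1 T2 :: "'b::t1_space set"
  assumes R: "R = (W1 \<union> W2) \<union> (W3 \<union> W4)"
    and disj: "W1 \<inter> W2 = {}" "W3 \<inter> W4 = {}" "(W1 \<union> W2) \<inter> (W3 \<union> W4) = {}"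
    and op: "openin (top_of_set R) W1" "openin (top_of_set R) W2" "openin (top_of_set R) W3" "openin (top_of_set R) W4"
    and sub: "R \<subseteq> Q"
    and cont: "continuous_on Q f1" "continuous_on Q f2" "continuous_on Q f3" "continuous_on Q f4"
    and im: "f1 ` Q \<subseteq> T1" "f2 ` Q \<subseteq> T1" "f3 ` Q \<subseteq> T2" "f4 ` Q \<subseteq> T2"
    and const: "\<And>z. z \<in> W2 \<union> (W3 \<union> W4) \<Longrightarrow> f1 z = y1" "\<And>z. z \<in> W1 \<union> (W3 \<union> W4) \<Longrightarrow> f2 z = y1"
      "\<And>z. z \<in> W4 \<union> (W1 \<union> W2) \<Longrightarrow> f3 z = y2" "\<And>z. z \<in> W3 \<union> (W1 \<union> W2) \<Longrightarrow> f4 z = y2"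
    and inj: "inj_on (hmap 1 W1 T1 f1) (carrier (hgroup 1 W1))" "inj_on (hmap 1 W2 T1 f2) (carrier (hgroup 1 W2))"
      "inj_on (hmap 1 W3 T2 f3) (carrier (hgroup 1 W3))" "inj_on (hmap 1 W4 T2 f4) (carrier (hgroup 1 W4))"
    and c: "c \<in> carrier (hgroup 1 R)" "hmap 1 R Q id c = \<one>\<^bsub>hgroup 1 Q\<^esub>"
  shows "c = \<one>\<^bsub>hgroup 1 R\<^esub>"
proof -
  define \<U> where "\<U> = {W1, W2, W3, W4}"
  have un: "\<Union>\<U> = R" unfolding R \<U>_def by auto
  define f where "f U = (if U = W1 then f1 else if U = W2 then f2 else if U = W3 then f3 else f4)" for U
  define T where "T U = (if U = W1 \<or> U = W2 then T1 else T2)" for U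
  have pick: "PP U (f U) (T U)"
    if "U \<in> \<U>" "PP W1 f1 T1" "PP W2 f2 T1" "U \<noteq> W1 \<Longrightarrow> U \<noteq> W2 \<Longrightarrow> PP W3 f3 T2"
      "U \<noteq> W1 \<Longrightarrow> U \<noteq> W2 \<Longrightarrow> PP W4 f4 T2" for U PP
    using that unfolding \<U>_def f_def T_def by auto
  have fT: "continuous_on Q (f U)" "f U ` Q \<subseteq> T U" if "U \<in> \<U>" for U
    using pick[OF that, where PP="\<lambda>_ f T. continuous_on Q f \<and> f ` Q \<subseteq> T"] cont im by simp_all
  have "c = \<one>\<^bsub>hgroup 1 (\<Union>\<U>)\<^esub>"
  proof (rule test_maps_detect[where f=f and T=T])
    show "finite \<U>" by (simp add: \<U>_def)
    have d: "W1 \<inter> W2 = {}" "W1 \<inter> W3 = {}" "W1 \<inter> W4 = {}" "W2 \<inter> W3 = {}" "W2 \<inter> W4 = {}" "W3 \<inter> W4 = {}"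
      using disj by blast+
    show "pairwise disjnt \<U>"
    proof (rule pairwiseI)
      fix U V assume "U \<in> \<U>" "V \<in> \<U>" "U \<noteq> V"
      then show "disjnt U V" unfolding \<U>_def disjnt_def insert_iff empty_iff
        by (elim disjE; simp only: d d[THEN trans[OF Int_commute]] simp_thms)
    qed
    show "openin (top_of_set (\<Union>\<U>)) U" if "U \<in> \<U>" for U
      using that op unfolding un unfolding \<U>_def by blast
    show "continuous_on (\<Union>\<U>) (f U) \<and> f U ` \<Union>\<U> \<subseteq> T U" if "U \<in> \<U>" for U
      unfolding un using continuous_on_subset[OF fT(1)[OF that] sub] image_mono[OF sub, of "f U"] fT(2)[OF that]
      by (intro conjI) (assumption, rule subset_trans)
    show "\<exists>y. \<forall>x\<in>V. f U x = y" if UV: "U \<in> \<U>" "V \<in> \<U>" "U \<noteq> V" for U V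
    proof -
      have V: "V = W1 \<or> V = W2 \<or> V = W3 \<or> V = W4" using UV(2) unfolding \<U>_def by simp
      have 1: "V \<noteq> W1 \<longrightarrow> (\<forall>x\<in>V. f1 x = y1)" using V const(1) by blast
      have 2: "V \<noteq> W2 \<longrightarrow> (\<forall>x\<in>V. f2 x = y1)" using V const(2) by blast
      have 3: "V \<noteq> W3 \<longrightarrow> (\<forall>x\<in>V. f3 x = y2)" using V const(3) by blast
      have 4: "V \<noteq> W4 \<longrightarrow> (\<forall>x\<in>V. f4 x = y2)" using V const(4) by blast
      have "V \<noteq> U \<longrightarrow> (\<exists>y. \<forall>x\<in>V. f U x = y)"
        by (rule pick[OF UV(1), where PP="\<lambda>U f _. V \<noteq> U \<longrightarrow> (\<exists>y. \<forall>x\<in>V. f x = y)"]) (use 1 2 3 4 in blast)+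
      then show ?thesis using UV(3) by simp
    qed
    show "inj_on (hmap 1 U (T U) (f U)) (carrier (hgroup 1 U))" if "U \<in> \<U>" for U
      by (rule pick[OF that, where PP="\<lambda>U f T. inj_on (hmap 1 U T f) (carrier (hgroup 1 U))"]) (rule inj)+
    show "c \<in> carrier (hgroup 1 (\<Union>\<U>))" unfolding un by (rule c(1))
    show "hmap 1 (\<Union>\<U>) (T U) (f U) c = \<one>\<^bsub>hgroup 1 (T U)\<^esub>" if "U \<in> \<U>" for U
    proof -
      have "hmap 1 Q (T U) (f U) (hmap 1 R Q id c) = hmap 1 R (T U) (f U \<circ> id) c"
        by (rule hmap_compose[OF continuous_on_id2 _ fT[OF that]]) (use sub in simp)
      then show ?thesis unfolding un c(2) by (simp add: hmap_one)
    qed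
  qed simp
  then show ?thesis unfolding un .
qed

context bridge
begin

abbreviation "P \<equiv> V1 \<union> V2"
abbreviation "Q \<equiv> A \<union> B"

lemma open_in_conf:
  assumes "openin (top_of_set (conf Y)) T" "T \<subseteq> Z" "Z \<subseteq> conf Y"
  shows "openin (top_of_set Z) T"
  using assms by (rule openin_subset_trans)

lemma subs: "V1 \<subseteq> conf Y" "V2 \<subseteq> conf Y" "A \<subseteq> conf Y" "B \<subseteq> conf Y"
  unfolding conf_cover[symmetric] by (rule le_supI1[OF Un_upper1], rule le_supI1[OF Un_upper2],
    rule le_supI2[OF Un_upper1], rule le_supI2[OF Un_upper2])

lemma open_PQ: "openin (top_of_set (P \<union> Q)) P" "openin (top_of_set (P \<union> Q)) Q"
  unfolding conf_cover by (intro openin_Un open_sets)+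

lemma open_P: "openin (top_of_set P) V1" "openin (top_of_set P) V2"
  by (rule open_in_conf[OF open_sets(1) Un_upper1 Un_least[OF subs(1,2)]],
    rule open_in_conf[OF open_sets(2) Un_upper2 Un_least[OF subs(1,2)]])

lemma open_Q: "openin (top_of_set Q) A" "openin (top_of_set Q) B"
  by (rule open_in_conf[OF open_sets(3) Un_upper1 Un_least[OF subs(3,4)]],
    rule open_in_conf[OF open_sets(4) Un_upper2 Un_least[OF subs(3,4)]])

abbreviation "W1 \<equiv> (S1 - {a}) \<times> O'"
abbreviation "W2 \<equiv> O' \<times> (S1 - {a})"
abbreviation "W3 \<equiv> O' \<times> (S2 - {b})"
abbreviation "W4 \<equiv> (S2 - {b}) \<times> O'"

lemma PQ_eq: "P \<inter> Q = (W1 \<union> W2) \<union> (W3 \<union> W4)"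
  unfolding V1A[symmetric] V1B[symmetric] V2A[symmetric] V2B[symmetric] Int_Un_distrib2 Int_Un_distrib
  by (simp only: Un_ac)

lemma O'_disjoint: "O' \<inter> S1 = {}" "O' \<inter> S2 = {}"
  using u_notin by auto

lemma W_open:
  "openin (top_of_set (P \<inter> Q)) W1" "openin (top_of_set (P \<inter> Q)) W2"
  "openin (top_of_set (P \<inter> Q)) W3" "openin (top_of_set (P \<inter> Q)) W4"
proof -
  have *: "openin (top_of_set (P \<inter> Q)) (T \<inter> T')"
    if "openin (top_of_set (conf Y)) T" "openin (top_of_set (conf Y)) T'" "T \<subseteq> P" "T' \<subseteq> Q" for T T'
  proof (rule open_in_conf[OF openin_Int[OF that(1,2)]])
    show "T \<inter> T' \<subseteq> P \<inter> Q" using that(3,4) by blast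
    show "P \<inter> Q \<subseteq> conf Y" by (rule le_infI1[OF Un_least[OF subs(1,2)]])
  qed
  show "openin (top_of_set (P \<inter> Q)) W1" unfolding V1A[symmetric] by (rule *[OF open_sets(1,3) Un_upper1 Un_upper1])
  show "openin (top_of_set (P \<inter> Q)) W2" unfolding V1B[symmetric] by (rule *[OF open_sets(1,4) Un_upper1 Un_upper2])
  show "openin (top_of_set (P \<inter> Q)) W3" unfolding V2A[symmetric] by (rule *[OF open_sets(2,3) Un_upper2 Un_upper1])
  show "openin (top_of_set (P \<inter> Q)) W4" unfolding V2B[symmetric] by (rule *[OF open_sets(2,4) Un_upper2 Un_upper2])
qed

lemma W_disjoint: "W1 \<inter> W2 = {}" "W3 \<inter> W4 = {}" "(W1 \<union> W2) \<inter> (W3 \<union> W4) = {}"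
proof -
  have d: "(T \<times> U) \<inter> (T' \<times> U') = {}" if "T \<inter> T' = {} \<or> U \<inter> U' = {}" for T U T' U' :: "'a set"
    using that unfolding Times_Int_Times by (elim disjE) simp_all
  have i: "(S1 - {a}) \<inter> O' = {}" "O' \<inter> (S1 - {a}) = {}" "(S2 - {b}) \<inter> O' = {}" "O' \<inter> (S2 - {b}) = {}"
    "(S1 - {a}) \<inter> (S2 - {b}) = {}"
    using O'_disjoint disj by blast+
  show "W1 \<inter> W2 = {}" "W3 \<inter> W4 = {}" by (rule d, rule disjI1, rule i)+
  have "W1 \<inter> W3 = {}" by (rule d, rule disjI1, rule i)
  moreover have "W1 \<inter> W4 = {}" by (rule d, rule disjI1, rule i)
  moreover have "W2 \<inter> W3 = {}" by (rule d, rule disjI2, rule i)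
  moreover have "W2 \<inter> W4 = {}" by (rule d, rule disjI1, rule i)
  ultimately show "(W1 \<union> W2) \<inter> (W3 \<union> W4) = {}"
    unfolding Int_Un_distrib Int_Un_distrib2 by simp
qed

lemma O'_convex: "convex O'" "O' \<noteq> {}"
proof -
  have "(1/2::real) \<in> {0<..<1}" by simp
  then show "O' \<noteq> {}" by blast
qed (intro convex_u convex_real_interval)

lemma W_homology:
  assumes "hfin p (S1 - {a})" "hfin p (S2 - {b})"
  shows "hfin p (P \<inter> Q)" "bnum p (P \<inter> Q) = 2 * bnum p (S1 - {a}) + 2 * bnum p (S2 - {b})"
proof -
  have 1: "hfin p (T \<times> O')" "bnum p (T \<times> O') = bnum p T" "hfin p (O' \<times> T)" "bnum p (O' \<times> T) = bnum p T"
    if "hfin p T" for T :: "'a set"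
    using homology_convex_factor[OF O'_convex, of p T] swap_homology[of p "T \<times> O'"] that
    by (simp_all add: swap_Times)
  have o: "openin (top_of_set (W1 \<union> W2)) W1" "openin (top_of_set (W1 \<union> W2)) W2"
    "openin (top_of_set (W3 \<union> W4)) W3" "openin (top_of_set (W3 \<union> W4)) W4"
    "openin (top_of_set ((W1 \<union> W2) \<union> (W3 \<union> W4))) (W1 \<union> W2)"
    "openin (top_of_set ((W1 \<union> W2) \<union> (W3 \<union> W4))) (W3 \<union> W4)"
    using W_open unfolding PQ_eq by (auto intro: openin_subset_trans intro!: openin_Un)
  note a = 1[OF assms(1)] and b = 1[OF assms(2)]
  note u = homology_disjoint_union[OF o(1,2) W_disjoint(1) a(1,3)]
  note v = homology_disjoint_union[OF o(3,4) W_disjoint(2) b(3,1)]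
  show "hfin p (P \<inter> Q)" "bnum p (P \<inter> Q) = 2 * bnum p (S1 - {a}) + 2 * bnum p (S2 - {b})"
    unfolding PQ_eq using homology_disjoint_union[OF o(5,6) W_disjoint(3) u(1) v(1)] u(2) v(2) a(2,4) b(2,4)
    by simp_all
qed

lemma W_htriv:
  assumes "htriv p (S1 - {a})" "htriv p (S2 - {b})"
  shows "htriv p (P \<inter> Q)"
proof -
  have 1: "htriv p (T \<times> O')" "htriv p (O' \<times> T)" if "htriv p T" for T :: "'a set"
    using homology_convex_factor(3)[OF O'_convex, of p T] swap_homology(3)[of p "T \<times> O'"] that
    by (simp_all add: swap_Times)
  have o: "openin (top_of_set (W1 \<union> W2)) W1" "openin (top_of_set (W1 \<union> W2)) W2"
    "openin (top_of_set (W3 \<union> W4)) W3" "openin (top_of_set (W3 \<union> W4)) W4"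
    "openin (top_of_set ((W1 \<union> W2) \<union> (W3 \<union> W4))) (W1 \<union> W2)"
    "openin (top_of_set ((W1 \<union> W2) \<union> (W3 \<union> W4))) (W3 \<union> W4)"
    using W_open unfolding PQ_eq by (auto intro: openin_subset_trans intro!: openin_Un)
  have e: "htriv q (T \<inter> T')" if "T \<inter> T' = {}" for q and T T' :: "('a \<times> 'a) set"
    unfolding that by simp
  note a = 1[OF assms(1)] and b = 1[OF assms(2)]
  note u = homology_trivial_union[OF o(1,2) a(1,2) e[OF W_disjoint(1)]]
  note v = homology_trivial_union[OF o(3,4) b(2,1) e[OF W_disjoint(2)]]
  show ?thesis
    unfolding PQ_eq by (rule homology_trivial_union[OF o(5,6) u v e[OF W_disjoint(3)]])
qed

lemma P_homology:
  assumes "hfin p (conf S1)" "hfin p (conf S2)"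
  shows "hfin p P" "bnum p P = bnum p (conf S1) + bnum p (conf S2)"
proof -
  have 1: "hfin p V1" "bnum p V1 = bnum p (conf S1)" "hfin p V2" "bnum p V2 = bnum p (conf S2)"
    using homotopy_invariance(1,2)[OF V1_equiv, of p] homotopy_invariance(1,2)[OF V2_equiv, of p] assms by metis+
  show "hfin p P" "bnum p P = bnum p (conf S1) + bnum p (conf S2)"
    using homology_disjoint_union[OF open_P V12 1(1,3)] unfolding 1 .
qed

lemma Q_homology:
  assumes "hfin p (S1 \<times> S2)"
  shows "hfin p Q" "bnum p Q = 2 * bnum p (S1 \<times> S2)"
proof -
  have 0: "hfin p (S2 \<times> S1)" "bnum p (S2 \<times> S1) = bnum p (S1 \<times> S2)"
    using swap_homology(1,2)[of p "S1 \<times> S2"] assms unfolding swap_Times by simp_all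
  have 1: "hfin p A" "bnum p A = bnum p (S1 \<times> S2)" "hfin p B" "bnum p B = bnum p (S1 \<times> S2)"
    using homotopy_invariance(1,2)[OF A_equiv, of p] homotopy_invariance(1,2)[OF B_equiv, of p] assms 0 by metis+
  show "hfin p Q" "bnum p Q = 2 * bnum p (S1 \<times> S2)"
    using homology_disjoint_union[OF open_Q AB 1(1,3)] unfolding 1 by simp_all
qed

lemma Q_htriv:
  assumes "htriv p (S1 \<times> S2)" "htriv p (S2 \<times> S1)"
  shows "htriv p Q"
proof (rule homology_trivial_union[OF open_Q])
  show "htriv p A" using homotopy_invariance(3)[OF A_equiv] assms(1) by (rule iffD2)
  show "htriv p B" using homotopy_invariance(3)[OF B_equiv] assms(2) by (rule iffD2)
  show "htriv (p-1) (A \<inter> B)" unfolding AB by simp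
qed

text \<open>The four retractions of a coordinate to \<open>S1\<close> or \<open>S2\<close> are defined on all of \<open>Q\<close>; on \<open>P \<inter> Q\<close> each
  of them sees exactly one of the four pieces.\<close>

lemma common_ker_1:
  assumes inj: "inj_on (hmap 1 (S1 - {a}) S1 id) (carrier (hgroup 1 (S1 - {a})))"
    "inj_on (hmap 1 (S2 - {b}) S2 id) (carrier (hgroup 1 (S2 - {b})))"
  shows "common_ker 1 P Q \<subseteq> {\<one>\<^bsub>hgroup 1 (P \<inter> Q)\<^esub>}"
proof
  fix c assume "c \<in> common_ker 1 P Q"
  then have c: "c \<in> carrier (hgroup 1 (P \<inter> Q))" "hmap 1 (P \<inter> Q) Q id c = \<one>\<^bsub>hgroup 1 Q\<^esub>"
    by (simp_all add: common_ker_def)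
  have AY: "fst z \<in> Y" "snd z \<in> Y" if "z \<in> Q" for z
    using that unfolding A_def B_def by (simp_all only: Un_iff mem_Collect_eq) (elim disjE conjE; assumption)+
  have QY: "fst ` Q \<subseteq> Y" "snd ` Q \<subseteq> Y" by (rule image_subsetI, erule AY)+
  have cont: "continuous_on Q (r1 \<circ> fst)" "continuous_on Q (r1 \<circ> snd)" "continuous_on Q (r2 \<circ> snd)" "continuous_on Q (r2 \<circ> fst)"
    by (rule continuous_on_compose, rule continuous_on_fst[OF continuous_on_id] continuous_on_snd[OF continuous_on_id],
      rule continuous_on_subset[OF _ QY(1)] continuous_on_subset[OF _ QY(2)], rule cont_r1 cont_r2)+
  have rO: "r1 y = a" "r2 y = b" if y: "y \<in> O'" for y
  proof -
    obtain s where "y = u s" "s \<in> {0<..<1}" by (rule imageE[OF y]) (rule that)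
    then show "r1 y = a" "r2 y = b" using on_u[of s] by simp_all
  qed
  have rS1: "r2 y = b" "r1 y = y" if "y \<in> S1 - {a}" for y using on_S1 that by simp_all
  have rS2: "r1 y = a" "r2 y = y" if "y \<in> S2 - {b}" for y using on_S2 that by simp_all
  have fstW: "fst z \<in> X" "snd z \<in> X'" if "z \<in> X \<times> X'" for z and X X' :: "'a set" using that by (simp_all add: mem_Times_iff)
  have sub1: "S1 - {a} \<subseteq> S1" "S2 - {b} \<subseteq> S2" by (rule Diff_subset)+
  have fst_inj: "inj_on (hmap 1 (X \<times> O') X fst) (carrier (hgroup 1 (X \<times> O')))" for X :: "'a set"
    using fst_convex_factor_iso[OF O'_convex, of 1 X] by (simp only: iso_def mem_Collect_eq bij_betw_def)
  have c_fst: "continuous_on Z (fst :: 'a \<times> 'a \<Rightarrow> 'a)" "continuous_on Z (snd :: 'a \<times> 'a \<Rightarrow> 'a)" for Z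
    by (rule continuous_on_fst[OF continuous_on_id] continuous_on_snd[OF continuous_on_id])+
  have im_fst: "fst ` (X \<times> X') \<subseteq> X" "snd ` (X' \<times> X) \<subseteq> X" for X X' :: "'a set" by (rule image_subsetI, erule fstW)+
  have im_id: "id ` (S1 - {a}) \<subseteq> S1" "id ` (S2 - {b}) \<subseteq> S2" unfolding id_def by simp_all
  have "c = \<one>\<^bsub>hgroup 1 (P \<inter> Q)\<^esub>"
  proof (rule four_test_maps[OF PQ_eq W_disjoint W_open _ cont _ _ _ _ _ _ _ _ _ _ _ _ c])
    show "P \<inter> Q \<subseteq> Q" by (rule Int_lower2)
    show "(r1 \<circ> fst) ` Q \<subseteq> S1" "(r1 \<circ> snd) ` Q \<subseteq> S1" "(r2 \<circ> snd) ` Q \<subseteq> S2" "(r2 \<circ> fst) ` Q \<subseteq> S2"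
      by (rule image_subsetI, subst o_apply, rule r_range)+
    show "(r1 \<circ> fst) z = a" if "z \<in> W2 \<union> (W3 \<union> W4)" for z
      using that unfolding o_apply by (elim UnE) (rule rO rS2, erule fstW)+
    show "(r1 \<circ> snd) z = a" if "z \<in> W1 \<union> (W3 \<union> W4)" for z
      using that unfolding o_apply by (elim UnE) (rule rO rS2, erule fstW)+
    show "(r2 \<circ> snd) z = b" if "z \<in> W4 \<union> (W1 \<union> W2)" for z
      using that unfolding o_apply by (elim UnE) (rule rO rS1, erule fstW)+
    show "(r2 \<circ> fst) z = b" if "z \<in> W3 \<union> (W1 \<union> W2)" for z
      using that unfolding o_apply by (elim UnE) (rule rO rS1, erule fstW)+
    show "inj_on (hmap 1 W1 S1 (r1 \<circ> fst)) (carrier (hgroup 1 W1))"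
      by (rule inj_on_hmap_comp[OF fst_inj inj(1) c_fst(1) im_fst(1) continuous_on_id2 im_id(1)])
        (unfold o_apply id_apply, rule rS1, erule fstW)
    show "inj_on (hmap 1 W2 S1 (r1 \<circ> snd)) (carrier (hgroup 1 W2))"
      by (rule inj_on_hmap_comp[OF snd_convex_factor_inj[OF O'_convex] inj(1) c_fst(2) im_fst(2) continuous_on_id2 im_id(1)])
        (unfold o_apply id_apply, rule rS1, erule fstW)
    show "inj_on (hmap 1 W3 S2 (r2 \<circ> snd)) (carrier (hgroup 1 W3))"
      by (rule inj_on_hmap_comp[OF snd_convex_factor_inj[OF O'_convex] inj(2) c_fst(2) im_fst(2) continuous_on_id2 im_id(2)])
        (unfold o_apply id_apply, rule rS2, erule fstW)
    show "inj_on (hmap 1 W4 S2 (r2 \<circ> fst)) (carrier (hgroup 1 W4))"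
      by (rule inj_on_hmap_comp[OF fst_inj inj(2) c_fst(1) im_fst(1) continuous_on_id2 im_id(2)])
        (unfold o_apply id_apply, rule rS2, erule fstW)
  qed
  then show "c \<in> {\<one>\<^bsub>hgroup 1 (P \<inter> Q)\<^esub>}" by (simp only: singleton_iff)
qed

text \<open>If \<open>S2\<close> is a point and \<open>S1 - {a}\<close> is connected, the two components of \<open>P \<inter> Q\<close> go to different components
  of \<open>Q\<close>.\<close>

lemma common_ker_0:
  assumes S: "S2 = {b}" "path_connected (S1 - {a})" "S1 - {a} \<noteq> {}"
  shows "common_ker 0 P Q \<subseteq> {\<one>\<^bsub>hgroup 0 (P \<inter> Q)\<^esub>}"
proof -
  obtain z1 where z1: "z1 \<in> W1" using S(3) O'_convex by fastforce
  obtain z2 where z2: "z2 \<in> W2" using S(3) O'_convex by fastforce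
  have PQ: "P \<inter> Q = W1 \<union> W2" unfolding PQ_eq using S(1) by auto
  define g where "g z = (if z \<in> A then z1 else z2)" for z
  have W: "W1 \<subseteq> A" "W2 \<subseteq> B" using V1A V1B by blast+
  have cg: "continuous_on Q g"
  proof (rule continuous_on_Un_local_open[OF open_Q])
    show "continuous_on A g" by (rule continuous_on_eq[OF continuous_on_const[of _ z1]]) (simp add: g_def)
    show "continuous_on B g"
      by (rule continuous_on_eq[OF continuous_on_const[of _ z2]]) (use AB in \<open>auto simp: g_def\<close>)
  qed
  have pc: "path_connected W1" "path_connected W2"
    using S(2) convex_imp_path_connected[OF O'_convex(1)] by (auto intro: path_connected_Times)
  have inj: "inj_on (hmap 0 (P \<inter> Q) Q id) (carrier (hgroup 0 (P \<inter> Q)))"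
  proof (rule hmap_0_inj[OF _ _ cg])
    show "g ` Q \<subseteq> P \<inter> Q" unfolding PQ using z1 z2 by (auto simp: g_def)
    show "path_component (P \<inter> Q) (g (id x)) x" if x: "x \<in> P \<inter> Q" for x
    proof (cases "x \<in> W1")
      case True
      then have "path_component W1 (g (id x)) x"
        using W z1 pc(1) by (auto simp: g_def path_connected_component)
      then show ?thesis unfolding PQ by (rule path_component_of_subset[rotated]) auto
    next
      case False
      then have "x \<in> W2" using x PQ by blast
      then have "path_component W2 (g (id x)) x"
        using W AB z2 pc(2) by (auto simp: g_def path_connected_component)
      then show ?thesis unfolding PQ by (rule path_component_of_subset[rotated]) auto
    qed
  qed auto
  show ?thesis
  proof
    fix c assume "c \<in> common_ker 0 P Q"
    then have "c \<in> carrier (hgroup 0 (P \<inter> Q))" "hmap 0 (P \<inter> Q) Q id c = hmap 0 (P \<inter> Q) Q id \<one>\<^bsub>hgroup 0 (P \<inter> Q)\<^esub>"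
      by (simp_all add: common_ker_def hmap_one)
    then show "c \<in> {\<one>\<^bsub>hgroup 0 (P \<inter> Q)\<^esub>}" using inj_onD[OF inj] by simp
  qed
qed

context
  assumes fin: "\<And>p. hfin p (conf S1)" "\<And>p. hfin p (conf S2)" "\<And>p. hfin p (S1 \<times> S2)"
      "\<And>p. hfin p (S1 - {a})" "\<And>p. hfin p (S2 - {b})"
    and inj: "inj_on (hmap 1 (S1 - {a}) S1 id) (carrier (hgroup 1 (S1 - {a})))"
      "inj_on (hmap 1 (S2 - {b}) S2 id) (carrier (hgroup 1 (S2 - {b})))"
    and triv: "htriv 2 (S1 - {a})" "htriv 2 (S2 - {b})"
begin

text \<open>In every degree the four parts of \<open>P \<inter> Q\<close>, the two of \<open>P\<close> and the two of \<open>Q\<close> are counted; the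
kernel terms measure the failure of additivity.\<close>

lemma conf_mv:
  "bnum p (conf Y) + 2 * bnum p (S1 - {a}) + 2 * bnum p (S2 - {b})
     = bnum p (conf S1) + bnum p (conf S2) + 2 * bnum p (S1 \<times> S2)
       + rank_on (hgroup p (P \<inter> Q)) (common_ker p P Q) + rank_on (hgroup (p-1) (P \<inter> Q)) (common_ker (p-1) P Q)"
proof -
  have "bnum p (conf Y) + bnum p (P \<inter> Q) = bnum p P + bnum p Q
       + rank_on (hgroup p (P \<inter> Q)) (common_ker p P Q) + rank_on (hgroup (p-1) (P \<inter> Q)) (common_ker (p-1) P Q)"
    using mayer_vietoris(2)[OF open_PQ P_homology(1)[OF fin(1,2)] Q_homology(1)[OF fin(3)]
      W_homology(1)[OF fin(4,5)] W_homology(1)[OF fin(4,5)], of p] unfolding conf_cover .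
  then show ?thesis
    using P_homology(2)[OF fin(1,2), of p] Q_homology(2)[OF fin(3), of p] W_homology(2)[OF fin(4,5), of p]
    by linarith
qed

theorem betti_2_bridge:
  "bnum 2 (conf Y) = bnum 2 (conf S1) + bnum 2 (conf S2) + 2 * bnum 2 (S1 \<times> S2)"
proof -
  have "rank_on (hgroup (2-1) (P \<inter> Q)) (common_ker (2-1) P Q) = 0"
    using common_ker_rank(2)[OF common_ker_1[OF inj]] by simp
  then show ?thesis
    using conf_mv[of 2] common_ker_rank(3)[OF W_htriv[OF triv]]
      trivial_imp_rank(2)[OF triv(1)] trivial_imp_rank(2)[OF triv(2)] by linarith
qed

text \<open>Subtracting the count in degree zero from the one in degree one removes the kernel term of degree zero, and the kernel
terms of degree one and minus one vanish.\<close>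

lemma betti_1_0_bridge:
  "int (bnum 1 (conf Y)) - int (bnum 0 (conf Y))
     = int (bnum 1 (conf S1)) - int (bnum 0 (conf S1)) + (int (bnum 1 (conf S2)) - int (bnum 0 (conf S2)))
       + 2 * (int (bnum 1 (S1 \<times> S2)) - int (bnum 0 (S1 \<times> S2)))
       - 2 * (int (bnum 1 (S1 - {a})) - int (bnum 0 (S1 - {a})))
       - 2 * (int (bnum 1 (S2 - {b})) - int (bnum 0 (S2 - {b})))"
proof -
  have aux: "int y1 - int y0 = int s1 - int s0 + (int t1 - int t0) + 2 * (int p1 - int p0) - 2 * (int v1 - int v0) - 2 * (int w1 - int w0)"
    if "k1 = 0" "k = 0" "k0' = k0" "y1 + 2 * v1 + 2 * w1 = s1 + t1 + 2 * p1 + k1 + k0'"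
      "y0 + 2 * v0 + 2 * w0 = s0 + t0 + 2 * p0 + k0 + k" for y1 y0 s1 s0 t1 t0 p1 p0 v1 v0 w1 w0 k1 k0 k0' k :: nat
    using that(1-3) arg_cong[OF that(4), of int] arg_cong[OF that(5), of int]
    by (simp only: of_nat_add of_nat_mult of_nat_numeral of_nat_0) presburger
  have "rank_on (hgroup (0-1) (P \<inter> Q)) (common_ker (0-1) P Q) = 0"
    by (rule common_ker_rank(3)) (rule trivial_homology_group, simp)
  moreover have "rank_on (hgroup (1-1) (P \<inter> Q)) (common_ker (1-1) P Q)
      = rank_on (hgroup 0 (P \<inter> Q)) (common_ker 0 P Q)" by simp
  ultimately show ?thesis
    by (rule aux[OF common_ker_rank(2)[OF common_ker_1[OF inj]] _ _ conf_mv[of 1] conf_mv[of 0]])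
qed

text \<open>Here \<open>S1 - {a}\<close> is connected, so that both the intersection \<open>P \<inter> Q\<close> and \<open>Q\<close> have two
components.\<close>

lemma betti_0_bridge_leaf:
  assumes S: "S2 = {b}" "path_connected (S1 - {a})" "S1 - {a} \<noteq> {}" "path_connected S1"
  shows "bnum 0 (conf Y) = bnum 0 (conf S1)"
proof -
  have "rank_on (hgroup (0-1) (P \<inter> Q)) (common_ker (0-1) P Q) = 0"
    by (rule common_ker_rank(3)) (rule trivial_homology_group, simp)
  moreover have "bnum 0 (conf S2) = 0"
  proof -
    have e: "conf {b} = {}" by auto
    show ?thesis unfolding S(1) e by simp
  qed
  moreover have "bnum 0 (S2 - {b}) = 0" unfolding S(1) by simp
  moreover have "bnum 0 (S1 - {a}) = 1" using homology_path_connected(2)[OF S(2,3)] .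
  moreover have "bnum 0 (S1 \<times> S2) = 1"
    using S(1,4) ends by (intro homology_path_connected(2) path_connected_Times) auto
  ultimately show ?thesis
    using conf_mv[of 0] common_ker_rank(2)[OF common_ker_0[OF S(1-3)]] by linarith
qed

text \<open>Since \<open>S2\<close> is a point, \<open>Q\<close> is equivalent to two copies of the graph \<open>S1\<close> and, like \<open>P \<inter> Q\<close>, has no
homology in degree two; \<open>P\<close> reduces to the configuration space of \<open>S1\<close>.\<close>

theorem homology_2_bridge_point:
  assumes "S2 = {b}" "htriv 2 (S1 \<times> S2)" "htriv 2 (S2 \<times> S1)"
  shows "hgroup 2 (conf S1) \<cong> hgroup 2 (conf Y)"
proof -
  have "hgroup 2 P \<cong> hgroup 2 (P \<union> Q)"
    by (rule homology_iso_union[OF open_PQ W_htriv[OF triv] Q_htriv[OF assms(2,3)]])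
      (use common_ker_1[OF inj] in simp)
  moreover have "V2 = {}"
  proof -
    have "r2 x = b" for x using r_range(2)[of x] assms(1) by simp
    then show ?thesis unfolding V2_def by simp
  qed
  moreover have "hgroup 2 (conf S1) \<cong> hgroup 2 V1"
    using homotopy_equivalent_space_imp_isomorphic_homology_groups[OF V1_equiv]
    by (rule group.iso_sym[OF group_relative_homology_group])
  ultimately show ?thesis
    unfolding conf_cover by (auto intro: iso_trans)
qed

end

end

section \<open>Path-connectedness of two-point configurations\<close>

lemma path_connected_segment_minus_end:
  fixes v w :: "'a::euclidean_space"
  assumes "v \<noteq> w"
  shows "path_connected (closed_segment v w - {v})"
proof -
  let ?f = "\<lambda>t::real. v + t *\<^sub>R (w - v)"
  have "closed_segment v w - {v} = ?f ` {0<..1}"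
  proof (rule equalityI; rule subsetI)
    fix x assume x: "x \<in> closed_segment v w - {v}"
    then obtain t where t: "0 \<le> t" "t \<le> 1" "x = (1 - t) *\<^sub>R v + t *\<^sub>R w" by (auto simp: closed_segment_def)
    then have "t \<noteq> 0" using x by auto
    then show "x \<in> ?f ` {0<..1}" using t by (intro image_eqI[of _ _ t]) (auto simp: algebra_simps)
  next
    fix x assume "x \<in> ?f ` {0<..1}"
    then obtain t where t: "0 < t" "t \<le> 1" "x = ?f t" by auto
    have "x \<in> closed_segment v w"
      unfolding closed_segment_def using t by (auto intro!: exI[of _ t] simp: algebra_simps)
    moreover have "x \<noteq> v" using t assms by simp
    ultimately show "x \<in> closed_segment v w - {v}" by simp
  qed
  moreover have "path_connected (?f ` {0<..1})"
    by (intro path_connected_continuous_image convex_imp_path_connected continuous_intros) simp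
  ultimately show ?thesis by simp
qed

text \<open>The two points can be moved from one position to the other without a collision.\<close>

definition joined :: "'a::euclidean_space set \<Rightarrow> 'a \<times> 'a \<Rightarrow> 'a \<times> 'a \<Rightarrow> bool" where
  "joined S p q \<longleftrightarrow> path_component (conf S) p q"

lemma joined_sym: "joined S p q \<Longrightarrow> joined S q p"
  unfolding joined_def by (rule path_component_sym)

lemma joined_trans: "joined S p q \<Longrightarrow> joined S q r \<Longrightarrow> joined S p r"
  unfolding joined_def by (rule path_component_trans)

lemma joined_refl: "x \<in> S \<Longrightarrow> y \<in> S \<Longrightarrow> x \<noteq> y \<Longrightarrow> joined S (x, y) (x, y)"
  unfolding joined_def by (rule path_component_refl) simp

lemma path_connected_conf_joined:
  "path_connected (conf S) \<longleftrightarrow> (\<forall>p\<in>conf S. \<forall>q\<in>conf S. joined S p q)"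
  unfolding joined_def path_connected_component ..

lemma joined_path:
  assumes "continuous_on {0..1::real} f" "continuous_on {0..1} g"
    and "\<And>t. t \<in> {0..1} \<Longrightarrow> f t \<in> S \<and> g t \<in> S \<and> f t \<noteq> g t"
  shows "joined S (f 0, g 0) (f 1, g 1)"
  unfolding joined_def path_component_def
proof (rule exI[of _ "\<lambda>t. (f t, g t)"], intro conjI)
  show "path (\<lambda>t. (f t, g t))" unfolding path_def using assms(1,2) by (rule continuous_on_Pair)
  show "path_image (\<lambda>t. (f t, g t)) \<subseteq> conf S"
    unfolding path_image_def by (rule image_subsetI) (use assms(3) in simp)
qed (simp_all add: pathstart_def pathfinish_def)

lemma joined_swap:
  assumes "joined S (x, y) (x', y')"
  shows "joined S (y, x) (y', x')"
proof -
  obtain p where p: "path p" "path_image p \<subseteq> conf S" "pathstart p = (x, y)" "pathfinish p = (x', y')"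
    using assms unfolding joined_def path_component_def by (elim exE conjE) (rule that)
  have "joined S ((snd \<circ> p) 0, (fst \<circ> p) 0) ((snd \<circ> p) 1, (fst \<circ> p) 1)"
  proof (rule joined_path)
    show "continuous_on {0..1} (snd \<circ> p)" "continuous_on {0..1} (fst \<circ> p)"
      using p(1) unfolding path_def o_def by (auto intro: continuous_on_fst continuous_on_snd)
    show "(snd \<circ> p) t \<in> S \<and> (fst \<circ> p) t \<in> S \<and> (snd \<circ> p) t \<noteq> (fst \<circ> p) t" if "t \<in> {0..1}" for t
    proof -
      have "p t \<in> conf S" by (rule subsetD[OF p(2)]) (use that in \<open>simp add: path_image_def\<close>)
      then show ?thesis unfolding conf_iff o_apply by (simp only: not_sym simp_thms)
    qed
  qed
  then show ?thesis using p(3,4) by (simp add: pathstart_def pathfinish_def)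
qed

lemma joined_move:
  assumes "path_component (S - {y}) x x'" "y \<in> S"
  shows "joined S (x, y) (x', y)" "joined S (y, x) (y, x')"
proof -
  obtain p where p: "path p" "path_image p \<subseteq> S - {y}" "pathstart p = x" "pathfinish p = x'"
    using assms(1) unfolding path_component_def by blast
  have "joined S (p 0, y) (p 1, y)"
  proof (rule joined_path)
    show "continuous_on {0..1} p" using p(1) by (simp add: path_def)
    show "p t \<in> S \<and> y \<in> S \<and> p t \<noteq> y" if "t \<in> {0..1}" for t
      using p(2) that assms(2) unfolding path_image_def by blast
  qed simp
  then show "joined S (x, y) (x', y)" using p(3,4) by (simp add: pathstart_def pathfinish_def)
  then show "joined S (y, x) (y, x')" by (rule joined_swap)
qed

lemma joined_mono:
  assumes "joined S p q" "S \<subseteq> T"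
  shows "joined T p q"
  using path_component_of_subset[OF _ assms(1)[unfolded joined_def], of "conf T"] assms(2)
  unfolding joined_def by (simp add: subset_iff)

text \<open>A point \<open>v\<close> at which the two points can be interchanged through every position of the other point makes the
  whole configuration space path-connected: a point \<open>y\<close> travels to \<open>v\<close> along an arc, unless \<open>x\<close> is in the way, and
  then \<open>x\<close> travels to \<open>v\<close> along the rest of this arc.\<close>

lemma path_connected_conf:
  assumes S: "path_connected S" "v \<in> S"
    and z: "\<And>x. x \<in> S - {v} \<Longrightarrow> joined S (x, v) z \<and> joined S (v, x) z"
  shows "path_connected (conf S)"
proof -
  have "joined S q z" if q: "q \<in> conf S" for q
  proof -
    obtain x y where xy: "q = (x, y)" "x \<in> S" "y \<in> S" "x \<noteq> y" using q by auto
    show ?thesis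
    proof (cases "x = v \<or> y = v")
      case True
      then show ?thesis using z[of x] z[of y] xy by auto
    next
      case False
      obtain g where g: "arc g" "path_image g \<subseteq> S" "pathstart g = y" "pathfinish g = v"
        using S xy(3) False by (metis path_connected_arcwise)
      show ?thesis
      proof (cases "x \<in> path_image g")
        case no: False
        then have "path_component (S - {x}) y v"
          unfolding path_component_def using g arc_imp_path by (intro exI[of _ g]) auto
        then have "joined S (x, y) (x, v)" by (rule joined_move(2)) (rule xy(2))
        moreover have "joined S (x, v) z" using z[of x] xy(2) False by blast
        ultimately show ?thesis unfolding xy(1) by (rule joined_trans)
      next
        case True
        then obtain t where t: "t \<in> {0..1}" "x = g t" by (auto simp: path_image_def)
        have t0: "t \<noteq> 0" using t(2) g(3) xy(4) by (auto simp: pathstart_def)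
        let ?h = "subpath t 1 g"
        have "path ?h" using t(1) arc_imp_path[OF g(1)] by (intro path_subpath) auto
        moreover have "path_image ?h \<subseteq> S - {y}"
        proof -
          have im: "path_image ?h = g ` {t..1}" using t(1) by (simp add: path_image_subpath)
          have "g s \<noteq> y" if "s \<in> {t..1}" for s
          proof
            assume "g s = y"
            then have "g s = g 0" using g(3) by (simp add: pathstart_def)
            then have "s = 0" using g(1) that t(1) unfolding arc_def by (auto dest!: inj_onD)
            then show False using that t0 t(1) by auto
          qed
          moreover have "g ` {t..1} \<subseteq> S" using g(2) t(1) unfolding path_image_def by auto
          ultimately show ?thesis unfolding im by (intro image_subsetI) auto
        qed
        moreover have "pathstart ?h = x" "pathfinish ?h = v"
          using t(2) g(4) by (simp_all add: pathfinish_def pathstart_def subpath_def)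
        ultimately have "path_component (S - {y}) x v"
          unfolding path_component_def by (intro exI[of _ ?h] conjI)
        then have "joined S (x, y) (v, y)" by (rule joined_move(1)) (rule xy(3))
        moreover have "joined S (v, y) z" using z[of y] xy(3) False by blast
        ultimately show ?thesis unfolding xy(1) by (rule joined_trans)
      qed
    qed
  qed
  then show ?thesis
    unfolding path_connected_conf_joined by (intro ballI) (rule joined_trans[OF _ joined_sym])
qed

context
  fixes V :: "'a::euclidean_space set" and E v
  assumes G: "lgraph V E" and v: "v \<in> V" and pc: "path_connected (gspace V E)"
begin

abbreviation "G \<equiv> gspace V E"

lemma ray_convex:
  assumes "e \<in> edges_at E v"
  shows "convex (e - V) \<and> e - V \<noteq> {} \<and> e - V \<subseteq> G - {v}"
proof -
  have "e - V \<in> rays V E v" unfolding rays_def[OF G v] using assms by (rule imageI)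
  from rays_props(4)[OF G v this] show ?thesis using v by blast
qed

lemma ray_joined:
  assumes "e \<in> edges_at E v" "p \<in> e - V" "q \<in> e - V"
  shows "path_component (G - {v}) p q"
proof -
  have "path_component (e - V) p q"
    using ray_convex[OF assms(1)] assms(2,3) convex_imp_path_connected path_connected_component by metis
  then show ?thesis
    by (rule path_component_of_subset[rotated]) (use ray_convex[OF assms(1)] in simp)
qed

text \<open>A path component of \<open>G - {v}\<close> that meets no edge at \<open>v\<close> would be open and closed in \<open>G\<close>.\<close>

lemma reach_ray:
  assumes x: "x \<in> G - {v}"
  obtains e p where "e \<in> edges_at E v" "p \<in> e - V" "path_component (G - {v}) x p"
proof (rule ccontr)
  assume contr: "\<not> thesis"
  let ?C = "path_component_set (G - {v}) x"
  have CG: "?C \<subseteq> G - {v}" by (rule path_component_subset)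
  have no: "?C \<inter> \<Union>(rays V E v) = {}"
    using contr that by (auto simp: rays_def[OF G v])
  have l: "locally path_connected G" by (rule convex_pieces_locally[OF convex_pieces_gspace[OF G]])
  have o: "openin (top_of_set G) (G - {v})" by (rule openin_minus_closed) simp
  then have lc: "locally path_connected (G - {v})" using l by (rule locally_open_subset[rotated])
  have oC: "openin (top_of_set G) ?C"
    by (rule openin_trans[OF openin_path_component_locally_path_connected[OF lc] o])
  have "openin (top_of_set (G - {v})) (G - {v} - ?C)"
    using closedin_path_component_locally_path_connected[OF lc, of x] by (simp add: closedin_def)
  then have "openin (top_of_set G) (G - {v} - ?C)" by (rule openin_trans) (rule o)
  then have "openin (top_of_set G) ((G - {v} - ?C) \<union> star V E v)"
    by (rule openin_Un) (rule star_props(3)[OF G v])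
  moreover have "(G - {v} - ?C) \<union> star V E v = G - ?C"
    using no CG star_props(2,4)[OF G v] unfolding star_def[OF G v] by blast
  ultimately have "openin (top_of_set G) (G - ?C)" by simp
  moreover have "connected G" using pc by (rule path_connected_imp_connected)
  moreover have "G \<subseteq> ?C \<union> (G - ?C)" "?C \<inter> (G - ?C) = {}" by blast+
  ultimately have "?C = {} \<or> G - ?C = {}" using oC unfolding connected_openin by meson
  moreover have "x \<in> ?C" using x by (simp add: path_component_refl_eq)
  moreover have "v \<in> G - ?C" using v CG by blast
  ultimately show False by blast
qed

text \<open>The first point approaches \<open>v\<close> along \<open>e\<close> while the second leaves it along \<open>f\<close>: at no time are they at the same
place.\<close>

lemma slide_through:
  assumes ef: "e \<in> edges_at E v" "f \<in> edges_at E v" "e \<noteq> f" and p: "p \<in> e - V" and q: "q \<in> f - V"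
  shows "joined G (p, v) (v, q)"
proof -
  obtain w where w: "e = closed_segment v w" "e - V = open_segment v w"
    using ef(1) by (auto simp: edges_at_def elim: open_edge_eq[OF G v])
  obtain u where u: "f = closed_segment v u" "f - V = open_segment v u"
    using ef(2) by (auto simp: edges_at_def elim: open_edge_eq[OF G v])
  have disj: "(e - V) \<inter> (f - V) = {}" using lgraphD(4)[OF G, of e f] ef by (auto simp: edges_at_def)
  have E: "e \<subseteq> G" "f \<subseteq> G" using ef by (auto simp: edges_at_def)
  define F where "F t = (1 - t) *\<^sub>R p + t *\<^sub>R v" for t :: real
  define H where "H t = (1 - t) *\<^sub>R v + t *\<^sub>R q" for t :: real
  have Fe: "F t \<in> insert v (e - V)" "t < 1 \<Longrightarrow> F t \<in> e - V" if "t \<in> {0..1}" for t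
  proof -
    show *: "F t \<in> e - V" if "t < 1"
    proof (cases "t = 0")
      case False
      then have "F t \<in> open_segment p v"
        using \<open>t \<in> {0..1}\<close> that p v unfolding F_def in_segment by (intro conjI exI[of _ t]) auto
      moreover have "open_segment p v \<subseteq> open_segment v w"
        using p unfolding w(2) subset_open_segment by (intro disjI2 conjI) (simp_all add: open_segment_def)
      ultimately show ?thesis using w(2) by blast
    qed (use p in \<open>simp add: F_def\<close>)
    show "F t \<in> insert v (e - V)"
    proof (cases "t < 1")
      case False
      then have "t = 1" using that by simp
      then show ?thesis by (simp add: F_def)
    qed (rule insertI2, rule *)
  qed
  have Hf: "H t \<in> insert v (f - V)" "0 < t \<Longrightarrow> H t \<in> f - V" if "t \<in> {0..1}" for t
  proof -
    show *: "H t \<in> f - V" if "0 < t"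
    proof (cases "t = 1")
      case False
      then have "H t \<in> open_segment v q"
        using \<open>t \<in> {0..1}\<close> that q v unfolding H_def in_segment by (intro conjI exI[of _ t]) auto
      moreover have "open_segment v q \<subseteq> open_segment v u"
        using q unfolding u(2) subset_open_segment by (intro disjI2 conjI) (simp_all add: open_segment_def)
      ultimately show ?thesis using u(2) by blast
    qed (use q in \<open>simp add: H_def\<close>)
    show "H t \<in> insert v (f - V)"
    proof (cases "0 < t")
      case False
      then have "t = 0" using that by simp
      then show ?thesis by (simp add: H_def)
    qed (rule insertI2, rule *)
  qed
  have "joined G (F 0, H 0) (F 1, H 1)"
  proof (rule joined_path)
    show "continuous_on {0..1} F" unfolding F_def by (intro continuous_intros)
    show "continuous_on {0..1} H" unfolding H_def by (intro continuous_intros)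
    show "F t \<in> G \<and> H t \<in> G \<and> F t \<noteq> H t" if t: "t \<in> {0..1}" for t
    proof (intro conjI)
      have "insert v (e - V) \<subseteq> G" "insert v (f - V) \<subseteq> G" using E v by blast+
      then show "F t \<in> G" "H t \<in> G" using Fe(1)[OF t] Hf(1)[OF t] by blast+
      show "F t \<noteq> H t"
      proof (cases "t < 1")
        case True
        then have "F t \<in> e - V" using Fe(2)[OF t] by blast
        moreover have "F t \<noteq> v" using calculation v by blast
        ultimately show ?thesis using Hf(1)[OF t] disj by (metis disjoint_iff insertE)
      next
        case False
        then have "F t = v" "H t = q" using t by (auto simp: F_def H_def)
        then show ?thesis using q v by auto
      qed
    qed
  qed
  then show ?thesis by (simp add: F_def H_def)
qed

definition "ray_pt e = (SOME p. p \<in> e - V)"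

lemma ray_pt:
  assumes "e \<in> edges_at E v"
  shows "ray_pt e \<in> e - V"
proof -
  have "e - V \<noteq> {}" using ray_convex[OF assms] by (elim conjE)
  then have "\<exists>p. p \<in> e - V" unfolding ex_in_conv .
  then show ?thesis unfolding ray_pt_def by (rule someI_ex)
qed

lemma ray_pt_G:
  assumes "e \<in> edges_at E v"
  shows "ray_pt e \<in> G - {v}"
proof -
  have "e - V \<subseteq> G - {v}" using ray_convex[OF assms] by (elim conjE)
  then show ?thesis using ray_pt[OF assms] by (rule subsetD)
qed

lemma swing:
  assumes "e \<in> edges_at E v" "f \<in> edges_at E v" "e \<noteq> f"
  shows "joined G (ray_pt e, v) (v, ray_pt f)"
  by (rule slide_through[OF assms ray_pt[OF assms(1)] ray_pt[OF assms(2)]])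

lemma reach_ray_pt:
  assumes "x \<in> G - {v}"
  obtains e where "e \<in> edges_at E v" "path_component (G - {v}) x (ray_pt e)"
proof -
  obtain e p where e: "e \<in> edges_at E v" "p \<in> e - V" "path_component (G - {v}) x p"
    by (rule reach_ray[OF assms])
  then have "path_component (G - {v}) p (ray_pt e)" using ray_joined ray_pt by blast
  then show ?thesis using e that path_component_trans by metis
qed

text \<open>Any position off \<open>v\<close> can be moved, in the complement of \<open>v\<close>, to one of the edges at \<open>v\<close>.\<close>

lemma path_connected_conf_rays:
  assumes "\<And>e. e \<in> edges_at E v \<Longrightarrow> joined G (ray_pt e, v) z \<and> joined G (v, ray_pt e) z"
  shows "path_connected (conf G)"
proof (rule path_connected_conf[OF pc])
  show vG: "v \<in> G" using v by simp
  fix x assume x: "x \<in> G - {v}"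
  obtain e where e: "e \<in> edges_at E v" "path_component (G - {v}) x (ray_pt e)"
    by (rule reach_ray_pt[OF x])
  show "joined G (x, v) z \<and> joined G (v, x) z"
    using joined_move[OF e(2) vG] assms[OF e(1)] by (blast intro: joined_trans)
qed

text \<open>Swinging from \<open>e\<close> through \<open>v\<close> to a third edge \<open>g\<close> and back to \<open>f\<close> moves one point from \<open>e\<close> to \<open>f\<close> while
the other returns to \<open>v\<close>.\<close>

lemma path_connected_conf_3:
  assumes "card (edges_at E v) \<ge> 3"
  shows "path_connected (conf G)"
proof -
  have other: "\<exists>g\<in>edges_at E v. g \<noteq> e \<and> g \<noteq> f" for e f
  proof (rule ccontr)
    assume "\<not> ?thesis"
    then have "edges_at E v \<subseteq> {e, f}" by blast
    then have "card (edges_at E v) \<le> card {e, f}" by (intro card_mono) auto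
    also have "\<dots> \<le> 2" by (simp add: card_insert_if)
    finally show False using assms by simp
  qed
  obtain e0 where e0: "e0 \<in> edges_at E v" using other by blast
  have L: "joined G (ray_pt e, v) (ray_pt f, v)" if ef: "e \<in> edges_at E v" "f \<in> edges_at E v" for e f
  proof -
    obtain g where g: "g \<in> edges_at E v" "g \<noteq> e" "g \<noteq> f" using other by blast
    have "joined G (ray_pt e, v) (v, ray_pt g)" by (rule swing[OF ef(1) g(1)]) (use g in auto)
    moreover have "joined G (v, ray_pt g) (ray_pt f, v)"
      by (rule joined_sym, rule swing[OF ef(2) g(1)]) (use g in auto)
    ultimately show ?thesis by (rule joined_trans)
  qed
  show ?thesis
  proof (rule path_connected_conf_rays[of "(ray_pt e0, v)"], intro conjI)
    fix e assume e: "e \<in> edges_at E v"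
    show "joined G (ray_pt e, v) (ray_pt e0, v)" by (rule L[OF e e0])
    obtain g where g: "g \<in> edges_at E v" "g \<noteq> e" using other by blast
    have "joined G (v, ray_pt e) (ray_pt g, v)"
      by (rule joined_sym, rule swing[OF g(1) e]) (use g in auto)
    then show "joined G (v, ray_pt e) (ray_pt e0, v)" using L[OF g(1) e0] by (rule joined_trans)
  qed
qed

lemma path_connected_minus_leaf:
  assumes "edges_at E v = {e}"
  shows "path_connected (G - {v})"
  unfolding path_connected_component
proof (intro ballI)
  have *: "path_component (G - {v}) x (ray_pt e)" if "x \<in> G - {v}" for x
    by (rule reach_ray_pt[OF that]) (use assms in simp)
  show "path_component (G - {v}) x y" if "x \<in> G - {v}" "y \<in> G - {v}" for x y
    by (rule path_component_trans[OF *[OF that(1)] path_component_sym[OF *[OF that(2)]]])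
qed

lemma no_edges_at:
  assumes "edges_at E v = {}"
  shows "G = {v}"
proof -
  have "x \<notin> G - {v}" for x
  proof
    assume "x \<in> G - {v}"
    then show False by (rule reach_ray_pt) (use assms in simp)
  qed
  moreover have "v \<in> G" using v by simp
  ultimately show ?thesis by blast
qed

end

text \<open>A union of edges and vertices of a graph, such as a component or the closure of a component of the complement of a
vertex, is a graph.\<close>

lemma lgraph_restrict:
  assumes G: "lgraph V E" and X: "X \<subseteq> gspace V E" "\<And>g. g \<in> E \<Longrightarrow> g \<inter> X \<subseteq> V \<or> g \<subseteq> X"
  shows "lgraph (V \<inter> X) {g \<in> E. g \<subseteq> X}" "gspace (V \<inter> X) {g \<in> E. g \<subseteq> X} = X"
proof -
  show "gspace (V \<inter> X) {g \<in> E. g \<subseteq> X} = X"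
  proof
    show "X \<subseteq> gspace (V \<inter> X) {g \<in> E. g \<subseteq> X}"
    proof
      fix x assume x: "x \<in> X"
      then consider "x \<in> V" | g where "g \<in> E" "x \<in> g" using X(1) by blast
      then show "x \<in> gspace (V \<inter> X) {g \<in> E. g \<subseteq> X}"
      proof cases
        case 2
        then show ?thesis using X(2)[of g] x by blast
      qed (use x in simp)
    qed
  qed blast
  have "\<exists>a\<in>V \<inter> X. \<exists>b\<in>V \<inter> X. a \<noteq> b \<and> g = closed_segment a b \<and> g \<inter> (V \<inter> X) = {a, b}" if g: "g \<in> E" "g \<subseteq> X" for g
  proof -
    obtain a b where ab: "a \<in> V" "b \<in> V" "a \<noteq> b" "g = closed_segment a b" "g \<inter> V = {a, b}"
      by (rule lgraph_edge[OF G g(1)])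
    have "a \<in> g" "b \<in> g" unfolding ab(4) by simp_all
    then have "a \<in> V \<inter> X" "b \<in> V \<inter> X" using ab(1,2) g(2) by blast+
    moreover have "g \<inter> (V \<inter> X) = {a, b}" using ab(5) g(2) by blast
    ultimately show ?thesis by (meson ab(3,4))
  qed
  moreover have "g \<inter> f \<subseteq> V \<inter> X" if "g \<in> E" "f \<in> E" "g \<noteq> f" "g \<subseteq> X" for g f
    by (rule Int_greatest[OF lgraphD(4)[OF G that(1-3)] le_infI1[OF that(4)]])
  moreover have "finite (V \<inter> X)" "finite {g \<in> E. g \<subseteq> X}" using lgraphD(1,2)[OF G] by simp_all
  ultimately show "lgraph (V \<inter> X) {g \<in> E. g \<subseteq> X}"
    unfolding lgraph_def by simp
qed

text \<open>At the far end of the edge at a leaf \<open>v\<close> the valence decides: with a further edge alone the leaf is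
  pruned, with several further edges the points are interchanged there.\<close>

lemma leaf_dichotomy:
  assumes "lgraph V E" "v \<in> V" "path_connected (gspace V E)" "edges_at E v = {e}"
  shows "(\<exists>g. arc g \<and> pathstart g = v \<and> path_image g = gspace V E) \<or>
         (\<forall>x\<in>gspace V E - {v}. joined (gspace V E) (v, x) (x, v))"
  using assms
proof (induction "card E" arbitrary: V E v e)
  case 0
  then show ?case using lgraphD(2)[OF 0(2)] by (auto simp: edges_at_def)
next
  case (Suc n)
  note G = Suc.prems(1) and v = Suc.prems(2) and pc = Suc.prems(3) and ev = Suc.prems(4)
  let ?G = "gspace V E"
  have e: "e \<in> E" "v \<in> e" using ev by (auto simp: edges_at_def)
  obtain w where w: "w \<in> V" "w \<noteq> v" "e = closed_segment v w" "e - V = open_segment v w" "e \<inter> V = {v, w}"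
    by (rule open_edge_eq[OF G v e])
  let ?V = "V - {v}" and ?E = "E - {e}"
  let ?G' = "gspace ?V ?E"
  have vno: "v \<notin> g" if "g \<in> ?E" for g using that ev by (auto simp: edges_at_def)
  have G'v: "v \<notin> ?G'" using vno by blast
  have G': "lgraph ?V ?E"
  proof -
    have "\<exists>a\<in>?V. \<exists>b\<in>?V. a \<noteq> b \<and> g = closed_segment a b \<and> g \<inter> ?V = {a, b}" if g: "g \<in> ?E" for g
    proof -
      have gE: "g \<in> E" using g by simp
      obtain a b where ab: "a \<in> V" "b \<in> V" "a \<noteq> b" "g = closed_segment a b" "g \<inter> V = {a, b}"
        by (rule lgraph_edge[OF G gE])
      then have "a \<noteq> v" "b \<noteq> v" using vno[OF g] by auto
      moreover have "g \<inter> ?V = {a, b}" using ab(5) vno[OF g] by blast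
      moreover have "a \<in> ?V" "b \<in> ?V" using ab(1,2) calculation(1,2) by simp_all
      ultimately show ?thesis
        by (meson ab(3,4))
    qed
    moreover have "g \<inter> f \<subseteq> ?V" if "g \<in> ?E" "f \<in> ?E" "g \<noteq> f" for g f
    proof -
      have "g \<inter> f \<subseteq> V" using that by (intro lgraphD(4)[OF G]) simp_all
      then show ?thesis using vno[OF that(1)] by blast
    qed
    moreover have "finite ?V" "finite ?E" using lgraphD(1,2)[OF G] by simp_all
    ultimately show ?thesis unfolding lgraph_def by simp
  qed
  have un: "?G = ?G' \<union> e" using e(1,2) by blast
  have int: "?G' \<inter> e = {w}"
  proof -
    have "g \<inter> e \<subseteq> {w}" if g: "g \<in> ?E" for g
    proof -
      have "g \<inter> e \<subseteq> V" using g e(1) by (intro lgraphD(4)[OF G]) simp_all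
      then have "g \<inter> e \<subseteq> {v, w}" using w(5) by blast
      then show ?thesis using vno[OF g] by blast
    qed
    then have "\<Union>?E \<inter> e \<subseteq> {w}" by blast
    moreover have "?V \<inter> e \<subseteq> {w}" using w(5) by blast
    moreover have "w \<in> ?V" "w \<in> e" using w(1,2,5) by blast+
    ultimately show ?thesis by blast
  qed
  have w': "w \<in> ?V" using w by simp
  have cl: "closed ?G'" by (intro compact_imp_closed convex_pieces_compact convex_pieces_gspace G')
  have pc': "path_connected ?G'"
  proof -
    have "continuous_on (?G' \<union> e) (\<lambda>x. if x \<in> ?G' then x else w)"
    proof (rule continuous_on_closed_Un[OF cl])
      show "closed e" unfolding w(3) by simp
      show "continuous_on ?G' (\<lambda>x. if x \<in> ?G' then x else w)"
        by (rule continuous_on_eq[OF continuous_on_id]) simp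
      show "continuous_on e (\<lambda>x. if x \<in> ?G' then x else w)"
      proof (rule continuous_on_eq[OF continuous_on_const[of _ w]])
        fix x assume "x \<in> e"
        then have "x \<in> ?G' \<Longrightarrow> x = w" using int by blast
        then show "w = (if x \<in> ?G' then x else w)" by (cases "x \<in> ?G'") (simp_all only: if_True if_False)
      qed
    qed
    then have "path_connected ((\<lambda>x. if x \<in> ?G' then x else w) ` ?G)"
      unfolding un using pc[unfolded un] by (rule path_connected_continuous_image)
    moreover have "(\<lambda>x. if x \<in> ?G' then x else w) ` ?G = ?G'"
    proof (rule equalityI; rule subsetI)
      fix y assume "y \<in> (\<lambda>x. if x \<in> ?G' then x else w) ` ?G"
      then obtain x where "y = (if x \<in> ?G' then x else w)" by (rule imageE)
      then show "y \<in> ?G'" using w' by (cases "x \<in> ?G'") simp_all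
    next
      fix y assume y: "y \<in> ?G'"
      then have "y \<in> ?G" unfolding un by (rule UnI1)
      then show "y \<in> (\<lambda>x. if x \<in> ?G' then x else w) ` ?G" by (rule rev_image_eqI) (simp only: y if_True)
    qed
    ultimately show ?thesis by (simp only:)
  qed
  let ?F = "edges_at ?E w"
  have finF: "finite ?F" using lgraphD(2)[OF G] by (auto simp: edges_at_def)
  have we: "w \<in> e" unfolding w(3) by simp
  have Fw: "edges_at E w = insert e ?F" "e \<notin> ?F" using e(1) we unfolding edges_at_def by blast+
  have arc_e: "arc (linepath v w)" "path_image (linepath v w) = e"
    unfolding path_image_linepath by (rule arc_linepath[OF w(2)[symmetric]], rule w(3)[symmetric])
  consider "?F = {}" | f where "?F = {f}" | "card ?F \<ge> 2"
  proof -
    have "card ?F = 0 \<or> card ?F = 1 \<or> card ?F \<ge> 2" by linarith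
    then show ?thesis using that finF by (metis card_0_eq card_1_singletonE)
  qed
  then show ?case
  proof cases
    case 1
    then have G'w: "?G' = {w}" by (rule no_edges_at[OF G' w' pc'])
    have "?G = {w} \<union> e" unfolding un G'w by (rule refl)
    then have "?G = e" using insert_absorb[OF we] by (simp only: Un_insert_left Un_empty_left)
    then have "path_image (linepath v w) = ?G" using arc_e(2) by (simp only:)
    then show ?thesis using arc_e(1) by (intro disjI1 exI[of _ "linepath v w"] conjI pathstart_linepath)
  next
    case (2 f)
    have "n = card ?E" using Suc.hyps(2) e(1) lgraphD(2)[OF G] by simp
    from Suc.hyps(1)[OF this G' w' pc' 2]
    show ?thesis
    proof (elim disjE exE conjE)
      fix g assume g: "arc g" "pathstart g = w" "path_image g = ?G'"
      have "arc (linepath v w +++ g)"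
      proof (rule arc_join[OF arc_e(1) g(1)])
        show "pathfinish (linepath v w) = pathstart g" unfolding g(2) by simp
        show "path_image (linepath v w) \<inter> path_image g \<subseteq> {pathstart g}"
          unfolding arc_e(2) g(2,3) Int_commute[of e] int by (rule subset_refl)
      qed
      moreover have "path_image (linepath v w +++ g) = path_image (linepath v w) \<union> path_image g"
        by (rule path_image_join) (simp add: g(2))
      then have "path_image (linepath v w +++ g) = ?G"
        unfolding arc_e(2) g(3) un by (rule trans[OF _ Un_commute])
      moreover have "pathstart (linepath v w +++ g) = v" by simp
      ultimately show ?thesis by (intro disjI1 exI[of _ "linepath v w +++ g"] conjI)
    next
      assume ex: "\<forall>x\<in>?G' - {w}. joined ?G' (w, x) (x, w)"
      have "f \<in> ?F" unfolding 2 by simp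
      then obtain x where x: "x \<in> ?G' - {w}" using ray_pt_G[OF G' w' pc'] by metis
      have xe: "x \<notin> e"
      proof
        assume "x \<in> e"
        with DiffD1[OF x] have "x \<in> ?G' \<inter> e" by (rule IntI)
        then have "x \<in> {w}" unfolding int .
        then show False by (rule DiffD2[OF x])
      qed
      have vG: "v \<in> ?G" using v by simp
      have xG: "x \<in> ?G" unfolding un by (rule UnI1[OF DiffD1[OF x]])
      have "path_component (?G - {x}) v w"
        unfolding path_component_def
      proof (rule exI[of _ "linepath v w"], intro conjI)
        have "e \<subseteq> ?G - {x}" unfolding subset_Diff_insert Diff_empty un using xe by (intro conjI Un_upper2)
        then show "path_image (linepath v w) \<subseteq> ?G - {x}" unfolding arc_e(2) .
      qed simp_all
      then have m: "joined ?G (v, x) (w, x)" "joined ?G (x, v) (x, w)" by (rule joined_move[OF _ xG])+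
      have "joined ?G (w, x) (x, w)"
        by (rule joined_mono[OF bspec[OF ex x]]) (unfold un, rule Un_upper1)
      then have vx: "joined ?G (v, x) (x, v)" using m by (metis joined_sym joined_trans)
      have pcv: "path_connected (?G - {v})" by (rule path_connected_minus_leaf[OF G v pc ev])
      have "joined ?G (v, y) (y, v)" if y: "y \<in> ?G - {v}" for y
      proof -
        have "x \<noteq> v"
        proof
          assume "x = v"
          then show False using DiffD1[OF x] G'v by (simp only: not_True_eq_False)
        qed
        then have "x \<in> ?G - {v}" using xG by simp
        then have "path_component (?G - {v}) x y"
          by (rule pcv[unfolded path_connected_component, rule_format, OF _ y])
        then have "joined ?G (x, v) (y, v)" "joined ?G (v, x) (v, y)" by (rule joined_move[OF _ vG])+
        then show ?thesis using vx by (metis joined_sym joined_trans)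
      qed
      then show ?thesis by (intro disjI2 ballI)
    qed
  next
    case 3
    then have "card (edges_at E w) \<ge> 3" unfolding Fw(1) using Fw(2) finF by simp
    then have pcj: "\<forall>p\<in>conf ?G. \<forall>q\<in>conf ?G. joined ?G p q"
      unfolding path_connected_conf_joined[symmetric] by (rule path_connected_conf_3[OF G w(1) pc])
    have "joined ?G (v, x) (x, v)" if x: "x \<in> ?G - {v}" for x
    proof (rule pcj[THEN bspec, THEN bspec])
      have xv: "x \<noteq> v" using x by simp
      have vG: "v \<in> ?G" using v by simp
      show "(v, x) \<in> conf ?G"
        unfolding conf_iff fst_conv snd_conv by (intro conjI vG DiffD1[OF x] xv[symmetric])
      show "(x, v) \<in> conf ?G"
        unfolding conf_iff fst_conv snd_conv by (intro conjI vG DiffD1[OF x] xv)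
    qed
    then show ?thesis by (intro disjI2 ballI)
  qed
qed

text \<open>Let \<open>p\<close> and \<open>q\<close> be points on the two edges at \<open>v\<close>. Swinging through \<open>v\<close> joins \<open>(p, v)\<close>
to \<open>(v, q)\<close> and \<open>(q, v)\<close> to \<open>(v, p)\<close>; one further connection between these two classes
suffices. It exists if \<open>p\<close> and \<open>q\<close> are joined in the complement of \<open>v\<close>. Otherwise \<open>v\<close> cuts the graph into two
halves with the leaf \<open>v\<close>. If one of them is not an arc, the two points can be interchanged inside it; if both are
arcs, so is the whole graph.\<close>

lemma path_connected_conf_2:
  assumes G: "lgraph V E" and v: "v \<in> V" and pc: "path_connected (gspace V E)"
    and two: "card (edges_at E v) = 2" and no_arc: "\<not> gspace V E homeomorphic {0..1::real}"
  shows "path_connected (conf (gspace V E))"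
proof -
  let ?G = "gspace V E"
  obtain e f where ef: "edges_at E v = {e, f}" "e \<noteq> f" using two by (auto simp: card_2_iff)
  have e: "e \<in> edges_at E v" and f: "f \<in> edges_at E v" using ef by auto
  let ?p = "ray_pt V e" and ?q = "ray_pt V f"
  note p = ray_pt_G[OF G v pc e] and q = ray_pt_G[OF G v pc f]
  have s1: "joined ?G (?p, v) (v, ?q)" by (rule swing[OF G v pc e f ef(2)])
  have s2: "joined ?G (?q, v) (v, ?p)" by (rule swing[OF G v pc f e ef(2)[symmetric]])
  have vG: "v \<in> ?G" using v by simp
  have "joined ?G (?p, v) (?q, v) \<or> joined ?G (?p, v) (v, ?p) \<or> joined ?G (?q, v) (v, ?q)"
  proof (cases "path_component (?G - {v}) ?p ?q")
    case True
    then have "joined ?G (?p, v) (?q, v)" by (rule joined_move(1)[OF _ vG])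
    then show ?thesis by (rule disjI1)
  next
    case sep: False
    define D where "D z = path_component_set (?G - {v}) z" for z
    have Dsub: "D z \<subseteq> ?G - {v}" for z unfolding D_def by (rule path_component_subset)
    have disj: "D ?p \<inter> D ?q = {}"
    proof (rule equals0I)
      fix x assume "x \<in> D ?p \<inter> D ?q"
      then have "path_component (?G - {v}) ?p x" "path_component (?G - {v}) ?q x" by (simp_all add: D_def)
      then show False using sep by (metis path_component_sym path_component_trans)
    qed
    have cover: "?G - {v} = D ?p \<union> D ?q"
    proof
      show "?G - {v} \<subseteq> D ?p \<union> D ?q"
      proof
        fix x assume x: "x \<in> ?G - {v}"
        show "x \<in> D ?p \<union> D ?q"
          by (rule reach_ray_pt[OF G v pc x]) (use ef(1) in \<open>auto simp: D_def intro: path_component_sym\<close>)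
      qed
    qed (use Dsub in blast)
    have half: "(\<exists>g. arc g \<and> pathstart g = v \<and> path_image g = insert v (D (ray_pt V k))) \<or>
        joined ?G (ray_pt V k, v) (v, ray_pt V k)" if k: "k \<in> edges_at E v" "k' \<in> edges_at E v" "k \<noteq> k'"
        "ray_pt V k' \<notin> D (ray_pt V k)" "edges_at E v = {k, k'}" for k k'
    proof -
      let ?r = "ray_pt V k"
      let ?X = "insert v (D ?r)"
      have r: "?r \<in> ?G - {v}" by (rule ray_pt_G[OF G v pc k(1)])
      have rD: "?r \<in> D ?r" unfolding D_def using r by (simp add: path_component_refl_eq)
      have X: "?X \<subseteq> ?G" using vG Dsub by blast
      have gX: "g \<inter> ?X \<subseteq> V \<or> g \<subseteq> ?X" if g: "g \<in> E" for g
      proof (cases "g \<inter> D ?r = {}")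
        case True
        then show ?thesis using v by blast
      next
        case False
        then obtain y where y: "y \<in> g" "y \<in> D ?r" by blast
        have "path_connected (g - {v})"
        proof (cases "v \<in> g")
          case True
          obtain w where w: "w \<noteq> v" "g = closed_segment v w" by (rule open_edge_eq[OF G v g True])
          show ?thesis unfolding w(2) using w(1) by (intro path_connected_segment_minus_end) simp
        next
          case no: False
          obtain c d where "g = closed_segment c d" by (rule lgraph_edge[OF G g])
          then have "path_connected g" by (simp add: convex_imp_path_connected)
          then show ?thesis using no by simp
        qed
        moreover have "g - {v} \<subseteq> ?G - {v}" using g by blast
        moreover have "y \<in> g - {v}" using y Dsub by blast
        ultimately have "g - {v} \<subseteq> path_component_set (?G - {v}) y" by (intro path_component_maximal)
        also have "\<dots> = D ?r" unfolding D_def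
          using path_component_eq[of y "?G - {v}" ?r] y(2) unfolding D_def by (simp only:)
        finally show ?thesis by blast
      qed
      have R: "lgraph (V \<inter> ?X) {g \<in> E. g \<subseteq> ?X}" "gspace (V \<inter> ?X) {g \<in> E. g \<subseteq> ?X} = ?X"
        by (rule lgraph_restrict[OF G X], erule gX)+
      have vX: "v \<in> V \<inter> ?X" using v by simp
      have kX: "k \<subseteq> ?X"
      proof -
        have "?r \<in> k" "?r \<notin> V" using ray_pt[OF G v pc k(1)] by blast+
        moreover have "?r \<in> ?X" using rD by (rule insertI2)
        moreover have "k \<in> E" using k(1) by (simp add: edges_at_def)
        ultimately show ?thesis using gX[of k] by blast
      qed
      have k'X: "\<not> k' \<subseteq> ?X"
      proof
        assume "k' \<subseteq> ?X"
        then have "ray_pt V k' \<in> ?X" using ray_pt[OF G v pc k(2)] by blast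
        then show False using k(4) ray_pt_G[OF G v pc k(2)] by blast
      qed
      have one: "edges_at {g \<in> E. g \<subseteq> ?X} v = {k}"
      proof -
        have "edges_at {g \<in> E. g \<subseteq> ?X} v = {g \<in> edges_at E v. g \<subseteq> ?X}" by (auto simp: edges_at_def)
        then show ?thesis unfolding k(5) using kX k'X by blast
      qed
      have "path_connected ?X"
      proof -
        have "k \<inter> D ?r \<noteq> {}" using ray_pt[OF G v pc k(1)] rD by blast
        moreover have "path_connected k"
        proof -
          have "k \<in> E" using k(1) by (simp add: edges_at_def)
          then obtain c d where "k = closed_segment c d" by (rule lgraph_edge[OF G])
          then show ?thesis by (simp add: convex_imp_path_connected)
        qed
        moreover have "path_connected (D ?r)" unfolding D_def by simp
        ultimately have "path_connected (k \<union> D ?r)" by (intro path_connected_Un)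
        moreover have "k \<union> D ?r = ?X" using kX k(1) unfolding edges_at_def by blast
        ultimately show ?thesis by simp
      qed
      then have "path_connected (gspace (V \<inter> ?X) {g \<in> E. g \<subseteq> ?X})" by (subst R(2))
      from leaf_dichotomy[OF R(1) vX this one]
      have "(\<exists>g. arc g \<and> pathstart g = v \<and> path_image g = ?X) \<or> (\<forall>x\<in>?X - {v}. joined ?X (v, x) (x, v))"
        unfolding R(2) .
      then show ?thesis
      proof
        assume *: "\<forall>x\<in>?X - {v}. joined ?X (v, x) (x, v)"
        have "?r \<in> ?X - {v}" using rD r by blast
        then have "joined ?X (v, ?r) (?r, v)" using * by blast
        then have "joined ?G (v, ?r) (?r, v)" using X by (rule joined_mono)
        then have "joined ?G (?r, v) (v, ?r)" by (rule joined_sym)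
        then show ?thesis by (rule disjI2)
      qed (rule disjI1)
    qed
    have qD: "?q \<notin> D ?p" using sep by (simp add: D_def)
    have pD: "?p \<notin> D ?q" unfolding D_def mem_Collect_eq using sep by (metis path_component_sym)
    have ef': "edges_at E v = {f, e}" unfolding ef(1) by (rule insert_commute)
    note h1 = half[OF e f ef(2) qD ef(1)] and h2 = half[OF f e ef(2)[symmetric] pD ef']
    from h1 show ?thesis
    proof (elim disjE exE conjE)
      fix g1 assume g1: "arc g1" "pathstart g1 = v" "path_image g1 = insert v (D ?p)"
      from h2 show ?thesis
      proof (elim disjE exE conjE)
        fix g2 assume g2: "arc g2" "pathstart g2 = v" "path_image g2 = insert v (D ?q)"
      have "arc (reversepath g1 +++ g2)"
      proof (rule arc_join)
        show "arc (reversepath g1)" using g1(1) by (rule arc_reversepath)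
        show "pathfinish (reversepath g1) = pathstart g2" using g1(2) g2(2) by simp
        show "path_image (reversepath g1) \<inter> path_image g2 \<subseteq> {pathstart g2}"
          unfolding path_image_reversepath g1(3) g2(2,3) using disj by blast
      qed (rule g2(1))
      moreover have "path_image (reversepath g1 +++ g2) = path_image (reversepath g1) \<union> path_image g2"
        by (rule path_image_join) (use g1(2) g2(2) in simp)
      then have "path_image (reversepath g1 +++ g2) = ?G"
        unfolding path_image_reversepath g1(3) g2(3) using insert_Diff[OF vG] unfolding cover
        by (simp only: Un_insert_left Un_insert_right insert_absorb2 insert_absorb[OF vG])
      ultimately have "?G homeomorphic {0..1::real}"
        using homeomorphic_arc_image_interval[of "reversepath g1 +++ g2" "0::real" 1] by (simp only: zero_less_one)
      then show ?thesis using no_arc by blast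
      qed (rule disjI2, rule disjI2)
    qed (rule disjI2, rule disjI1)
  qed
  then have "joined ?G (?p, v) (?q, v) \<and> joined ?G (v, ?p) (?q, v) \<and> joined ?G (v, ?q) (?q, v)"
    using s1 s2 by (metis joined_sym joined_trans)
  moreover have "joined ?G (?q, v) (?q, v)" using q by (intro joined_refl vG) simp_all
  ultimately have "joined ?G (ray_pt V k, v) (?q, v) \<and> joined ?G (v, ray_pt V k) (?q, v)" if "k \<in> {e, f}" for k
    using that by (elim insertE emptyE) simp_all
  then show ?thesis by (intro path_connected_conf_rays[OF G v pc, of "(?q, v)"]) (simp only: ef(1))
qed

section \<open>Attaching an edge\<close>

locale graph_bridge = bridge S1 S2 a b
  for S1 S2 :: "'a::euclidean_space set" and a b :: 'a +
  fixes N1 N2 :: "'a set" and E1 E2 :: "'a set set"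
  assumes graphs: "lgraph N1 E1" "lgraph N2 E2" and spaces: "S1 = gspace N1 E1" "S2 = gspace N2 E2"
    and nodes: "a \<in> N1" "b \<in> N2"
begin

lemma pieces: "convex_pieces S1" "convex_pieces S2"
  unfolding spaces by (rule convex_pieces_gspace[OF graphs(1)], rule convex_pieces_gspace[OF graphs(2)])

lemma finiteness: "hfin p (conf S1)" "hfin p (conf S2)" "hfin p (S1 \<times> S2)" "hfin p (S1 - {a})" "hfin p (S2 - {b})"
  using convex_pieces_hfin_conf pieces convex_pieces_hfin[OF convex_pieces_Times] convex_pieces_hfin_minus by blast+

lemma puncture_inj:
  "inj_on (hmap 1 (S1 - {a}) S1 id) (carrier (hgroup 1 (S1 - {a})))"
  "inj_on (hmap 1 (S2 - {b}) S2 id) (carrier (hgroup 1 (S2 - {b})))"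
  unfolding spaces
  by (rule minus_vertex_inj_general[OF graphs(1) nodes(1)], simp, rule minus_vertex_inj_general[OF graphs(2) nodes(2)], simp)

lemma puncture_htriv: "htriv 2 (S1 - {a})" "htriv 2 (S2 - {b})"
  unfolding spaces
  by (rule minus_vertex_htriv[OF graphs(1) nodes(1)], simp, rule minus_vertex_htriv[OF graphs(2) nodes(2)], simp)

lemmas betti_2 = betti_2_bridge[OF finiteness puncture_inj puncture_htriv]
lemmas betti_1_0 = betti_1_0_bridge[OF finiteness puncture_inj puncture_htriv]
lemmas betti_0_leaf = betti_0_bridge_leaf[OF finiteness puncture_inj puncture_htriv]
lemmas homology_2_point = homology_2_bridge_point[OF finiteness puncture_inj puncture_htriv]

theorem betti_2_graph_bridge:
  "bnum 2 (conf Y) = bnum 2 (conf S1) + bnum 2 (conf S2) + 2 * bnum 1 S1 * bnum 1 S2"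
proof -
  have "htriv 2 S1" unfolding spaces by (rule graph_htriv[OF graphs(1)]) simp
  then have "bnum 2 (S1 \<times> S2) = bnum 1 S1 * bnum 1 S2"
    unfolding spaces(2) by (rule betti_2_product[OF graphs(2) convex_pieces_hfin[OF pieces(1)]])
  then show ?thesis using betti_2 by (simp only: mult.assoc)
qed

end

lemma lgraph_point: "lgraph {w} {}"
  by (simp add: lgraph_def)

lemma lgraph_attach:
  assumes G: "lgraph V E" and v: "v \<in> V" and w: "w \<notin> gspace V E" and e: "closed_segment v w \<inter> gspace V E = {v}"
  shows "lgraph (insert w V) (insert (closed_segment v w) E)"
    "gspace (insert w V) (insert (closed_segment v w) E) = gspace V E \<union> closed_segment v w"
    "edges_at (insert (closed_segment v w) E) v = insert (closed_segment v w) (edges_at E v)"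
    "closed_segment v w \<notin> E"
proof -
  let ?e = "closed_segment v w"
  have we: "w \<in> ?e" and ve: "v \<in> ?e" by simp_all
  have vw: "v \<noteq> w" using v w by blast
  show "gspace (insert w V) (insert ?e E) = gspace V E \<union> ?e" using we by blast
  show "edges_at (insert ?e E) v = insert ?e (edges_at E v)" using ve unfolding edges_at_def by blast
  show "?e \<notin> E" using we w by blast
  have wE: "w \<notin> g" if "g \<in> E" for g using w that by blast
  have eV: "?e \<inter> V = {v}" using e v by blast
  have eg: "?e \<inter> g \<subseteq> V" if "g \<in> E" for g
  proof -
    have "?e \<inter> g \<subseteq> ?e \<inter> gspace V E" using that by blast
    then show ?thesis unfolding e using v by blast
  qed
  have edges: "\<exists>a\<in>insert w V. \<exists>b\<in>insert w V. a \<noteq> b \<and> g = closed_segment a b \<and> g \<inter> insert w V = {a, b}"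
    if "g \<in> insert ?e E" for g
  proof (cases "g = ?e")
    case True
    have i: "?e \<inter> insert w V = {v, w}" using eV we by blast
    have n: "v \<in> insert w V" "w \<in> insert w V" using v by simp_all
    show ?thesis
      unfolding True by (rule bexI[of _ v], rule bexI[of _ w], (intro conjI vw refl i n)+)
  next
    case False
    then have g: "g \<in> E" using that by simp
    obtain a b where ab: "a \<in> V" "b \<in> V" "a \<noteq> b" "g = closed_segment a b" "g \<inter> V = {a, b}"
      by (rule lgraph_edge[OF G g])
    have i: "g \<inter> insert w V = {a, b}" using ab(5) wE[OF g] by blast
    have n: "a \<in> insert w V" "b \<in> insert w V" using ab(1,2) by simp_all
    show ?thesis by (rule bexI[of _ a], rule bexI[of _ b], (intro conjI ab(3,4) i n)+)
  qed
  have meets: "g \<inter> f \<subseteq> insert w V" if gf: "g \<in> insert ?e E" "f \<in> insert ?e E" "g \<noteq> f" for g f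
  proof -
    consider "g = ?e" "f \<in> E" | "f = ?e" "g \<in> E" | "g \<in> E" "f \<in> E" using gf by blast
    then have "g \<inter> f \<subseteq> V"
    proof cases
      case 1
      then show ?thesis using eg by simp
    next
      case 2
      then show ?thesis using eg by (simp add: Int_commute)
    next
      case 3
      then show ?thesis using lgraphD(4)[OF G _ _ gf(3)] by blast
    qed
    then show ?thesis by (rule subset_insertI2)
  qed
  show "lgraph (insert w V) (insert ?e E)"
    unfolding lgraph_def
  proof (intro conjI)
    show "finite (insert w V)" "finite (insert ?e E)" using lgraphD(1,2)[OF G] by simp_all
    show "\<forall>e\<in>insert ?e E. \<exists>a\<in>insert w V. \<exists>b\<in>insert w V. a \<noteq> b \<and> e = closed_segment a b \<and> e \<inter> insert w V = {a, b}"
      using edges by (rule ballI)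
    show "\<forall>e\<in>insert ?e E. \<forall>f\<in>insert ?e E. e \<noteq> f \<longrightarrow> e \<inter> f \<subseteq> insert w V"
      using meets by (intro ballI impI)
  qed
qed

text \<open>The formula for \<open>b\<^sub>1 - b\<^sub>0\<close> gives the increment
\<open>2 (b\<^sub>1 (S) - 1 - b\<^sub>1 (S - {v}) + b\<^sub>0 (S - {v}))\<close>, which by \<open>minus_vertex_betti\<close> is twice the valence
of \<open>v\<close> minus two. It remains to compare the numbers of
components.\<close>

theorem attach_whisker:
  assumes G: "lgraph V E" and v: "v \<in> V" and S: "S = gspace V E" and pc: "path_connected S"
    and w: "w \<notin> S" and e: "closed_segment v w \<inter> S = {v}" and ne: "edges_at E v \<noteq> {}"
  shows "hgroup 2 (conf S) \<cong> hgroup 2 (conf (S \<union> closed_segment v w))"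
    and "\<not> (S homeomorphic {0..1::real} \<and> card (edges_at E v) = 2) \<Longrightarrow>
      int (bnum 1 (conf (S \<union> closed_segment v w))) - int (bnum 1 (conf S)) = 2 * int (card (edges_at E v)) - 2"
proof -
  let ?m = "card (edges_at E v)" and ?Y = "S \<union> closed_segment v w"
  have vS: "v \<in> S" unfolding S using v by simp
  have vw: "v \<noteq> w" using vS w by blast
  have we: "closed_segment v w \<inter> {w} = {w}" by simp
  have cS: "compact S" unfolding S by (intro convex_pieces_compact convex_pieces_gspace G)
  have wsp: "{w} = gspace {w} {}" by simp
  have ww: "w \<in> {w}" by simp
  have Sw: "S \<inter> {w} = {}" using w by simp
  interpret B: graph_bridge S "{w}" v w V "{w}" E "{}"
    by (intro graph_bridge.intro bridge.intro graph_bridge_axioms.intro cS compact_sing vS ww Sw e we G lgraph_point S wsp v)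
  have "w \<in> closed_segment v w" by simp
  then have BY: "B.Y = ?Y" unfolding B.Y_def by blast
  have ht: "htriv 2 S" unfolding S by (rule graph_htriv[OF G]) simp
  have hf: "hfin p S" for p by (rule convex_pieces_hfin[OF B.pieces(1)])
  have Sx: "htriv 2 (S \<times> {w})" "htriv 2 ({w} \<times> S)" "bnum p (S \<times> {w}) = bnum p S" for p
    using product_with_points(3)[of "{w}" S 2, OF _ hf ht] product_with_points(2)[of "{w}" S p, OF _ hf]
      swap_homology(3)[of 2 "S \<times> {w}"] by (simp_all add: swap_Times)
  show "hgroup 2 (conf S) \<cong> hgroup 2 (conf ?Y)"
    using B.homology_2_point[OF refl Sx(1,2)] unfolding BY .
  assume arc: "\<not> (S homeomorphic {0..1::real} \<and> ?m = 2)"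
  have fin: "finite (edges_at E v)" using lgraphD(2)[OF G] by (simp add: edges_at_def)
  then have m: "?m \<ge> 1" using ne by (simp add: Suc_leI card_gt_0_iff)
  obtain k where k: "k \<in> edges_at E v" using ne by blast
  have pcG: "path_connected (gspace V E)" using pc unfolding S .
  have r: "ray_pt V k \<in> S - {v}" unfolding S by (rule ray_pt_G[OF G v pcG k])
  have b0: "bnum 0 (conf ?Y) = bnum 0 (conf S)"
  proof (cases "?m = 1")
    case True
    then obtain g where g: "edges_at E v = {g}" by (rule card_1_singletonE)
    have "path_connected (S - {v})" unfolding S by (rule path_connected_minus_leaf[OF G v pcG g])
    moreover have "S - {v} \<noteq> {}" using r by (rule ex_in_conv[THEN iffD1, OF exI])
    ultimately show ?thesis by (rule B.betti_0_leaf[OF refl _ _ pc, unfolded BY])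
  next
    case False
    (* With valence two the arc has to be excluded for S, but in the larger graph v has three edges. *)
    have S1: "path_connected (conf S)"
    proof (cases "?m = 2")
      case True
      then have "\<not> gspace V E homeomorphic {0..1::real}" using arc unfolding S by blast
      then show ?thesis unfolding S by (rule path_connected_conf_2[OF G v pcG True])
    next
      case F2: False
      have "?m \<ge> 3" using False F2 m by linarith
      then show ?thesis unfolding S by (rule path_connected_conf_3[OF G v pcG])
    qed
    note A = lgraph_attach[OF G v w[unfolded S] e[unfolded S]]
    have "path_connected ?Y"
      by (rule path_connected_Un[OF pc]) (use e in \<open>simp_all add: convex_imp_path_connected Int_commute\<close>)
    then have "path_connected (gspace (insert w V) (insert (closed_segment v w) E))" unfolding A(2) S .
    moreover have "card (edges_at (insert (closed_segment v w) E) v) \<ge> 3"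
    proof -
      have "closed_segment v w \<notin> edges_at E v" using A(4) by (simp add: edges_at_def)
      then show ?thesis unfolding A(3) using False m fin by simp
    qed
    ultimately have "path_connected (conf (gspace (insert w V) (insert (closed_segment v w) E)))"
      by (intro path_connected_conf_3[OF A(1)]) (use v in simp_all)
    then have S2: "path_connected (conf ?Y)" unfolding A(2) S .
    have z: "(v, ray_pt V k) \<in> conf S" using r vS by auto
    then have z': "(v, ray_pt V k) \<in> conf ?Y" by auto
    have "conf S \<noteq> {}" "conf ?Y \<noteq> {}" using z z' by (metis empty_iff)+
    then show ?thesis using homology_path_connected(2)[OF S1] homology_path_connected(2)[OF S2] by simp
  qed
  have mv: "int (bnum 1 S) - int (bnum 1 (S - {v})) = int ?m - int (bnum 0 (S - {v}))"
    unfolding S by (rule minus_vertex_betti[OF G v pcG])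
  have S0: "bnum 0 S = 1" using vS by (intro homology_path_connected(2)[OF pc]) blast
  have e1: "bnum p (conf {w}) = 0" for p
  proof -
    have c: "conf {w} = {}" by auto
    show ?thesis unfolding c by simp
  qed
  have e2: "bnum p ({w} - {w}) = 0" for p by simp
  from B.betti_1_0 show "int (bnum 1 (conf ?Y)) - int (bnum 1 (conf S)) = 2 * int ?m - 2"
    unfolding BY e1 e2 Sx(3) b0 S0 using mv by simp
qed

section \<open>Simplicial complexes of dimension one\<close>

lemma simplex_1_segment:
  assumes "1 simplex e"
  obtains a b where "a \<noteq> b" "e = closed_segment a b"
proof -
  obtain C where C: "int (card C) = 1 + 1" "e = convex hull C"
    using assms unfolding simplex_def by blast
  then have "card C = 2" by simp
  then obtain a b where "C = {a, b}" "a \<noteq> b" by (auto simp: card_2_iff)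
  then show ?thesis using that[of a b] C(2) by (simp add: segment_convex_hull)
qed

lemma singleton_face_of_segment:
  fixes x :: "'a::euclidean_space"
  shows "{x} face_of closed_segment a b \<longleftrightarrow> x = a \<or> x = b"
  by (simp add: face_of_singleton extreme_point_of_segment)

lemma proper_face_of_segment:
  assumes "F face_of e" "F \<noteq> e" "F \<noteq> {}" "1 simplex e"
  obtains x where "F = {x}" "{x} face_of e"
proof -
  have "convex e" using assms(4) by (rule convex_simplex)
  then have "aff_dim F < aff_dim e" by (rule face_of_aff_dim_lt) (rule assms(1,2))+
  moreover have "aff_dim e = 1" using assms(4) by (rule aff_dim_simplex)
  moreover have "\<not> aff_dim F < 0" using assms(3) by simp
  ultimately have "aff_dim F = 0" by linarith
  then obtain x where "F = {x}" unfolding aff_dim_eq_0 by blast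
  then show ?thesis using that assms(1) by blast
qed

text \<open>A graph given as a simplicial complex of dimension one becomes a linear graph: the singletons of the complex yield
the vertices.\<close>

definition nodes :: "'a::euclidean_space set set \<Rightarrow> 'a set" where
  "nodes K = {x. {x} \<in> K}"

definition edges :: "'a::euclidean_space set set \<Rightarrow> 'a set set" where
  "edges K = {e \<in> K. 1 simplex e}"

context
  fixes K :: "'a::euclidean_space set set"
  assumes K: "graph_complex K"
begin

lemma complexD:
  shows "finite K" "S \<in> K \<Longrightarrow> F face_of S \<Longrightarrow> F \<in> K" "S \<in> K \<Longrightarrow> T \<in> K \<Longrightarrow> (S \<inter> T) face_of S"
    "S \<in> K \<Longrightarrow> T \<in> K \<Longrightarrow> (S \<inter> T) face_of T"
proof -
  have sc: "simplicial_complex K" using K unfolding graph_complex_def by (elim conjE)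
  show "finite K" "S \<in> K \<Longrightarrow> F face_of S \<Longrightarrow> F \<in> K" and 3: "S \<in> K \<Longrightarrow> T \<in> K \<Longrightarrow> (S \<inter> T) face_of S" for S F T
    using sc unfolding simplicial_complex_def by blast+
  show "S \<in> K \<Longrightarrow> T \<in> K \<Longrightarrow> (S \<inter> T) face_of T" using 3[of T S] by (simp add: Int_commute)
qed

lemma simplex_cases:
  assumes "S \<in> K"
  shows "S = {} \<or> (\<exists>x. S = {x}) \<or> 1 simplex S"
proof -
  obtain n where n: "n simplex S"
    using K assms unfolding graph_complex_def simplicial_complex_def by blast
  have "aff_dim S \<le> 1" using K assms unfolding graph_complex_def by blast
  then consider "aff_dim S < 0" | "aff_dim S = 0" | "aff_dim S = 1" by linarith
  then show ?thesis
  proof cases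
    case 1
    then show ?thesis by simp
  next
    case 2
    then show ?thesis unfolding aff_dim_eq_0 by blast
  next
    case 3
    then show ?thesis using n aff_dim_simplex[OF n] by simp
  qed
qed

lemma node_in_edge:
  assumes "e \<in> edges K" "x \<in> nodes K" "x \<in> e"
  shows "{x} face_of e"
proof -
  have "e \<in> K" "{x} \<in> K" using assms(1,2) by (simp_all add: edges_def nodes_def)
  then have "(e \<inter> {x}) face_of e" by (rule complexD(3))
  moreover have "e \<inter> {x} = {x}" using assms(3) by simp
  ultimately show ?thesis by simp
qed

lemma graph_complex_lgraph: "lgraph (nodes K) (edges K)"
  unfolding lgraph_def
proof (intro conjI ballI impI)
  have "nodes K = (\<lambda>x. {x}) -` K" by (auto simp: nodes_def)
  then show "finite (nodes K)" using finite_vimageI[OF complexD(1), of "\<lambda>x. {x}"] by simp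
  show "finite (edges K)" unfolding edges_def using complexD(1) by simp
next
  fix e assume e: "e \<in> edges K"
  then have eK: "e \<in> K" "1 simplex e" by (simp_all add: edges_def)
  obtain a b where ab: "a \<noteq> b" "e = closed_segment a b" by (rule simplex_1_segment[OF eK(2)])
  have f: "{a} face_of e" "{b} face_of e" unfolding ab(2) singleton_face_of_segment by simp_all
  have n: "a \<in> nodes K" "b \<in> nodes K"
    unfolding nodes_def mem_Collect_eq by (rule complexD(2)[OF eK(1) f(1)], rule complexD(2)[OF eK(1) f(2)])
  have "x = a \<or> x = b" if "x \<in> e" "x \<in> nodes K" for x
    using node_in_edge[OF e that(2,1)] unfolding ab(2) singleton_face_of_segment .
  moreover have "a \<in> e" "b \<in> e" unfolding ab(2) by simp_all
  ultimately have i: "e \<inter> nodes K = {a, b}" using n by blast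
  show "\<exists>a\<in>nodes K. \<exists>b\<in>nodes K. a \<noteq> b \<and> e = closed_segment a b \<and> e \<inter> nodes K = {a, b}"
    by (rule bexI[of _ a], rule bexI[of _ b], (intro conjI ab i n)+)
next
  fix e f assume ef: "e \<in> edges K" "f \<in> edges K" "e \<noteq> f"
  then have K': "e \<in> K" "f \<in> K" "1 simplex e" "1 simplex f" by (simp_all add: edges_def)
  have fe: "(e \<inter> f) face_of e" "(e \<inter> f) face_of f" using complexD(3,4)[OF K'(1,2)] .
  show "e \<inter> f \<subseteq> nodes K"
  proof (cases "e \<inter> f = {}")
    case False
    have "e \<inter> f \<noteq> e \<or> e \<inter> f \<noteq> f" using ef(3) by metis
    then have "\<exists>x. e \<inter> f = {x}"
      using proper_face_of_segment[OF fe(1) _ False K'(3)] proper_face_of_segment[OF fe(2) _ False K'(4)] by metis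
    then obtain x where x: "e \<inter> f = {x}" by blast
    have "{x} \<in> K" using complexD(2)[OF K'(1) fe(1)] unfolding x .
    then show ?thesis unfolding x nodes_def by simp
  qed simp
qed

lemma gspace_complex: "gspace (nodes K) (edges K) = \<Union>K"
proof
  show "gspace (nodes K) (edges K) \<subseteq> \<Union>K" unfolding nodes_def edges_def by blast
  show "\<Union>K \<subseteq> gspace (nodes K) (edges K)"
  proof
    fix x assume "x \<in> \<Union>K"
    then obtain S where S: "S \<in> K" "x \<in> S" by blast
    from simplex_cases[OF S(1)] show "x \<in> gspace (nodes K) (edges K)"
    proof (elim disjE exE)
      assume "S = {}" then show ?thesis using S(2) by simp
    next
      fix y assume "S = {y}" then show ?thesis using S unfolding nodes_def by simp
    next
      assume "1 simplex S" then have "S \<in> edges K" using S(1) by (simp add: edges_def)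
      then show ?thesis using S(2) by blast
    qed
  qed
qed

lemma valence_edges_at:
  assumes "{v} \<in> K"
  shows "valence K v = card (edges_at (edges K) v)"
proof -
  have v: "v \<in> nodes K" using assms by (simp add: nodes_def)
  have "{v} face_of e \<longleftrightarrow> v \<in> e" if "e \<in> edges K" for e
    using node_in_edge[OF that v] face_of_imp_subset[of "{v}" e] by blast
  then have "{e \<in> K. 1 simplex e \<and> {v} face_of e} = edges_at (edges K) v"
    unfolding edges_at_def edges_def by blast
  then show ?thesis by (simp only: valence_def)
qed

end

lemma config2_conf: "config2 (top_of_set S) = top_of_set (conf S)"
proof -
  have "S \<times> S \<inter> {(x, y). x \<noteq> y} = conf S" by auto
  then show ?thesis by (simp add: config2_def subtopology_subtopology)
qed

lemma adds_edgeD: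
  assumes "adds_edge K' K e"
  shows "graph_complex K'" "graph_complex K" "1 simplex e" "e \<notin> K'" "K = K' \<union> {F. F face_of e}"
  using assms unfolding adds_edge_def by blast+

lemma adds_edge_Union:
  assumes "adds_edge K' K e"
  shows "\<Union>K = \<Union>K' \<union> e"
proof -
  note K = adds_edgeD(5,3)[OF assms]
  have "e face_of e" using K(2) by (intro face_of_refl convex_simplex)
  moreover have "F \<subseteq> e" if "F face_of e" for F using that by (rule face_of_imp_subset)
  ultimately show ?thesis unfolding K(1) by blast
qed

text \<open>The intersection of \<open>e\<close> with a simplex of \<open>K'\<close> is a face of \<open>e\<close>. It is a proper one, for otherwise \<open>e\<close>
would be a face of a simplex of \<open>K'\<close>.\<close>

lemma adds_edge_meets:
  assumes "adds_edge K' K (closed_segment a b)"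
  shows "closed_segment a b \<inter> \<Union>K' \<subseteq> {a, b}"
proof
  let ?e = "closed_segment a b"
  note A = adds_edgeD[OF assms]
  fix x assume "x \<in> ?e \<inter> \<Union>K'"
  then obtain S where S: "S \<in> K'" "x \<in> S" "x \<in> ?e" by blast
  have "?e face_of ?e" by (intro face_of_refl convex_closed_segment)
  then have K: "?e \<in> K" "S \<in> K" using S(1) unfolding A(5) by simp_all
  have "?e \<inter> S \<noteq> ?e"
  proof
    assume *: "?e \<inter> S = ?e"
    have "?e face_of S" using complexD(4)[OF A(2) K] unfolding * .
    then have "?e \<in> K'" by (rule complexD(2)[OF A(1) S(1)])
    then show False using A(4) by (rule notE[rotated])
  qed
  moreover have "?e \<inter> S \<noteq> {}" using S(2,3) by blast
  ultimately obtain y where "?e \<inter> S = {y}" "{y} face_of ?e"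
    by (rule proper_face_of_segment[OF complexD(3)[OF A(2) K] _ _ A(3)])
  moreover have "x \<in> ?e \<inter> S" using S(2,3) by (rule IntI[rotated])
  ultimately show "x \<in> {a, b}" by (simp add: singleton_face_of_segment)
qed

theorem attach_pendant_edge:
  assumes add: "adds_edge K' K e" and conn: "connected (\<Union>K')" and v: "{v} \<in> K'" and meet: "\<Union>K' \<inter> e = {v}"
  shows "hgroup 2 (conf (\<Union>K')) \<cong> hgroup 2 (conf (\<Union>K))"
    and "\<not> (\<Union>K' homeomorphic {0..1::real} \<and> valence K' v = 2) \<Longrightarrow>
      int (bnum 1 (conf (\<Union>K))) - int (bnum 1 (conf (\<Union>K'))) = 2 * int (valence K' v) - 2"
proof -
  note A = adds_edgeD(1-3)[OF add]
  define S where "S = \<Union>K'"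
  note G = graph_complex_lgraph[OF A(1)]
  have S: "S = gspace (nodes K') (edges K')" unfolding S_def by (rule gspace_complex[OF A(1), symmetric])
  have vN: "v \<in> nodes K'" using v by (simp add: nodes_def)
  obtain w where w: "w \<noteq> v" "e = closed_segment v w"
  proof -
    obtain a b where ab: "a \<noteq> b" "e = closed_segment a b" by (rule simplex_1_segment[OF A(3)])
    have "v \<in> closed_segment a b \<inter> \<Union>K'" using meet unfolding ab(2) by blast
    then have "v \<in> {a, b}" using adds_edge_meets[OF add[unfolded ab(2)]] by (rule subsetD[rotated])
    then show ?thesis using that[of b] that[of a] ab by (auto simp: closed_segment_commute)
  qed
  have e: "closed_segment v w \<inter> S = {v}" using meet unfolding S_def w(2) by (simp only: Int_commute)
  have wS: "w \<notin> S"
  proof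
    assume "w \<in> S"
    then have "w \<in> closed_segment v w \<inter> S" by simp
    then show False using w(1) unfolding e by simp
  qed
  have "locally path_connected S" unfolding S by (rule convex_pieces_locally[OF convex_pieces_gspace[OF G]])
  then have pc: "path_connected S"
    using conn[folded S_def]
    by (simp add: path_connected_component path_component_eq_connected_component connected_iff_connected_component)
  have ne: "edges_at (edges K') v \<noteq> {}"
  proof
    assume "edges_at (edges K') v = {}"
    then have "gspace (nodes K') (edges K') = {v}" by (rule no_edges_at[OF G vN pc[unfolded S]])
    then have Sv: "\<Union>K' = {v}" unfolding S[symmetric] S_def .
    obtain T where T: "T \<in> K'" "aff_dim T = 1" using A(1) unfolding graph_complex_def by blast
    then have "T \<subseteq> {v}" unfolding Sv[symmetric] by blast
    then have "aff_dim T \<le> aff_dim {v}" by (rule aff_dim_subset)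
    then show False using T(2) by simp
  qed
  have U: "\<Union>K = S \<union> closed_segment v w" unfolding adds_edge_Union[OF add] S_def w(2) ..
  note W = attach_whisker[OF G vN S pc wS e ne]
  show "hgroup 2 (conf (\<Union>K')) \<cong> hgroup 2 (conf (\<Union>K))"
    using W(1) unfolding U S_def[symmetric] .
  show "int (bnum 1 (conf (\<Union>K))) - int (bnum 1 (conf (\<Union>K'))) = 2 * int (valence K' v) - 2"
    if "\<not> (\<Union>K' homeomorphic {0..1::real} \<and> valence K' v = 2)"
    using W(2) that unfolding U S_def[symmetric] valence_edges_at[OF A(1) v] .
qed

text \<open>Each component is a graph, because an edge is connected and thus lies in a component or misses it.\<close>

theorem attach_connecting_edge:
  assumes add: "adds_edge K' K (closed_segment a b)" and C: "components (\<Union>K') = {C1, C2}" "C1 \<noteq> C2"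
    and ab: "{a} \<in> K'" "{b} \<in> K'" "a \<in> C1" "b \<in> C2"
  shows "bnum 2 (conf (\<Union>K)) = bnum 2 (conf C1) + bnum 2 (conf C2) + 2 * bnum 1 C1 * bnum 1 C2"
proof -
  note K' = adds_edgeD(1)[OF add]
  note G = graph_complex_lgraph[OF K'] and sp = gspace_complex[OF K']
  have comp: "C1 \<in> components (\<Union>K')" "C2 \<in> components (\<Union>K')" unfolding C(1) by simp_all
  have un: "C1 \<union> C2 = \<Union>K'" using Union_components[of "\<Union>K'"] unfolding C(1) by simp
  have disj: "C1 \<inter> C2 = {}" using components_nonoverlap[OF comp] C(2) by simp
  have R: "lgraph (nodes K' \<inter> D) {g \<in> edges K'. g \<subseteq> D}" "gspace (nodes K' \<inter> D) {g \<in> edges K'. g \<subseteq> D} = D"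
    if D: "D \<in> components (\<Union>K')" for D
  proof -
    have sub: "D \<subseteq> gspace (nodes K') (edges K')" unfolding sp using D by (rule in_components_subset)
    have split: "g \<inter> D \<subseteq> nodes K' \<or> g \<subseteq> D" if g: "g \<in> edges K'" for g
    proof (cases "D \<inter> g = {}")
      case True
      then show ?thesis by blast
    next
      case False
      have "connected g" using g by (auto simp: edges_def intro: convex_connected convex_simplex)
      moreover have "g \<subseteq> \<Union>K'" using g by (auto simp: edges_def)
      ultimately have "g \<subseteq> D" using False by (rule components_maximal[OF D])
      then show ?thesis ..
    qed
    show "lgraph (nodes K' \<inter> D) {g \<in> edges K'. g \<subseteq> D}" "gspace (nodes K' \<inter> D) {g \<in> edges K'. g \<subseteq> D} = D"
      by (rule lgraph_restrict[OF G sub], erule split)+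
  qed
  have ends: "closed_segment a b \<inter> \<Union>K' \<subseteq> {a, b}" by (rule adds_edge_meets[OF add])
  interpret B: graph_bridge C1 C2 a b "nodes K' \<inter> C1" "nodes K' \<inter> C2" "{g \<in> edges K'. g \<subseteq> C1}" "{g \<in> edges K'. g \<subseteq> C2}"
  proof (intro graph_bridge.intro bridge.intro graph_bridge_axioms.intro R comp ab(3,4) disj)
    show "compact C1" "compact C2"
      using convex_pieces_compact[OF convex_pieces_gspace[OF R(1)]] comp unfolding R(2)[OF comp(1)] R(2)[OF comp(2)]
      by (metis R(2))+
    have "a \<in> closed_segment a b" "b \<in> closed_segment a b" by simp_all
    then show "closed_segment a b \<inter> C1 = {a}" "closed_segment a b \<inter> C2 = {b}"
      using ends ab(3,4) disj unfolding un[symmetric] by blast+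
    show "C1 = gspace (nodes K' \<inter> C1) {g \<in> edges K'. g \<subseteq> C1}" "C2 = gspace (nodes K' \<inter> C2) {g \<in> edges K'. g \<subseteq> C2}"
      by (rule R(2)[symmetric], rule comp)+
    show "a \<in> nodes K' \<inter> C1" "b \<in> nodes K' \<inter> C2" using ab by (simp_all add: nodes_def)
  qed
  have "B.Y = \<Union>K" unfolding B.Y_def adds_edge_Union[OF add] un ..
  then show ?thesis using B.betti_2_graph_bridge by (simp only:)
qed

theorem theorem7:
  shows
    "(\<forall>(K' :: 'a::euclidean_space set set) K e v.
        adds_edge K' K e \<and> connected (\<Union>K') \<and> {v} \<in> K' \<and> \<Union>K' \<inter> e = {v} \<longrightarrow>
          homology_group 2 (config2 (top_of_set (\<Union>K')))
            \<cong> homology_group 2 (config2 (top_of_set (\<Union>K))) \<and>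
          (\<not> (\<Union>K' homeomorphic {0..1::real} \<and> valence K' v = 2) \<longrightarrow>
             int (betti 1 (config2 (top_of_set (\<Union>K))))
               - int (betti 1 (config2 (top_of_set (\<Union>K'))))
             = 2 * int (valence K' v) - 2))
     \<and>
     (\<forall>(K' :: 'a set set) K e C1 C2 a b.
        adds_edge K' K e \<and> components (\<Union>K') = {C1, C2} \<and> C1 \<noteq> C2 \<and>
        {a} \<in> K' \<and> {b} \<in> K' \<and> a \<in> C1 \<and> b \<in> C2 \<and> e = closed_segment a b \<longrightarrow>
          betti 2 (config2 (top_of_set (\<Union>K)))
            = betti 2 (config2 (top_of_set C1)) + betti 2 (config2 (top_of_set C2))
              + 2 * betti 1 (top_of_set C1) * betti 1 (top_of_set C2))"
  unfolding config2_conf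
proof (intro conjI allI impI; elim conjE)
  fix K' K :: "'a set set" and e v
  assume *: "adds_edge K' K e" "connected (\<Union>K')" "{v} \<in> K'" "\<Union>K' \<inter> e = {v}"
  show "hgroup 2 (conf (\<Union>K')) \<cong> hgroup 2 (conf (\<Union>K))"
    using * by (rule attach_pendant_edge(1))
  assume "\<not> (\<Union>K' homeomorphic {0..1::real} \<and> valence K' v = 2)"
  with * show "int (bnum 1 (conf (\<Union>K))) - int (bnum 1 (conf (\<Union>K'))) = 2 * int (valence K' v) - 2"
    by (rule attach_pendant_edge(2))
next
  fix K' K :: "'a set set" and e C1 C2 a b
  assume *: "adds_edge K' K e" "components (\<Union>K') = {C1, C2}" "C1 \<noteq> C2" "{a} \<in> K'" "{b} \<in> K'" "a \<in> C1" "b \<in> C2"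
    and e: "e = closed_segment a b"
  from *(1) have "adds_edge K' K (closed_segment a b)" unfolding e .
  then show "bnum 2 (conf (\<Union>K)) = bnum 2 (conf C1) + bnum 2 (conf C2) + 2 * bnum 1 C1 * bnum 1 C2"
    by (rule attach_connecting_edge[OF _ *(2-)])
qed

end
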